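(* Every triangle-free planar graph $G$ with at least two vertices satisfies $\rho_2(G)\ge 1/723636$.
   Context: Firefighter process: in a finite simple graph $G$, a fire starts at time $0$ at a vertex $v$. At each subsequent time step, the firefighters first protect at most $k$ vertices that are not burning (protection is permanent), and then the fire spreads from every burning vertex to all its unprotected neighbours. A vertex is saved if it never burns. Let $sn_k(G,v)$ be the maximum number of vertices of $G$ that can be saved when the fire starts at $v$. For a graph $G$ on $n$ vertices, the $k$-surviving rate is $\rho_k(G)=\frac{1}{n^2}\sum_{v\in V(G)} sn_k(G,v)$. *)

theory Defs
  imports "HOL-Analysis.Analysis"
begin

definition simple_graph :: "'a set \<Rightarrow> 'a set set \<Rightarrow> bool" where
  "simple_graph V E \<longleftrightarrow> finite V \<and>
     (\<forall>e\<in>E. \<exists>u v. u \<in> V \<and> v \<in> V \<and> u \<noteq> v \<and> e = {u, v})"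

definition triangle_free :: "'a set \<Rightarrow> 'a set set \<Rightarrow> bool" where
  "triangle_free V E \<longleftrightarrow>
     \<not> (\<exists>a\<in>V. \<exists>b\<in>V. \<exists>c\<in>V. {a, b} \<in> E \<and> {b, c} \<in> E \<and> {a, c} \<in> E)"

definition planar :: "'a set \<Rightarrow> 'a set set \<Rightarrow> bool" where
  "planar V E \<longleftrightarrow>
     (\<exists>(pos :: 'a \<Rightarrow> complex) (\<gamma> :: 'a set \<Rightarrow> real \<Rightarrow> complex).
        inj_on pos V \<and>
        (\<forall>e\<in>E. arc (\<gamma> e) \<and> {pathstart (\<gamma> e), pathfinish (\<gamma> e)} = pos ` e) \<and>
        (\<forall>e\<in>E. \<forall>v\<in>V. pos v \<in> path_image (\<gamma> e) \<longrightarrow> v \<in> e) \<and>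
        (\<forall>e\<in>E. \<forall>e'\<in>E. e \<noteq> e' \<longrightarrow>
            path_image (\<gamma> e) \<inter> path_image (\<gamma> e') \<subseteq> pos ` (e \<inter> e')))"

text \<open>Firefighter process. A strategy S gives for each time step t \<ge> 1 the set
  S t of vertices newly protected at time t (S 0 is ignored).
  burning V E S v t is the set of vertices burning after time step t when the
  fire starts at v.\<close>
primrec burning :: "'a set \<Rightarrow> 'a set set \<Rightarrow> (nat \<Rightarrow> 'a set) \<Rightarrow> 'a \<Rightarrow> nat \<Rightarrow> 'a set" where
  "burning V E S v 0 = {v}"
| "burning V E S v (Suc t) = burning V E S v t \<union>
     {w \<in> V. w \<notin> (\<Union>i\<in>{1..Suc t}. S i) \<and> (\<exists>u\<in>burning V E S v t. {u, w} \<in> E)}"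

definition valid_strategy :: "nat \<Rightarrow> 'a set \<Rightarrow> 'a set set \<Rightarrow> 'a \<Rightarrow> (nat \<Rightarrow> 'a set) \<Rightarrow> bool" where
  "valid_strategy k V E v S \<longleftrightarrow>
     (\<forall>t. S (Suc t) \<subseteq> V - burning V E S v t \<and> finite (S (Suc t)) \<and> card (S (Suc t)) \<le> k)"

definition saved :: "'a set \<Rightarrow> 'a set set \<Rightarrow> (nat \<Rightarrow> 'a set) \<Rightarrow> 'a \<Rightarrow> 'a set" where
  "saved V E S v = V - (\<Union>t. burning V E S v t)"

definition sn :: "nat \<Rightarrow> 'a set \<Rightarrow> 'a set set \<Rightarrow> 'a \<Rightarrow> nat" where
  "sn k V E v = Max {card (saved V E S v) | S. valid_strategy k V E v S}"

definition surviving_rate :: "nat \<Rightarrow> 'a set \<Rightarrow> 'a set set \<Rightarrow> real" where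
  "surviving_rate k V E = (\<Sum>v\<in>V. real (sn k V E v)) / (real (card V))\<^sup>2"

end

(* The idea is to save a constant fraction of the vertices whenever the fire starts at a vertex of
   degree at most 3, or at a vertex of degree 4 all of whose neighbours have degree at most 4.
   A triangle-free planar graph has average degree at most 4, so such vertices are a positive
   fraction of all vertices.

   For a breadth-first tree rooted at the burning vertex v, a Lipton-Tarjan cycle separator consists
   of two tree paths.  Two firefighters suffice to protect the vertices of both paths just in time,
   level by level, and then the fire spreads to only one side of the cycle, provided that in the
   first step there is time to protect the neighbours of v on the other side.  The only obstacle is
   a vertex v of degree 4 with two neighbours on the cycle and one on each side.  It is overcome by
   breaking ties in the tree: if all geodesics to the vertices of one of the paths start at vertices
   protected in the first step, that path may be protected one step late, which yields the missing
   firefighter.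

   Planarity enters only through the fact that the graph is a minor of a finite square grid, in
   which cycles mod 2 are coboundaries of sets of unit squares.  Separators and the edge bound
   are derived from this without faces or rotation systems: the regions enclosed by the fundamental
   cycles of a spanning tree of the grid form a laminar family. *)
theory Submission
  imports Defs "HOL-Library.Z2"
begin

text \<open>In the hard case a vertex \<open>v\<close> of degree 4 has two neighbours
  \<open>wi\<close>, \<open>wj\<close> on the separator and one, \<open>wk\<close>, on the side to
  be saved: three vertices for two firefighters. Then \<open>wj\<close> is given up, and its
  neighbours on that side become due in step 2. There is room for them if the path through
  \<open>wi\<close> runs one step late, which is safe when all geodesics to it start at
  \<open>wi\<close> or \<open>wk\<close>. Since \<open>wj\<close> has degree at most 4, some side
  always works, provided at most one neighbour of \<open>v\<close> has lower priority than
  \<open>wi\<close>. This fails only if \<open>wi\<close>, \<open>wj\<close> are the two neighbours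
  of highest priority, and for that pair a separator of another kind is wanted: one that leaves a
  side without neighbours of \<open>v\<close>. It comes from splitting \<open>v\<close> into two
  adjacent vertices. A drawing known only as a minor offers no cyclic order around \<open>v\<close>,
  so the split cuts the branch set of \<open>v\<close> into two connected parts with two exits each,
  and this is possible because the host can be taken of maximum degree 3. The pair is dictated by
  the cut, and the priorities are chosen after it. The outcome is 1/400: at least 1/25 of the
  vertices are good, and a fire at a good vertex leaves at least 1/16 of the graph.\<close>

section \<open>Cycles of the square grid as coboundaries\<close>

text \<open>These simplification rules would replace field arithmetic on bits by bitwise operations.\<close>

declare add_bit_eq_xor [simp del] mult_bit_eq_and [simp del]

type_synonym pixel = "int \<times> int"

text \<open>Connectedness expressed by cuts, so that a connected set directly yields an edge leaving
  any proper nonempty part. The empty set counts as connected.\<close>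

definition linked :: "('b \<Rightarrow> 'b \<Rightarrow> bool) \<Rightarrow> 'b set \<Rightarrow> bool" where
  "linked adj B \<longleftrightarrow> (\<forall>X\<subseteq>B. X \<noteq> {} \<longrightarrow> X \<noteq> B \<longrightarrow> (\<exists>a\<in>X. \<exists>b\<in>B - X. adj a b))"

definition nb :: "pixel \<Rightarrow> pixel set" where
  "nb p = {(fst p + 1, snd p), (fst p - 1, snd p), (fst p, snd p + 1), (fst p, snd p - 1)}"

definition gadj :: "pixel \<Rightarrow> pixel \<Rightarrow> bool" where
  "gadj p q \<longleftrightarrow> q \<in> nb p"

definition gedge :: "pixel set set" where
  "gedge = {{p, q} | p q. gadj p q}"

text \<open>The degree mod 2 at \<open>p\<close>. Cycles mod 2 are the edge sets whose boundary
  \<open>bd\<close> vanishes everywhere.\<close>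

definition bd :: "(pixel set \<Rightarrow> bit) \<Rightarrow> pixel \<Rightarrow> bit" where
  "bd x p = (\<Sum>q\<in>nb p. x {p, q})"

text \<open>A unit square is identified with its lower left corner. The edge \<open>e\<close> of the grid separates
  the squares \<open>sq1 e\<close> and \<open>sq2 e\<close>, so \<open>cob S\<close> is the boundary of a set \<open>S\<close> of squares.\<close>

definition sq1 :: "pixel set \<Rightarrow> pixel" where
  "sq1 e = (Min (fst ` e), Min (snd ` e))"

definition sq2 :: "pixel set \<Rightarrow> pixel" where
  "sq2 e = (if card (fst ` e) = 1 then (fst (sq1 e) - 1, snd (sq1 e)) else (fst (sq1 e), snd (sq1 e) - 1))"

definition cob :: "(pixel \<Rightarrow> bit) \<Rightarrow> pixel set \<Rightarrow> bit" where
  "cob S e = S (sq1 e) + S (sq2 e)"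

lemma bit_double [simp]: "(x::bit) + x = 0"
  by (cases x) auto

lemma bit_add_zero_iff: "(x::bit) + y = 0 \<longleftrightarrow> x = y"
  by (cases x; cases y) auto

lemma gadj_sym: "gadj p q \<longleftrightarrow> gadj q p"
  by (cases p; cases q) (auto simp: gadj_def nb_def)

lemma gadj_irrefl: "\<not> gadj p p"
  by (cases p) (auto simp: gadj_def nb_def)

lemma finite_nb [simp]: "finite (nb p)"
  by (simp add: nb_def)

lemma gedge_cases:
  assumes "e \<in> gedge"
  obtains (hor) i j where "e = {(i, j), (i + 1, j)}" | (ver) i j where "e = {(i, j), (i, j + 1)}"
proof -
  obtain p q where e: "e = {p, q}" "gadj p q" using assms by (auto simp: gedge_def)
  obtain a b where p: "p = (a, b)" by (cases p)
  have "q = (a + 1, b) \<or> q = (a - 1, b) \<or> q = (a, b + 1) \<or> q = (a, b - 1)"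
    using e(2) p by (auto simp: gadj_def nb_def)
  then show thesis
  proof (elim disjE)
    assume "q = (a + 1, b)" then show thesis using hor[of a b] e p by simp
  next
    assume "q = (a - 1, b)" then show thesis using hor[of "a - 1" b] e p by (simp add: insert_commute)
  next
    assume "q = (a, b + 1)" then show thesis using ver[of a b] e p by simp
  next
    assume "q = (a, b - 1)" then show thesis using ver[of a "b - 1"] e p by (simp add: insert_commute)
  qed
qed

lemma hor_gedge [simp]: "{(i, j), (i + 1, j)} \<in> gedge" "{(i - 1, j), (i, j)} \<in> gedge"
  by (auto simp: gedge_def gadj_def nb_def)

lemma ver_gedge [simp]: "{(i, j), (i, j + 1)} \<in> gedge" "{(i, j - 1), (i, j)} \<in> gedge"
  by (auto simp: gedge_def gadj_def nb_def)

lemma sq_hor [simp]: "sq1 {(i, j), (i + 1, j)} = (i, j)" "sq2 {(i, j), (i + 1, j)} = (i, j - 1)"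
  by (auto simp: sq1_def sq2_def)

lemma sq_ver [simp]: "sq1 {(i, j), (i, j + 1)} = (i, j)" "sq2 {(i, j), (i, j + 1)} = (i - 1, j)"
  by (auto simp: sq1_def sq2_def)

lemma cob_hor: "cob S {(i, j), (i + 1, j)} = S (i, j) + S (i, j - 1)"
  by (simp add: cob_def)

lemma cob_ver: "cob S {(i, j), (i, j + 1)} = S (i, j) + S (i - 1, j)"
  by (simp add: cob_def)

lemma bd_explicit:
  "bd x (i, j) = x {(i, j), (i + 1, j)} + x {(i - 1, j), (i, j)} + x {(i, j), (i, j + 1)} + x {(i, j - 1), (i, j)}"
  by (simp add: bd_def nb_def insert_commute algebra_simps)

text \<open>Each of the four squares around \<open>p\<close> borders two of the four edges at
  \<open>p\<close>, so it is counted twice.\<close>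

lemma bd_cob: "bd (cob S) p = 0"
proof -
  obtain i j where p: "p = (i, j)" by (cases p)
  have 1: "cob S {(i - 1, j), (i, j)} = S (i - 1, j) + S (i - 1, j - 1)"
    using cob_hor[of S "i - 1" j] by simp
  have 2: "cob S {(i, j - 1), (i, j)} = S (i, j - 1) + S (i - 1, j - 1)"
    using cob_ver[of S i "j - 1"] by simp
  show ?thesis
    unfolding p bd_explicit 1 2 cob_hor cob_ver
    by (cases "S (i,j)"; cases "S (i-1,j)"; cases "S (i,j-1)"; cases "S (i-1,j-1)") auto
qed

text \<open>Vertical edges do not separate the squares of a row, so a nonzero value would repeat
  along the whole row.\<close>

lemma cob_zero:
  assumes fin: "finite {f. S f \<noteq> 0}" and z: "\<And>e. e \<in> gedge \<Longrightarrow> cob S e = 0"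
  shows "S f = 0"
proof (rule ccontr)
  obtain i j where f: "f = (i, j)" by (cases f)
  assume "S f \<noteq> 0"
  have "S (i + int n, j) = S (i, j)" for n
  proof (induction n)
    case (Suc n)
    have "cob S {(i + int n + 1, j), (i + int n + 1, j + 1)} = 0" by (rule z) simp
    then have "S (i + int n + 1, j) = S (i + int n, j)" unfolding cob_ver by (simp add: bit_add_zero_iff)
    then show ?case using Suc by (simp add: algebra_simps)
  qed simp
  then have "range (\<lambda>n. (i + int n, j)) \<subseteq> {f. S f \<noteq> 0}" using \<open>S f \<noteq> 0\<close> f by auto
  moreover have "infinite (range (\<lambda>n. (i + int n, j)))"
    by (rule range_inj_infinite) (auto simp: inj_on_def)
  ultimately show False using fin finite_subset by blast
qed

lemma finite_pixels_box:
  assumes "finite (A :: pixel set)"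
  obtains N :: int where "N > 0" "\<And>i j. (i, j) \<in> A \<Longrightarrow> \<bar>i\<bar> < N \<and> \<bar>j\<bar> < N"
proof -
  let ?B = "insert 0 ((\<lambda>p. \<bar>fst p\<bar>) ` A \<union> (\<lambda>p. \<bar>snd p\<bar>) ` A)"
  have fin: "finite ?B" using assms by simp
  show thesis
  proof (rule that[of "Max ?B + 1"])
    have "0 \<le> Max ?B" using fin by (intro Max_ge) auto
    then show "Max ?B + 1 > 0" by simp
  next
    fix i j assume "(i, j) \<in> A"
    then have "\<bar>i\<bar> \<in> ?B" "\<bar>j\<bar> \<in> ?B" by force+
    then have "\<bar>i\<bar> \<le> Max ?B" "\<bar>j\<bar> \<le> Max ?B" using fin by (auto intro: Max_ge)
    then show "\<bar>i\<bar> < Max ?B + 1 \<and> \<bar>j\<bar> < Max ?B + 1" by simp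
  qed
qed

text \<open>Inside and outside are told apart by a ray: a square is inside iff the ray from it to
  the left crosses an odd number of vertical edges. Horizontal edges then come out right by
  induction from the left, using evenness at one vertex per step.\<close>

lemma even_is_cob:
  assumes fin: "finite {e\<in>gedge. x e \<noteq> 0}" and ev: "\<And>p. bd x p = 0"
  obtains S where "finite {f. S f \<noteq> 0}" "\<And>e. e \<in> gedge \<Longrightarrow> x e = cob S e"
proof -
  have fe: "finite e" if "e \<in> gedge" for e using that by (auto simp: gedge_def)
  then have finU: "finite (\<Union>{e\<in>gedge. x e \<noteq> 0})" using fin by (intro finite_Union) auto
  obtain N :: int where "N > 0"
    and N: "\<And>i j. (i, j) \<in> \<Union>{e\<in>gedge. x e \<noteq> 0} \<Longrightarrow> \<bar>i\<bar> < N \<and> \<bar>j\<bar> < N"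
    using finite_pixels_box[OF finU] by blast
  have h0: "x {(i, j), (i + 1, j)} = 0" if "\<not> \<bar>i\<bar> < N \<or> \<not> \<bar>j\<bar> < N" for i j
  proof (rule ccontr)
    assume "x {(i, j), (i + 1, j)} \<noteq> 0"
    then have "(i, j) \<in> \<Union>{e\<in>gedge. x e \<noteq> 0}"
      by (intro UnionI[of "{(i, j), (i + 1, j)}"]) (simp_all del: bit_not_zero_iff)
    then show False using N that by blast
  qed
  have v0: "x {(i, j), (i, j + 1)} = 0" if "\<not> \<bar>i\<bar> < N \<or> \<not> \<bar>j\<bar> < N" for i j
  proof (rule ccontr)
    assume "x {(i, j), (i, j + 1)} \<noteq> 0"
    then have "(i, j) \<in> \<Union>{e\<in>gedge. x e \<noteq> 0}"
      by (intro UnionI[of "{(i, j), (i, j + 1)}"]) (simp_all del: bit_not_zero_iff)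
    then show False using N that by blast
  qed
  define S where "S = (\<lambda>(i, j). \<Sum>k\<in>{-N..i}. x {(k, j), (k, j + 1)})"
  have Slow: "S (i, j) = 0" if "i \<le> -N" for i j
  proof -
    have "x {(k, j), (k, j + 1)} = 0" if "k \<in> {-N..i}" for k
      using v0[of k j] that \<open>i \<le> -N\<close> \<open>N > 0\<close> by auto
    then show ?thesis unfolding S_def by (simp add: sum.neutral)
  qed
  have ver: "x {(i, j), (i, j + 1)} = S (i, j) + S (i - 1, j)" for i j
  proof (cases "i \<ge> -N")
    case True
    then have "{-N..i} = insert i {-N..i - 1}" by auto
    then have "S (i, j) = x {(i, j), (i, j + 1)} + S (i - 1, j)"
      by (simp add: S_def)
    then show ?thesis by (metis add.assoc add.commute bit_double add_0)
  next
    case False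
    then show ?thesis using Slow[of i j] Slow[of "i - 1" j] v0[of i j] \<open>N > 0\<close> by auto
  qed
  have hor: "x {(i, j), (i + 1, j)} = S (i, j) + S (i, j - 1)" for i j
  proof -
    have *: "x {(-N + int n, j), (-N + int n + 1, j)} = S (-N + int n, j) + S (-N + int n, j - 1)" for n
    proof (induction n)
      case 0
      then show ?case using Slow[of "-N" j] Slow[of "-N" "j - 1"] h0[of "-N" j] \<open>N > 0\<close> by simp
    next
      case (Suc n)
      let ?i = "-N + int n + 1"
      have "bd x (?i, j) = 0" by (rule ev)
      then have "x {(?i, j), (?i + 1, j)} = x {(?i - 1, j), (?i, j)} + x {(?i, j), (?i, j + 1)} + x {(?i, j - 1), (?i, j)}"
        unfolding bd_explicit by (simp only: bit_add_zero_iff add.assoc)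
      also have "x {(?i - 1, j), (?i, j)} = S (?i - 1, j) + S (?i - 1, j - 1)"
        using Suc by simp
      also have "x {(?i, j), (?i, j + 1)} = S (?i, j) + S (?i - 1, j)" by (rule ver)
      also have "x {(?i, j - 1), (?i, j)} = S (?i, j - 1) + S (?i - 1, j - 1)"
        using ver[of ?i "j - 1"] by simp
      finally have "x {(?i, j), (?i + 1, j)} = S (?i, j) + S (?i, j - 1)"
        by (cases "S (?i,j)"; cases "S (?i-1,j)"; cases "S (?i,j-1)"; cases "S (?i-1,j-1)") auto
      moreover have "- N + int (Suc n) = ?i" by simp
      ultimately show ?case by (simp only:)
    qed
    show ?thesis
    proof (cases "i \<ge> -N")
      case True
      then show ?thesis using *[of "nat (i + N)"] by simp
    next
      case False
      then show ?thesis using Slow[of i j] Slow[of i "j - 1"] h0[of i j] \<open>N > 0\<close> by auto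
    qed
  qed
  have Srow: "S (i, j) = 0" if "\<not> \<bar>j\<bar> < N" for i j
    unfolding S_def using v0 that by (simp add: sum.neutral)
  \<comment> \<open>The ray definition alone does not bound the support on the right. There no
    horizontal edge is used, so each column is constant, with value 0 at the bottom row.\<close>
  have Shigh: "S (i, j) = 0" if "i \<ge> N" for i j
  proof -
    have "S (i, -N + int n) = 0" for n
    proof (induction n)
      case 0 then show ?case using Srow \<open>N > 0\<close> by simp
    next
      case (Suc n)
      have "x {(i, -N + int n + 1), (i + 1, -N + int n + 1)} = 0" using h0[of i "-N + int n + 1"] that \<open>N > 0\<close> by auto
      then have "S (i, -N + int n + 1) = S (i, -N + int n)" using hor[of i "-N + int n + 1"]
        by (simp add: bit_add_zero_iff)
      moreover have "- N + int (Suc n) = - N + int n + 1" by simp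
      ultimately show ?case using Suc by (simp only:)
    qed
    from this[of "nat (j + N)"] show ?thesis using Srow[of j i] by (cases "j \<ge> -N") auto
  qed
  have "{f. S f \<noteq> 0} \<subseteq> {-N..N} \<times> {-N..N}"
  proof (clarsimp)
    fix i j assume "S (i, j) = 1"
    then have "\<not> i \<le> -N" "\<not> i \<ge> N" "\<bar>j\<bar> < N" using Slow[of i j] Shigh[of i j] Srow[of j i] by auto
    then show "-N \<le> i \<and> i \<le> N \<and> -N \<le> j \<and> j \<le> N" by auto
  qed
  then have "finite {f. S f \<noteq> 0}" by (rule finite_subset) simp
  moreover have "x e = cob S e" if "e \<in> gedge" for e
    using that by (cases rule: gedge_cases) (simp_all add: hor ver cob_def)
  ultimately show thesis using that by blast
qed

section \<open>Spanning trees of grid regions and their fundamental cycles\<close>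

text \<open>Parent steps stop at \<open>r\<close>, so in a tree with root \<open>r\<close> this is
  the vertex set of the path from \<open>s\<close> to the root, both ends included.\<close>

definition anc :: "('b \<Rightarrow> 'b) \<Rightarrow> 'b \<Rightarrow> 'b \<Rightarrow> 'b set" where
  "anc par r s = {u. (s, u) \<in> {(w, par w) | w. w \<noteq> r}\<^sup>*}"

lemma anc_self [simp]: "s \<in> anc par r s"
  by (simp add: anc_def)

lemma anc_root [simp]: "anc par r r = {r}"
proof -
  have "u = r" if "(r, u) \<in> {(w, par w) | w. w \<noteq> r}\<^sup>*" for u
    using that by (induction rule: rtrancl_induct) auto
  then show ?thesis by (auto simp: anc_def)
qed

lemma anc_step: "s \<noteq> r \<Longrightarrow> anc par r s = insert s (anc par r (par s))"
proof -
  assume "s \<noteq> r"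
  then have "(s, par s) \<in> {(w, par w) | w. w \<noteq> r}" by auto
  moreover have "u = s \<or> (par s, u) \<in> {(w, par w) | w. w \<noteq> r}\<^sup>*"
    if "(s, u) \<in> {(w, par w) | w. w \<noteq> r}\<^sup>*" for u
    using that by (auto elim!: converse_rtranclE)
  ultimately show ?thesis
    by (auto simp: anc_def intro: converse_rtrancl_into_rtrancl)
qed

lemma anc_linear:
  assumes "a \<in> anc par r x" "b \<in> anc par r x"
  shows "a \<in> anc par r b \<or> b \<in> anc par r a"
proof -
  have "single_valued {(w, par w) | w. w \<noteq> r}" by (auto simp: single_valued_def)
  from single_valued_confluent[OF this] show ?thesis using assms by (auto simp: anc_def)
qed

text \<open>Search from the root. The relation \<open>P\<close> is arbitrary because it may
  prescribe more than adjacency: in this way grid trees are made to follow a given tree of the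
  graph. The numbers \<open>d\<close> certify that parent steps terminate.\<close>

lemma grow_tree:
  assumes fin: "finite M" and r: "r \<in> M"
    and grow: "\<And>U. r \<in> U \<Longrightarrow> U \<subset> M \<Longrightarrow> \<exists>s\<in>M - U. \<exists>a\<in>U. P s a"
  shows "\<exists>par (d :: 'b \<Rightarrow> nat). \<forall>s\<in>M - {r}. par s \<in> M \<and> P s (par s) \<and> d (par s) < d s"
proof -
  have "\<exists>U par (d :: 'b \<Rightarrow> nat). r \<in> U \<and> U \<subseteq> M \<and> card U = Suc n \<and>
      (\<forall>s\<in>U - {r}. par s \<in> U \<and> P s (par s) \<and> d (par s) < d s)" if "Suc n \<le> card M" for n
    using that
  proof (induction n)
    case 0
    show ?case by (rule exI[of _ "{r}"]) (use r in auto)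
  next
    case (Suc n)
    then have "Suc n \<le> card M" by simp
    from Suc.IH[OF this] obtain U par and d :: "'b \<Rightarrow> nat" where
      *: "r \<in> U \<and> U \<subseteq> M \<and> card U = Suc n \<and> (\<forall>s\<in>U - {r}. par s \<in> U \<and> P s (par s) \<and> d (par s) < d s)"
      by (elim exE)
    then have U: "r \<in> U" "U \<subseteq> M" "card U = Suc n" by simp_all
    have t: "par s \<in> U \<and> P s (par s) \<and> d (par s) < d s" if "s \<in> U - {r}" for s using * that by blast
    have "U \<noteq> M" using U(3) Suc.prems by auto
    then obtain s a where sa: "s \<in> M - U" "a \<in> U" "P s a" using grow U by blast
    have "finite U" using U(2) fin finite_subset by auto
    show ?case
    proof (rule exI[of _ "insert s U"], rule exI[of _ "par(s := a)"], rule exI[of _ "d(s := Suc (d a))"], intro conjI)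
      show "card (insert s U) = Suc (Suc n)" using sa U \<open>finite U\<close> by simp
      show "\<forall>sa\<in>insert s U - {r}. (par(s := a)) sa \<in> insert s U \<and> P sa ((par(s := a)) sa) \<and>
          (d(s := Suc (d a))) ((par(s := a)) sa) < (d(s := Suc (d a))) sa"
      proof
        fix u assume u: "u \<in> insert s U - {r}"
        show "(par(s := a)) u \<in> insert s U \<and> P u ((par(s := a)) u) \<and>
          (d(s := Suc (d a))) ((par(s := a)) u) < (d(s := Suc (d a))) u"
        proof (cases "u = s")
          case True
          then show ?thesis using sa by auto
        next
          case False
          then have "u \<in> U - {r}" using u by auto
          from t[OF this] show ?thesis using False sa by auto
        qed
      qed
    qed (use U sa in auto)
  qed
  from this[of "card M - 1"] obtain U par and d :: "'b \<Rightarrow> nat" where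
    "r \<in> U" "U \<subseteq> M" "card U = Suc (card M - 1)"
      "\<forall>s\<in>U - {r}. par s \<in> U \<and> P s (par s) \<and> d (par s) < d s"
    using card_gt_0_iff[of M] fin r by (metis Suc_diff_1 empty_iff order_refl)
  moreover from this have "U = M" using fin r
    by (metis Suc_diff_1 card_gt_0_iff card_subset_eq empty_iff)
  ultimately show ?thesis by blast
qed

locale grid_tree =
  fixes M :: "pixel set" and r :: pixel and par :: "pixel \<Rightarrow> pixel" and d :: "pixel \<Rightarrow> nat"
  assumes fin: "finite M" and root: "r \<in> M"
    and par: "\<And>s. s \<in> M \<Longrightarrow> s \<noteq> r \<Longrightarrow> par s \<in> M \<and> gadj s (par s) \<and> d (par s) < d s"
begin

definition tedges :: "pixel set set" where
  "tedges = {{s, par s} | s. s \<in> M \<and> s \<noteq> r}"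

definition cotree :: "pixel set set" where
  "cotree = {{s, t} | s t. s \<in> M \<and> t \<in> M \<and> gadj s t} - tedges"

lemma finite_tedges: "finite tedges"
proof -
  have "tedges = (\<lambda>s. {s, par s}) ` (M - {r})" unfolding tedges_def by blast
  then show ?thesis using fin by simp
qed

lemma cotree_gedge: "cotree \<subseteq> gedge"
  unfolding cotree_def gedge_def by blast

text \<open>Among the vertices whose parent edge is in use, one with largest \<open>d\<close> has no
  other edge in use, so its degree would be odd.\<close>

lemma tree_acyclic:
  assumes supp: "\<And>e. e \<in> gedge \<Longrightarrow> x e \<noteq> 0 \<Longrightarrow> e \<in> tedges" and ev: "\<And>p. bd x p = 0"
    and e: "e \<in> gedge"
  shows "x e = 0"
proof (rule ccontr)
  assume "x e \<noteq> 0"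
  then have "e \<in> tedges" using supp e by blast
  let ?B = "{s \<in> M. s \<noteq> r \<and> x {s, par s} \<noteq> 0}"
  have "?B \<noteq> {}" using \<open>x e \<noteq> 0\<close> \<open>e \<in> tedges\<close> by (auto simp: tedges_def)
  moreover have "finite ?B" using fin by simp
  ultimately have "Max (d ` ?B) \<in> d ` ?B" by (intro Max_in) auto
  then obtain s where s: "s \<in> ?B" and "Max (d ` ?B) = d s" by (rule imageE)
  then have max: "d u \<le> d s" if "u \<in> ?B" for u
    using that \<open>finite ?B\<close> Max_ge[of "d ` ?B" "d u"] by simp
  have "x {s, q} = 0" if "q \<in> nb s" "q \<noteq> par s" for q
  proof (rule ccontr)
    assume nz: "x {s, q} \<noteq> 0"
    have "{s, q} \<in> gedge" using that(1) unfolding gedge_def gadj_def by blast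
    then have "{s, q} \<in> tedges" using supp nz by blast
    then obtain u where u: "{s, q} = {u, par u}" "u \<in> M" "u \<noteq> r" by (auto simp: tedges_def)
    then have "u = q" "par q = s" using that by (auto simp: doubleton_eq_iff)
    then have "q \<in> ?B" using u nz by (simp add: insert_commute)
    then have "d q \<le> d s" by (rule max)
    moreover have "d s < d q" using par[of q] \<open>u = q\<close> \<open>par q = s\<close> u by auto
    ultimately show False by simp
  qed
  moreover have "par s \<in> nb s" using par s by (auto simp: gadj_def)
  ultimately have "bd x s = x {s, par s}"
    unfolding bd_def by (subst sum.remove[of _ "par s"]) auto
  then show False using ev s by simp
qed

lemma bd_add: "bd (\<lambda>e. x e + y e) p = bd x p + bd y p"
  by (simp add: bd_def sum.distrib)

lemma bd_single: "gadj s t \<Longrightarrow> bd (\<lambda>e. if e = {s, t} then 1 else 0) p = (if p = s then 1 else 0) + (if p = t then 1 else 0)"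
proof -
  assume st: "gadj s t"
  then have "s \<noteq> t" using gadj_irrefl by blast
  have *: "{p, q} = {s, t} \<longleftrightarrow> (p = s \<and> q = t) \<or> (p = t \<and> q = s)" for q
    by (auto simp: doubleton_eq_iff)
  have ts: "t \<in> nb s" "s \<in> nb t" using st gadj_sym by (auto simp: gadj_def)
  consider "p = s" | "p = t" "p \<noteq> s" | "p \<noteq> s" "p \<noteq> t" by auto
  then show ?thesis
  proof cases
    case 1
    then have "{p, q} = {s, t} \<longleftrightarrow> q = t" for q using * \<open>s \<noteq> t\<close> by blast
    then show ?thesis using ts \<open>s \<noteq> t\<close> 1 by (simp add: bd_def)
  next
    case 2
    then have "{p, q} = {s, t} \<longleftrightarrow> q = s" for q using * \<open>s \<noteq> t\<close> by blast
    then show ?thesis using ts \<open>s \<noteq> t\<close> 2 by (simp add: bd_def)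
  next
    case 3
    then show ?thesis by (simp add: bd_def *)
  qed
qed

lemma root_path:
  assumes "s \<in> M"
  shows "\<exists>x. (\<forall>p. bd x p = (if p = s then 1 else 0) + (if p = r then 1 else 0)) \<and>
     (\<forall>e. x e \<noteq> 0 \<longrightarrow> e \<in> tedges \<and> e \<subseteq> anc par r s)"
  using assms
proof (induction "d s" arbitrary: s rule: less_induct)
  case less
  show ?case
  proof (cases "s = r")
    case True
    then show ?thesis by (intro exI[of _ "\<lambda>_. 0"]) (auto simp: bd_def)
  next
    case False
    then have p: "par s \<in> M" "gadj s (par s)" "d (par s) < d s" using par less.prems by auto
    from less.hyps[OF p(3,1)] obtain x where
      x: "\<And>p. bd x p = (if p = par s then 1 else 0) + (if p = r then 1 else 0)"
        "\<And>e. x e \<noteq> 0 \<Longrightarrow> e \<in> tedges \<and> e \<subseteq> anc par r (par s)" by blast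
    let ?y = "\<lambda>e. x e + (if e = {s, par s} then 1 else 0)"
    have "bd ?y p = (if p = s then 1 else 0) + (if p = r then 1 else 0)" for p
      unfolding bd_add x bd_single[OF p(2)] by (auto simp: add.commute)
    moreover have "e \<in> tedges \<and> e \<subseteq> anc par r s" if "?y e \<noteq> 0" for e
    proof (cases "e = {s, par s}")
      case True
      moreover have "{s, par s} \<in> tedges" using False less.prems unfolding tedges_def by blast
      ultimately show ?thesis by (simp add: anc_step[OF False])
    next
      case n: False
      then have "x e \<noteq> 0" using that by simp
      then show ?thesis using x(2)[of e] anc_step[OF False] by blast
    qed
    ultimately show ?thesis by blast
  qed
qed

text \<open>The root paths from both ends of \<open>k\<close>, closed up by \<open>k\<close>; shared
  edges cancel mod 2. The last conjunct is the source of the two-path shape of the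
  separator.\<close>

lemma cycle_exists:
  assumes "k \<in> cotree"
  shows "\<exists>x. (\<forall>p. bd x p = 0) \<and> x k = 1 \<and> (\<forall>e. x e \<noteq> 0 \<longrightarrow> e \<in> insert k tedges) \<and>
    (\<exists>s\<in>M. \<exists>t\<in>M. \<forall>e. x e \<noteq> 0 \<longrightarrow> e \<subseteq> anc par r s \<union> anc par r t)"
proof -
  obtain s t where k: "k = {s, t}" "s \<in> M" "t \<in> M" "gadj s t" "k \<notin> tedges"
    using assms by (auto simp: cotree_def)
  obtain x where
    x: "\<And>p. bd x p = (if p = s then 1 else 0) + (if p = r then 1 else 0)"
       "\<And>e. x e \<noteq> 0 \<Longrightarrow> e \<in> tedges \<and> e \<subseteq> anc par r s" using root_path[OF k(2)] by blast
  obtain y where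
    y: "\<And>p. bd y p = (if p = t then 1 else 0) + (if p = r then 1 else 0)"
       "\<And>e. y e \<noteq> 0 \<Longrightarrow> e \<in> tedges \<and> e \<subseteq> anc par r t" using root_path[OF k(3)] by blast
  let ?z = "\<lambda>e. (x e + y e) + (if e = {s, t} then 1 else 0)"
  have "bd ?z p = 0" for p
    unfolding bd_add x y bd_single[OF k(4)] by auto
  moreover have "?z k = 1"
  proof -
    have "x k = 0" "y k = 0" using x(2)[of k] y(2)[of k] k(5) by blast+
    then show ?thesis using k(1) by simp
  qed
  moreover have "e \<in> insert k tedges \<and> e \<subseteq> anc par r s \<union> anc par r t" if "?z e \<noteq> 0" for e
  proof (cases "e = {s, t}")
    case True
    then show ?thesis using k by auto
  next
    case False
    then have "x e \<noteq> 0 \<or> y e \<noteq> 0" using that by auto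
    then show ?thesis using x(2) y(2) by blast
  qed
  ultimately show ?thesis using k(2,3) by blast
qed

text \<open>The squares enclosed by the fundamental cycle of \<open>k\<close>. Requiring a finite
  support selects the inside rather than the outside.\<close>

definition zone :: "pixel set \<Rightarrow> pixel \<Rightarrow> bit" where
  "zone k = (SOME S. finite {f. S f \<noteq> 0} \<and> cob S k = 1 \<and>
     (\<forall>e\<in>gedge. cob S e \<noteq> 0 \<longrightarrow> e \<in> insert k tedges) \<and>
     (\<exists>s\<in>M. \<exists>t\<in>M. \<forall>e\<in>gedge. cob S e \<noteq> 0 \<longrightarrow> e \<subseteq> anc par r s \<union> anc par r t))"

lemma zone:
  assumes "k \<in> cotree"
  shows "finite {f. zone k f \<noteq> 0}" "cob (zone k) k = 1"
    "\<And>e. e \<in> gedge \<Longrightarrow> cob (zone k) e \<noteq> 0 \<Longrightarrow> e \<in> insert k tedges"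
    "\<exists>s\<in>M. \<exists>t\<in>M. \<forall>e\<in>gedge. cob (zone k) e \<noteq> 0 \<longrightarrow> e \<subseteq> anc par r s \<union> anc par r t"
proof -
  obtain x where x: "\<And>p. bd x p = 0" "x k = 1" "\<And>e. x e \<noteq> 0 \<Longrightarrow> e \<in> insert k tedges"
    "\<exists>s\<in>M. \<exists>t\<in>M. \<forall>e. x e \<noteq> 0 \<longrightarrow> e \<subseteq> anc par r s \<union> anc par r t"
    using cycle_exists[OF assms] by blast
  have "{e \<in> gedge. x e \<noteq> 0} \<subseteq> insert k tedges" using x(3) by blast
  then have "finite {e \<in> gedge. x e \<noteq> 0}" using finite_tedges finite_subset by blast
  from even_is_cob[OF this x(1)] obtain S where S: "finite {f. S f \<noteq> 0}" "\<And>e. e \<in> gedge \<Longrightarrow> x e = cob S e"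
    by blast
  have kg: "k \<in> gedge" using assms cotree_gedge by blast
  have "\<exists>S. finite {f. S f \<noteq> 0} \<and> cob S k = 1 \<and>
     (\<forall>e\<in>gedge. cob S e \<noteq> 0 \<longrightarrow> e \<in> insert k tedges) \<and>
     (\<exists>s\<in>M. \<exists>t\<in>M. \<forall>e\<in>gedge. cob S e \<noteq> 0 \<longrightarrow> e \<subseteq> anc par r s \<union> anc par r t)"
  proof (intro exI[of _ S] conjI)
    show "\<exists>s\<in>M. \<exists>t\<in>M. \<forall>e\<in>gedge. cob S e \<noteq> 0 \<longrightarrow> e \<subseteq> anc par r s \<union> anc par r t"
      using x(4) S(2) by (metis (no_types, lifting))
    show "\<forall>e\<in>gedge. cob S e \<noteq> 0 \<longrightarrow> e \<in> insert k tedges" using x(3) S(2) by metis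
  qed (use S kg x(2) in auto)
  from someI_ex[OF this, folded zone_def]
  show "finite {f. zone k f \<noteq> 0}" "cob (zone k) k = 1"
    "\<And>e. e \<in> gedge \<Longrightarrow> cob (zone k) e \<noteq> 0 \<Longrightarrow> e \<in> insert k tedges"
    "\<exists>s\<in>M. \<exists>t\<in>M. \<forall>e\<in>gedge. cob (zone k) e \<noteq> 0 \<longrightarrow> e \<subseteq> anc par r s \<union> anc par r t" by blast+
qed

lemma zone_other:
  assumes "k \<in> cotree" "k' \<in> cotree" "k \<noteq> k'"
  shows "cob (zone k) k' = 0"
proof (rule ccontr)
  assume "cob (zone k) k' \<noteq> 0"
  moreover have "k' \<in> gedge" "k' \<notin> tedges" using assms(2) cotree_gedge by (auto simp only: cotree_def)
  ultimately show False using zone(3)[OF assms(1)] assms(3) by blast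
qed

lemma cob_sum: "cob (\<lambda>f. \<Sum>k\<in>K. c k * Z k f) e = (\<Sum>k\<in>K. c k * cob (Z k) e)"
  by (simp add: cob_def sum.distrib distrib_left)

text \<open>The difference of both sides has its boundary in the tree, so the boundary vanishes by
  \<open>tree_acyclic\<close> and then the difference by \<open>cob_zero\<close>. Applied to single
  squares, to the whole box and to products of zones, this takes the place of arguments about
  faces.\<close>

lemma zone_expansion:
  assumes S: "finite {f. S f \<noteq> 0}" and K: "finite K" "K \<subseteq> cotree"
    and supp: "\<And>e. e \<in> gedge \<Longrightarrow> cob S e \<noteq> 0 \<Longrightarrow> e \<in> tedges \<union> K"
  shows "S f = (\<Sum>k\<in>K. cob S k * zone k f)"
proof -
  define D where "D = (\<lambda>f. S f + (\<Sum>k\<in>K. cob S k * zone k f))"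
  have cD: "cob D e = cob S e + (\<Sum>k\<in>K. cob S k * cob (zone k) e)" for e
  proof -
    have "cob D e = cob S e + cob (\<lambda>f. \<Sum>k\<in>K. cob S k * zone k f) e"
      by (simp add: cob_def D_def algebra_simps)
    then show ?thesis by (simp add: cob_sum)
  qed
  have "{f. D f \<noteq> 0} \<subseteq> {f. S f \<noteq> 0} \<union> (\<Union>k\<in>K. {f. zone k f \<noteq> 0})"
  proof
    fix f assume "f \<in> {f. D f \<noteq> 0}"
    then have "D f \<noteq> 0" by blast
    moreover have "D f = 0" if "S f = 0" "(\<Sum>k\<in>K. cob S k * zone k f) = 0"
      unfolding D_def that by simp
    ultimately have "S f \<noteq> 0 \<or> (\<Sum>k\<in>K. cob S k * zone k f) \<noteq> 0" by blast
    moreover have "\<exists>k\<in>K. zone k f \<noteq> 0" if "(\<Sum>k\<in>K. cob S k * zone k f) \<noteq> 0"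
    proof (rule ccontr)
      assume "\<not> (\<exists>k\<in>K. zone k f \<noteq> 0)"
      then have "(\<Sum>k\<in>K. cob S k * zone k f) = 0" by (intro sum.neutral) simp
      then show False using that by blast
    qed
    ultimately show "f \<in> {f. S f \<noteq> 0} \<union> (\<Union>k\<in>K. {f. zone k f \<noteq> 0})" by blast
  qed
  moreover have "finite ({f. S f \<noteq> 0} \<union> (\<Union>k\<in>K. {f. zone k f \<noteq> 0}))"
    using S K zone(1) by (intro finite_UnI finite_UN_I) auto
  ultimately have finD: "finite {f. D f \<noteq> 0}" by (rule finite_subset)
  have ks: "(\<Sum>k\<in>K. cob S k * cob (zone k) e) = cob S e" if "e \<in> K" for e
  proof -
    have "(\<Sum>k\<in>K. cob S k * cob (zone k) e) = (\<Sum>k\<in>K. if k = e then cob S e else 0)"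
    proof (rule sum.cong[OF refl])
      fix k assume "k \<in> K"
      then have "k \<in> cotree" "e \<in> cotree" using that K by blast+
      then show "cob S k * cob (zone k) e = (if k = e then cob S e else 0)"
        using zone(2)[of e] zone_other[of k e] by simp
    qed
    then show ?thesis using that K by simp
  qed
  have "cob D e = 0" if "e \<in> gedge" for e
  proof (rule tree_acyclic[OF _ bd_cob that])
    fix e assume e: "e \<in> gedge" and nz: "cob D e \<noteq> 0"
    show "e \<in> tedges"
    proof (rule ccontr)
      assume n: "e \<notin> tedges"
      show False
      proof (cases "e \<in> K")
        case True
        then show False using nz cD ks by simp
      next
        case False
        then have "cob S e = 0" using supp[OF e] n by blast
        moreover have "cob (zone k) e = 0" if "k \<in> K" for k
          using zone(3)[of k e] that K e n False by blast
        ultimately show False using nz cD by simp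
      qed
    qed
  qed
  from cob_zero[OF finD this] have "D f = 0" .
  then show ?thesis unfolding D_def by (simp add: bit_add_zero_iff)
qed

text \<open>The product is supported on the tree and two further edges, so it is a combination of the two zones.
  Hence the zones form a laminar family.\<close>

lemma zone_mult:
  assumes k: "k \<in> cotree" "k' \<in> cotree" "k \<noteq> k'"
  obtains a b where "\<And>f. zone k f * zone k' f = a * zone k f + b * zone k' f"
proof -
  let ?S = "\<lambda>f. zone k f * zone k' f"
  have "{f. ?S f \<noteq> 0} \<subseteq> {f. zone k f \<noteq> 0}" by (intro Collect_mono) simp
  then have fin: "finite {f. ?S f \<noteq> 0}" using zone(1)[OF k(1)] finite_subset by blast
  have supp: "e \<in> tedges \<union> {k, k'}" if "e \<in> gedge" "cob ?S e \<noteq> 0" for e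
  proof (rule ccontr)
    assume "e \<notin> tedges \<union> {k, k'}"
    then have "cob (zone k) e = 0" "cob (zone k') e = 0"
      using zone(3)[OF k(1) that(1)] zone(3)[OF k(2) that(1)] by blast+
    then have "zone k (sq1 e) = zone k (sq2 e)" "zone k' (sq1 e) = zone k' (sq2 e)"
      by (simp_all only: cob_def bit_add_zero_iff)
    then have "cob ?S e = 0" by (simp only: cob_def bit_double)
    then show False using that(2) by blast
  qed
  have "finite {k, k'}" "{k, k'} \<subseteq> cotree" using k by simp_all
  from zone_expansion[OF fin this supp] have "?S f = (\<Sum>j\<in>{k, k'}. cob ?S j * zone j f)" for f .
  moreover have "(\<Sum>j\<in>{k, k'}. c j * zone j f) = c k * zone k f + c k' * zone k' f" for c f
    using k(3) by simp
  ultimately have "?S f = cob ?S k * zone k f + cob ?S k' * zone k' f" for f by (rule trans)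
  then show thesis by (rule that)
qed

end

section \<open>Balanced fundamental cycles\<close>

definition quad :: "pixel \<Rightarrow> pixel set set" where
  "quad f = (case f of (i, j) \<Rightarrow>
     {{(i, j), (i + 1, j)}, {(i, j + 1), (i + 1, j + 1)}, {(i, j), (i, j + 1)}, {(i + 1, j), (i + 1, j + 1)}})"

lemma finite_quad [simp]: "finite (quad f)"
  by (cases f) (simp add: quad_def)

lemma card_quad: "card (quad f) \<le> 4"
proof -
  obtain i j where "f = (i, j)" by (cases f)
  then have q: "quad f = set [{(i, j), (i + 1, j)}, {(i, j + 1), (i + 1, j + 1)}, {(i, j), (i, j + 1)},
      {(i + 1, j), (i + 1, j + 1)}]"
    unfolding quad_def by simp
  show ?thesis unfolding q by (rule order_trans[OF card_length]) simp
qed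

lemma hor_eq_iff: "{(a, b), (a + 1, b)} = {(i, j), (i + 1, j :: int)} \<longleftrightarrow> a = i \<and> b = (j :: int)" for a i :: int
  by (metis sq_hor(1) prod.inject)

lemma ver_eq_iff: "{(a, b), (a, b + 1)} = {(i, j), (i, j + 1 :: int)} \<longleftrightarrow> a = i \<and> b = j" for a i :: int
  by (metis sq_ver(1) prod.inject)

lemma hor_neq_ver: "{(a, b), (a + 1, b)} \<noteq> {(i, j), (i, j + 1 :: int)}" for a i :: int
proof
  assume eq: "{(a, b), (a + 1, b)} = {(i, j), (i, j + 1)}"
  have "(a, b) = (i, j)" using arg_cong[OF eq, of sq1] unfolding sq_hor sq_ver .
  moreover have "(a, b - 1) = (i - 1, j)" using arg_cong[OF eq, of sq2] unfolding sq_hor sq_ver .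
  ultimately show False by simp
qed

lemma quad_sides:
  assumes "e \<in> gedge"
  shows "e \<in> quad f \<longleftrightarrow> f = sq1 e \<or> f = sq2 e"
  using assms
proof (cases rule: gedge_cases)
  case e: (hor i j)
  obtain a b where f: "f = (a, b)" by (cases f)
  have "e \<in> quad f \<longleftrightarrow> (i = a \<and> j = b) \<or> (i = a \<and> j = b + 1)"
    by (simp only: e f quad_def prod.case insert_iff empty_iff hor_eq_iff hor_neq_ver simp_thms)
  moreover have "f = sq1 e \<or> f = sq2 e \<longleftrightarrow> (a = i \<and> b = j) \<or> (a = i \<and> b = j - 1)"
    by (simp only: e f sq_hor prod.inject)
  ultimately show ?thesis by linarith
next
  case e: (ver i j)
  obtain a b where f: "f = (a, b)" by (cases f)
  have "e \<in> quad f \<longleftrightarrow> (i = a \<and> j = b) \<or> (i = a + 1 \<and> j = b)"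
    by (simp only: e f quad_def prod.case insert_iff empty_iff ver_eq_iff hor_neq_ver[symmetric] simp_thms)
  moreover have "f = sq1 e \<or> f = sq2 e \<longleftrightarrow> (a = i \<and> b = j) \<or> (a = i - 1 \<and> b = j)"
    by (simp only: e f sq_ver prod.inject)
  ultimately show ?thesis by linarith
qed

lemma quad_gedge: "quad f \<subseteq> gedge"
proof -
  obtain i j where f: "f = (i, j)" by (cases f)
  show ?thesis unfolding f quad_def
    using hor_gedge(1)[of i j] hor_gedge(1)[of i "j + 1"] ver_gedge(1)[of i j] ver_gedge(1)[of "i + 1" j] by simp
qed

lemma sq_neq: "e \<in> gedge \<Longrightarrow> sq1 e \<noteq> sq2 e"
  by (erule gedge_cases) auto

lemma cob_indicator:
  assumes "e \<in> gedge"
  shows "cob (\<lambda>g. if g = f then 1 else 0) e = (if e \<in> quad f then 1 else 0)"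
  using sq_neq[OF assms] by (auto simp: cob_def quad_sides[OF assms])

lemma other_side:
  assumes "e \<in> quad f"
  obtains g where "\<And>S. cob S e = S f + S g"
proof -
  have "e \<in> gedge" using assms quad_gedge by blast
  from quad_sides[OF this, of f] assms have "f = sq1 e \<or> f = sq2 e" by blast
  then show thesis
  proof
    assume "f = sq1 e" then show thesis using that[of "sq2 e"] by (simp add: cob_def)
  next
    assume "f = sq2 e" then show thesis using that[of "sq1 e"] by (simp add: cob_def add.commute)
  qed
qed

context grid_tree
begin

text \<open>The boundary of one square consists of its four sides, so \<open>zone_expansion\<close>
  applies to its indicator.\<close>

lemma quad_expansion:
  assumes "quad f \<subseteq> tedges \<union> cotree"
  shows "(if g = f then 1 else 0) = (\<Sum>k\<in>quad f \<inter> cotree. zone k g)"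
proof -
  let ?S = "\<lambda>g. if g = f then 1 else 0 :: bit"
  have fin: "finite {g. ?S g \<noteq> 0}" by simp
  have supp: "e \<in> tedges \<union> (quad f \<inter> cotree)" if "e \<in> gedge" "cob ?S e \<noteq> 0" for e
  proof -
    have "e \<in> quad f" using that(2) unfolding cob_indicator[OF that(1)] by (simp split: if_splits)
    then show ?thesis using assms by blast
  qed
  have "?S g = (\<Sum>k\<in>quad f \<inter> cotree. cob ?S k * zone k g)"
    by (rule zone_expansion[OF fin _ _ supp]) simp_all
  also have "\<dots> = (\<Sum>k\<in>quad f \<inter> cotree. zone k g)"
  proof (rule sum.cong[OF refl])
    fix k assume k: "k \<in> quad f \<inter> cotree"
    then have "k \<in> gedge" using cotree_gedge by blast
    then show "cob ?S k * zone k g = zone k g" using cob_indicator[of k f] k by simp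
  qed
  finally show ?thesis .
qed

text \<open>By \<open>quad_expansion\<close> a square other than \<open>f\<close> lies in an even
  number of zones of sides of \<open>f\<close>, hence never in exactly one.\<close>

lemma descend_cover:
  assumes "quad f \<subseteq> tedges \<union> cotree" "k \<in> quad f \<inter> cotree" "zone k g \<noteq> 0" "g \<noteq> f"
  shows "\<exists>k'\<in>quad f \<inter> cotree - {k}. zone k' g \<noteq> 0"
proof (rule ccontr)
  assume "\<not> ?thesis"
  then have "(\<Sum>k\<in>quad f \<inter> cotree - {k}. zone k g) = 0" by (intro sum.neutral) simp
  moreover have "(\<Sum>k\<in>quad f \<inter> cotree. zone k g) = zone k g + (\<Sum>k\<in>quad f \<inter> cotree - {k}. zone k g)"
    by (rule sum.remove) (use assms in auto)
  ultimately show False using quad_expansion[OF assms(1), of g] assms(3,4) by simp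
qed

text \<open>The product of the two zones is \<open>a * zone k + b * zone k'\<close>. Its values at
  \<open>f\<close> and at the squares \<open>h\<close> and \<open>h'\<close> across \<open>k\<close>
  and \<open>k'\<close> leave only \<open>a = 0\<close>, \<open>b = 1\<close> and
  \<open>zone k' f = 0\<close>.\<close>

lemma descend_subset:
  assumes k: "k \<in> cotree" "k \<in> quad f" "zone k f = 1"
    and k': "k' \<in> cotree" "k' \<in> quad f" "k' \<noteq> k"
  shows "zone k' f = 0" "\<And>g. zone k' g \<noteq> 0 \<Longrightarrow> zone k g \<noteq> 0"
proof -
  obtain a b where ab: "\<And>g. zone k g * zone k' g = a * zone k g + b * zone k' g"
    using zone_mult[OF k(1) k'(1)] k'(3) by metis
  obtain h where h: "\<And>S. cob S k = S f + S h" using other_side[OF k(2)] by blast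
  obtain h' where h': "\<And>S. cob S k' = S f + S h'" using other_side[OF k'(2)] by blast
  have 1: "zone k h = 0" using zone(2)[OF k(1)] k(3) unfolding h by (cases "zone k h") auto
  have 2: "zone k' h = zone k' f" using zone_other[OF k'(1) k(1) k'(3)] unfolding h
    by (simp only: bit_add_zero_iff)
  have 3: "zone k h' = 1" using zone_other[OF k(1) k'(1)] k'(3) k(3) unfolding h'
    by (cases "zone k h'") auto
  have 4: "zone k' h' = 1 + zone k' f" using zone(2)[OF k'(1)] unfolding h'
    by (cases "zone k' h'"; cases "zone k' f") auto
  have e1: "zone k' f = a + b * zone k' f" using ab[of f] k(3) by simp
  have e2: "0 = b * zone k' f" using ab[of h] 1 2 by simp
  have e3: "1 + zone k' f = a + b * (1 + zone k' f)" using ab[of h'] 3 4 by simp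
  have "a = 0 \<and> b = 1 \<and> zone k' f = 0" using e1 e2 e3
    by (cases a; cases b; cases "zone k' f") auto
  then show "zone k' f = 0" and "\<And>g. zone k' g \<noteq> 0 \<Longrightarrow> zone k g \<noteq> 0"
    using ab by (simp, metis add_0 mult_1 mult_zero_left)
qed

lemma inner_side:
  assumes "k \<in> cotree"
  obtains f where "k \<in> quad f" "zone k f = 1"
proof -
  have "k \<in> gedge" using assms cotree_gedge by blast
  then have "k \<in> quad (sq1 k)" "k \<in> quad (sq2 k)" using quad_sides by blast+
  moreover have "zone k (sq1 k) = 1 \<or> zone k (sq2 k) = 1" using zone(2)[OF assms] unfolding cob_def
    by (cases "zone k (sq1 k)") auto
  ultimately show thesis using that by blast
qed

text \<open>Descent in the laminar family. A zone that is too heavy is covered by the square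
  \<open>f\<close> next to \<open>k\<close> and the zones of the at most three other sides of
  \<open>f\<close>. One of these still holds a quarter of \<open>R\<close>, and it is strictly
  smaller because it misses \<open>f\<close>.\<close>

lemma balanced_zone:
  assumes finR: "finite R" and n: "card R > 0"
    and quads: "\<And>k f. k \<in> cotree \<Longrightarrow> zone k f \<noteq> 0 \<Longrightarrow> quad f \<subseteq> tedges \<union> cotree"
    and k0: "k0 \<in> cotree" "\<And>f. f \<in> R \<Longrightarrow> zone k0 f \<noteq> 0"
  shows "\<exists>k\<in>cotree. card R \<le> 4 * card {f\<in>R. zone k f \<noteq> 0} \<and> 4 * card {f\<in>R. zone k f \<noteq> 0} \<le> 3 * card R + 1"
proof -
  define W where "W = (\<lambda>k. card {f\<in>R. zone k f \<noteq> 0})"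
  have "\<exists>k\<in>cotree. card R \<le> 4 * W k \<and> 4 * W k \<le> 3 * card R + 1" if "k \<in> cotree" "card R \<le> 4 * W k" for k
    using that
  proof (induction "card {f. zone k f \<noteq> 0}" arbitrary: k rule: less_induct)
    case less
    show ?case
    proof (cases "4 * W k \<le> 3 * card R + 1")
      case True
      then show ?thesis using less.prems by blast
    next
      case False
      obtain f where f: "k \<in> quad f" "zone k f = 1" using inner_side less.prems(1) by blast
      have q: "quad f \<subseteq> tedges \<union> cotree" using quads[OF less.prems(1), of f] f(2) by simp
      define J where "J = quad f \<inter> cotree - {k}"
      have finJ: "finite J" unfolding J_def by simp
      have "card J \<le> 3"
      proof -
        have "J \<subseteq> quad f - {k}" unfolding J_def by blast
        then have "card J \<le> card (quad f - {k})" by (intro card_mono) simp_all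
        also have "\<dots> = card (quad f) - 1" using f(1) by simp
        finally show ?thesis using card_quad[of f] by simp
      qed
      have "\<exists>k'\<in>J. card R \<le> 4 * W k'"
      proof (rule ccontr)
        assume "\<not> ?thesis"
        then have small: "4 * W k' \<le> card R - 1" if "k' \<in> J" for k' using that n by fastforce
        have "{g\<in>R. zone k g \<noteq> 0} \<subseteq> insert f (\<Union>k'\<in>J. {g\<in>R. zone k' g \<noteq> 0})"
        proof
          fix g assume g: "g \<in> {g\<in>R. zone k g \<noteq> 0}"
          then have "g = f \<or> (\<exists>k'\<in>J. zone k' g \<noteq> 0)"
            unfolding J_def using descend_cover[OF q, of k g] f(1) less.prems(1) by blast
          then show "g \<in> insert f (\<Union>k'\<in>J. {g\<in>R. zone k' g \<noteq> 0})" using g by blast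
        qed
        moreover have "finite (\<Union>k'\<in>J. {g\<in>R. zone k' g \<noteq> 0})" using finJ finR by (intro finite_UN_I) simp_all
        ultimately have "W k \<le> card (insert f (\<Union>k'\<in>J. {g\<in>R. zone k' g \<noteq> 0}))"
          unfolding W_def by (intro card_mono) simp_all
        also have "\<dots> \<le> Suc (card (\<Union>k'\<in>J. {g\<in>R. zone k' g \<noteq> 0}))" by (rule card_insert_le_m1) simp_all
        also have "\<dots> \<le> Suc (\<Sum>k'\<in>J. W k')" unfolding W_def using card_UN_le[OF finJ] by simp
        \<comment> \<open>The square \<open>f\<close> contributes at most 4, and three light zones
          at most \<open>3 * (card R - 1)\<close>. The sum is the bound
          \<open>3 * card R + 1\<close> of the statement.\<close>
        finally have "4 * W k \<le> 4 + (\<Sum>k'\<in>J. 4 * W k')" by (simp add: sum_distrib_left[symmetric])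
        also have "(\<Sum>k'\<in>J. 4 * W k') \<le> of_nat (card J) * (card R - 1)"
          by (rule sum_bounded_above) (rule small)
        also have "of_nat (card J) * (card R - 1) \<le> 3 * (card R - 1)" using \<open>card J \<le> 3\<close> by simp
        finally show False using False n by simp
      qed
      then obtain k' where k': "k' \<in> J" "card R \<le> 4 * W k'" by blast
      then have k'2: "k' \<in> cotree" "k' \<in> quad f" "k' \<noteq> k" unfolding J_def by blast+
      note sub = descend_subset[OF less.prems(1) f k'2]
      have "{g. zone k' g \<noteq> 0} \<subset> {g. zone k g \<noteq> 0}"
      proof
        show "{g. zone k' g \<noteq> 0} \<subseteq> {g. zone k g \<noteq> 0}" using sub(2) by blast
        have "f \<in> {g. zone k g \<noteq> 0}" "f \<notin> {g. zone k' g \<noteq> 0}" using f(2) sub(1) by simp_all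
        then show "{g. zone k' g \<noteq> 0} \<noteq> {g. zone k g \<noteq> 0}" by blast
      qed
      then have "card {g. zone k' g \<noteq> 0} < card {g. zone k g \<noteq> 0}"
        by (rule psubset_card_mono[OF zone(1)[OF less.prems(1)]])
      from less.hyps[OF this k'2(1) k'(2)] show ?thesis .
    qed
  qed
  moreover have "{f\<in>R. zone k0 f \<noteq> 0} = R" using k0(2) by blast
  then have "card R \<le> 4 * W k0" unfolding W_def by simp
  ultimately show ?thesis using k0(1) unfolding W_def by blast
qed

end

section \<open>Graphs as minors of the grid\<close>

text \<open>The host graph \<open>adj\<close> is a parameter, since both the square grid and a graph
  of maximum degree 3 serve as hosts.\<close>

definition minor_model :: "('b \<Rightarrow> 'b \<Rightarrow> bool) \<Rightarrow> 'a set \<Rightarrow> 'a set set \<Rightarrow> ('a \<Rightarrow> 'b set) \<Rightarrow> bool" where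
  "minor_model adj V E B \<longleftrightarrow>
     (\<forall>v\<in>V. finite (B v) \<and> B v \<noteq> {} \<and> linked adj (B v)) \<and>
     (\<forall>u\<in>V. \<forall>v\<in>V. u \<noteq> v \<longrightarrow> B u \<inter> B v = {}) \<and>
     (\<forall>u\<in>V. \<forall>v\<in>V. u \<noteq> v \<longrightarrow> {u, v} \<in> E \<longrightarrow> (\<exists>a\<in>B u. \<exists>b\<in>B v. adj a b))"

definition span_tree :: "'a set \<Rightarrow> 'a set set \<Rightarrow> 'a \<Rightarrow> ('a \<Rightarrow> 'a) \<Rightarrow> ('a \<Rightarrow> nat) \<Rightarrow> bool" where
  "span_tree V E r par lev \<longleftrightarrow> r \<in> V \<and>
     (\<forall>w\<in>V. w \<noteq> r \<longrightarrow> par w \<in> V \<and> {w, par w} \<in> E \<and> lev (par w) < lev w)"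

lemma linkedD:
  assumes "linked adj B" "X \<inter> B \<noteq> {}" "\<not> B \<subseteq> X"
  shows "\<exists>a\<in>X \<inter> B. \<exists>b\<in>B - X. adj a b"
proof -
  have "X \<inter> B \<subseteq> B" "X \<inter> B \<noteq> B" using assms(3) by blast+
  then obtain a b where "a \<in> X \<inter> B" "b \<in> B - X \<inter> B" "adj a b"
    using assms(1,2) unfolding linked_def by meson
  then show ?thesis by blast
qed

lemma linked_closed:
  assumes "linked adj B" "a \<in> X" "a \<in> B" "\<And>x y. x \<in> X \<Longrightarrow> x \<in> B \<Longrightarrow> y \<in> B \<Longrightarrow> adj x y \<Longrightarrow> y \<in> X"
  shows "B \<subseteq> X"
proof (rule ccontr)
  assume "\<not> B \<subseteq> X"
  then obtain x y where "x \<in> X \<inter> B" "y \<in> B - X" "adj x y" using linkedD[OF assms(1), of X] assms(2,3) by blast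
  then show False using assms(4) by blast
qed

locale model_tree =
  fixes V :: "'a set" and E B r0 par0 lev0
  assumes finV: "finite V" and model: "minor_model gadj V E B" and tree0: "span_tree V E r0 par0 lev0"
begin

definition H :: "pixel set" where "H = (\<Union>w\<in>V. B w)"

definition port :: "'a \<Rightarrow> 'a \<Rightarrow> pixel \<times> pixel" where
  "port u v = (SOME ab. fst ab \<in> B u \<and> snd ab \<in> B v \<and> gadj (fst ab) (snd ab))"

definition rpix :: pixel where "rpix = (SOME p. p \<in> B r0)"

text \<open>Admissible parent edges of a grid tree: inside a branch set, or along the one chosen
  edge towards the branch set of the parent. A root path of such a tree meets only branch sets of
  one root path of the graph.\<close>

definition branch :: "pixel \<Rightarrow> pixel \<Rightarrow> bool" where
  "branch s a \<longleftrightarrow> (\<exists>w\<in>V. s \<in> B w \<and> a \<in> B w \<and> gadj s a) \<or>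
     (\<exists>w\<in>V. w \<noteq> r0 \<and> (s, a) = port w (par0 w))"

lemma root0: "r0 \<in> V" and par0: "\<And>w. w \<in> V \<Longrightarrow> w \<noteq> r0 \<Longrightarrow> par0 w \<in> V \<and> {w, par0 w} \<in> E \<and> lev0 (par0 w) < lev0 w"
  using tree0 by (auto simp: span_tree_def)

lemma B_fin: "w \<in> V \<Longrightarrow> finite (B w)" and B_ne: "w \<in> V \<Longrightarrow> B w \<noteq> {}" and B_linked: "w \<in> V \<Longrightarrow> linked gadj (B w)"
  and B_disj: "u \<in> V \<Longrightarrow> w \<in> V \<Longrightarrow> p \<in> B u \<Longrightarrow> p \<in> B w \<Longrightarrow> u = w"
  using model by (auto simp: minor_model_def)

lemma finite_H: "finite H"
  unfolding H_def using finV B_fin by blast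

lemma rpix: "rpix \<in> B r0"
  unfolding rpix_def using B_ne[OF root0] by (simp add: some_in_eq)

lemma port:
  assumes "u \<in> V" "v \<in> V" "u \<noteq> v" "{u, v} \<in> E"
  shows "fst (port u v) \<in> B u" "snd (port u v) \<in> B v" "gadj (fst (port u v)) (snd (port u v))"
proof -
  have "\<exists>a\<in>B u. \<exists>b\<in>B v. gadj a b" using model assms unfolding minor_model_def by blast
  then obtain a b where "a \<in> B u" "b \<in> B v" "gadj a b" by blast
  then have "\<exists>ab. fst ab \<in> B u \<and> snd ab \<in> B v \<and> gadj (fst ab) (snd ab)" by (intro exI[of _ "(a, b)"]) simp
  from someI_ex[OF this, folded port_def]
  show "fst (port u v) \<in> B u" "snd (port u v) \<in> B v" "gadj (fst (port u v)) (snd (port u v))" by blast+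
qed

lemma par0_neq: "w \<in> V \<Longrightarrow> w \<noteq> r0 \<Longrightarrow> par0 w \<noteq> w"
  using par0 by fastforce

lemma port_par:
  assumes "w \<in> V" "w \<noteq> r0" "(s, a) = port w (par0 w)"
  shows "s \<in> B w" "a \<in> B (par0 w)" "gadj s a"
proof -
  have eq: "fst (port w (par0 w)) = s" "snd (port w (par0 w)) = a" using assms(3)[symmetric] by simp_all
  have p: "par0 w \<in> V" "w \<noteq> par0 w" "{w, par0 w} \<in> E"
    using par0[OF assms(1,2)] par0_neq[OF assms(1,2)] by auto
  show "s \<in> B w" using port(1)[OF assms(1) p] unfolding eq .
  show "a \<in> B (par0 w)" using port(2)[OF assms(1) p] unfolding eq .
  show "gadj s a" using port(3)[OF assms(1) p] unfolding eq .
qed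

lemma branch_cases:
  assumes "branch s a"
  obtains (inside) w where "w \<in> V" "s \<in> B w" "a \<in> B w" "gadj s a"
    | (up) w where "w \<in> V" "w \<noteq> r0" "(s, a) = port w (par0 w)" "s \<in> B w" "a \<in> B (par0 w)" "par0 w \<in> V" "gadj s a"
  using assms unfolding branch_def
proof (elim disjE bexE conjE)
  fix w assume w: "w \<in> V" "w \<noteq> r0" "(s, a) = port w (par0 w)"
  then show thesis using up[OF w port_par(1,2)[OF w] _ port_par(3)[OF w]] par0[OF w(1,2)] by blast
qed (rule inside)

lemma H_I: "w \<in> V \<Longrightarrow> s \<in> B w \<Longrightarrow> s \<in> H"
  unfolding H_def by blast

lemma branch_H:
  assumes "branch s a"
  shows "s \<in> H" "a \<in> H" "gadj s a"
  using assms by (cases rule: branch_cases; simp add: H_I)+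

text \<open>Take an unfinished branch set of least level. If it has been entered, connectedness
  extends it; otherwise the branch set of its parent is complete and contains the end of the chosen
  edge.\<close>

lemma grow_H:
  assumes "rpix \<in> U" "\<not> H \<subseteq> U"
  shows "\<exists>s\<in>H - U. \<exists>a\<in>U. branch s a"
proof -
  have "\<exists>w. w \<in> V \<and> \<not> B w \<subseteq> U" using assms(2) unfolding H_def by blast
  then obtain w where w: "w \<in> V" "\<not> B w \<subseteq> U" and min: "\<And>u. u \<in> V \<Longrightarrow> \<not> B u \<subseteq> U \<Longrightarrow> lev0 w \<le> lev0 u"
    using ex_has_least_nat[of "\<lambda>w. w \<in> V \<and> \<not> B w \<subseteq> U" _ lev0] by blast
  show ?thesis
  proof (cases "U \<inter> B w = {}")
    case False
    from linkedD[OF B_linked[OF w(1)] False w(2)] obtain a s where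
      "a \<in> U \<inter> B w" "s \<in> B w - U" "gadj a s" by blast
    moreover from this have "branch s a" unfolding branch_def using w(1) gadj_sym[of s a] by blast
    moreover have "s \<in> H" using H_I w(1) calculation(2) by blast
    ultimately show ?thesis by blast
  next
    case True
    then have "w \<noteq> r0" using rpix assms(1) by blast
    from par0[OF w(1) this] have "par0 w \<in> V" "\<not> lev0 w \<le> lev0 (par0 w)" by simp_all
    then have sub: "B (par0 w) \<subseteq> U" using min by blast
    obtain s a where sa: "(s, a) = port w (par0 w)" by (cases "port w (par0 w)") simp
    have "s \<in> B w" "a \<in> B (par0 w)" using port_par[OF w(1) \<open>w \<noteq> r0\<close> sa] by simp_all
    moreover have "branch s a" unfolding branch_def using sa w(1) \<open>w \<noteq> r0\<close> by blast
    moreover have "s \<in> H" using H_I w(1) calculation(1) by blast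
    ultimately show ?thesis using True sub by blast
  qed
qed

lemma branch_target:
  assumes "branch s a" "s \<in> B w" "w \<in> V"
  shows "a \<in> B w \<or> (w \<noteq> r0 \<and> a \<in> B (par0 w))"
proof -
  from assms(1) show ?thesis
  proof (cases rule: branch_cases)
    case (inside u)
    then have "u = w" using B_disj[OF _ assms(3) _ assms(2)] by blast
    then show ?thesis using inside by blast
  next
    case (up u)
    then have "u = w" using B_disj[OF _ assms(3) _ assms(2)] by blast
    then show ?thesis using up by blast
  qed
qed

text \<open>Induction along the root path. In \<open>B w\<close> the vertex \<open>x\<close> must be
  \<open>w\<close>, and the next pixel is in \<open>B w\<close> or in the branch set of the parent
  of \<open>w\<close>. Outside the branch sets \<open>x\<close> is inherited from the next
  pixel.\<close>

lemma anc_project: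
  assumes tr: "\<And>s. s \<in> M \<Longrightarrow> s \<noteq> rpix \<Longrightarrow> par s \<in> M \<and> d (par s) < (d s :: nat)"
    and br: "\<And>s. s \<in> H \<Longrightarrow> s \<noteq> rpix \<Longrightarrow> branch s (par s)"
    and s: "s \<in> M"
  shows "\<exists>x\<in>V. (\<forall>w\<in>V. s \<in> B w \<longrightarrow> x = w) \<and> (\<forall>p\<in>anc par rpix s. \<forall>w\<in>V. p \<in> B w \<longrightarrow> w \<in> anc par0 r0 x)"
  using s
proof (induction "d s" arbitrary: s rule: less_induct)
  case less
  show ?case
  proof (cases "s = rpix")
    case True
    have "\<forall>w\<in>V. rpix \<in> B w \<longrightarrow> r0 = w" using rpix B_disj root0 by blast
    then show ?thesis using True root0 by (intro bexI[of _ r0]) auto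
  next
    case False
    then have p: "par s \<in> M" "d (par s) < d s" using tr less.prems by blast+
    from less.hyps[OF p(2,1)] obtain x where x: "x \<in> V"
      "\<And>w. w \<in> V \<Longrightarrow> par s \<in> B w \<Longrightarrow> x = w"
      "\<And>p w. p \<in> anc par rpix (par s) \<Longrightarrow> w \<in> V \<Longrightarrow> p \<in> B w \<Longrightarrow> w \<in> anc par0 r0 x" by blast
    note as = anc_step[OF False, of par]
    show ?thesis
    proof (cases "s \<in> H")
      case True
      then obtain w where w: "w \<in> V" "s \<in> B w" unfolding H_def by blast
      have "branch s (par s)" using br True False by blast
      from branch_target[OF this w(2,1)] have "x = w \<or> (w \<noteq> r0 \<and> x = par0 w)"
        using x(2) w(1) par0 by blast
      then have sub: "anc par0 r0 x \<subseteq> anc par0 r0 w" using anc_step[of w r0 par0] by blast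
      have f1: "w = u" if "u \<in> V" "s \<in> B u" for u using B_disj[OF w(1) that(1) w(2) that(2)] .
      have f2: "u \<in> anc par0 r0 w" if "p \<in> anc par rpix s" "u \<in> V" "p \<in> B u" for p u
      proof (cases "p = s")
        case True
        then show ?thesis using f1[of u] that by simp
      next
        case False
        then show ?thesis using that as x(3) sub by blast
      qed
      show ?thesis
        by (rule bexI[OF _ w(1)], intro conjI ballI impI) (fact f1, fact f2)
    next
      case nH: False
      have f1: "x = u" if "u \<in> V" "s \<in> B u" for u using H_I[OF that] nH by blast
      have f2: "u \<in> anc par0 r0 x" if "p \<in> anc par rpix s" "u \<in> V" "p \<in> B u" for p u
      proof -
        have "p \<noteq> s" using H_I[OF that(2,3)] nH by blast
        then show ?thesis using that as x(3) by blast
      qed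
      show ?thesis
        by (rule bexI[OF _ x(1)], intro conjI ballI impI) (fact f1, fact f2)
    qed
  qed
qed

end

section \<open>A separator made of two tree paths\<close>

definition inner :: "int \<Rightarrow> pixel set" where
  "inner N = {p. \<bar>fst p\<bar> < N \<and> \<bar>snd p\<bar> < N}"

definition box :: "int \<Rightarrow> pixel set" where
  "box N = {p. \<bar>fst p\<bar> \<le> N \<and> \<bar>snd p\<bar> \<le> N}"

text \<open>The boundary of the box, except for one edge, becomes part of the tree. The fundamental cycle of the
  remaining edge is then the whole boundary, and its zone contains all squares of the box.\<close>

definition ringpar :: "int \<Rightarrow> pixel \<Rightarrow> pixel" where
  "ringpar N p = (let i = fst p; j = snd p in
     if j = -N then (if i = -N then (i + 1, j) else if i = -N + 1 then (i, j + 1) else (i - 1, j))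
     else if i = -N \<or> i = N then (i, j - 1) else (i - 1, j))"

text \<open>Decreases along \<open>ringpar\<close> until the ring is left at
  \<open>(-N + 1, -N)\<close>, which has rank 1. The extra 2 is for the part of the ring that runs
  over the top and left sides: it arrives at the corner \<open>(-N, -N)\<close> with rank 2, just
  above the exit.\<close>

definition ringrank :: "int \<Rightarrow> pixel \<Rightarrow> nat" where
  "ringrank N p = nat (2 * N + fst p + snd p + (if fst p = -N \<or> snd p = N then 2 else 0))"

lemma finite_box [simp]: "finite (box N)"
proof -
  have "box N \<subseteq> {-N..N} \<times> {-N..N}" by (auto simp: box_def)
  then show ?thesis by (rule finite_subset) simp
qed

lemma ringpar:
  assumes "N > 0" "p \<in> box N" "p \<notin> inner N"
  shows "ringpar N p \<in> box N" "gadj p (ringpar N p)"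
    "ringpar N p \<in> inner N \<or> ringrank N (ringpar N p) < ringrank N p"
proof -
  obtain i j where p: "p = (i, j)" by (cases p)
  have b: "\<bar>i\<bar> \<le> N" "\<bar>j\<bar> \<le> N" "\<bar>i\<bar> = N \<or> \<bar>j\<bar> = N" using assms unfolding p box_def inner_def by auto
  show "ringpar N p \<in> box N"
    using b assms(1) unfolding p ringpar_def box_def Let_def by (simp split: if_splits) linarith
  show "gadj p (ringpar N p)"
    unfolding p ringpar_def gadj_def nb_def Let_def by simp
  show "ringpar N p \<in> inner N \<or> ringrank N (ringpar N p) < ringrank N p"
  proof (cases "j = -N")
    case True
    consider "i = -N" | "i = -N + 1" | "i > -N + 1" using b by linarith
    then show ?thesis
    proof cases
      case 1
      then show ?thesis using True assms(1) unfolding p ringpar_def ringrank_def by simp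
    next
      case 2
      then show ?thesis using True assms(1) unfolding p ringpar_def inner_def Let_def by simp
    next
      case 3
      then show ?thesis using True assms(1) b unfolding p ringpar_def ringrank_def by simp
    qed
  next
    case False
    then have j: "j > -N" using b by linarith
    have "i = -N \<or> i = N \<or> j = N" using b j by linarith
    then consider "i = -N" | "i = N" | "i \<noteq> -N" "i \<noteq> N" "j = N" by blast
    then show ?thesis
    proof cases
      case 1
      then show ?thesis using j b assms(1) unfolding p ringpar_def ringrank_def by simp
    next
      case 2
      then show ?thesis using j b assms(1) unfolding p ringpar_def ringrank_def by simp
    next
      case 3
      then show ?thesis using j b assms(1) unfolding p ringpar_def ringrank_def by (simp; linarith)
    qed
  qed
qed

lemma linked_inner: "linked gadj (inner N)"
  unfolding linked_def
proof (intro allI impI)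
  fix X assume X: "X \<subseteq> inner N" "X \<noteq> {}" "X \<noteq> inner N"
  show "\<exists>a\<in>X. \<exists>b\<in>inner N - X. gadj a b"
  proof (rule ccontr)
    assume "\<not> ?thesis"
    then have cl: "b \<in> X" if "a \<in> X" "b \<in> inner N" "gadj a b" for a b using that by blast
    have right: "(i + int n, j) \<in> X" if "(i, j) \<in> X" "i + int n < N" for i j n
      using that(2)
    proof (induction n)
      case (Suc n)
      then have "(i + int n, j) \<in> X" by simp
      moreover have "(i + int n + 1, j) \<in> inner N"
        using calculation X(1) Suc.prems by (auto simp: inner_def)
      moreover have "gadj (i + int n, j) (i + int n + 1, j)" by (simp add: gadj_def nb_def)
      ultimately have "(i + int n + 1, j) \<in> X" by (rule cl)
      then show ?case by (simp add: algebra_simps)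
    qed (use that in simp)
    have left: "(i - int n, j) \<in> X" if "(i, j) \<in> X" "- N < i - int n" for i j n
      using that(2)
    proof (induction n)
      case (Suc n)
      then have "(i - int n, j) \<in> X" by simp
      moreover have "(i - int n - 1, j) \<in> inner N"
        using calculation X(1) Suc.prems by (auto simp: inner_def)
      moreover have "gadj (i - int n, j) (i - int n - 1, j)" by (simp add: gadj_def nb_def)
      ultimately have "(i - int n - 1, j) \<in> X" by (rule cl)
      then show ?case by (simp add: algebra_simps)
    qed (use that in simp)
    have up: "(i, j + int n) \<in> X" if "(i, j) \<in> X" "j + int n < N" for i j n
      using that(2)
    proof (induction n)
      case (Suc n)
      then have "(i, j + int n) \<in> X" by simp
      moreover have "(i, j + int n + 1) \<in> inner N"
        using calculation X(1) Suc.prems by (auto simp: inner_def)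
      moreover have "gadj (i, j + int n) (i, j + int n + 1)" by (simp add: gadj_def nb_def)
      ultimately have "(i, j + int n + 1) \<in> X" by (rule cl)
      then show ?case by (simp add: algebra_simps)
    qed (use that in simp)
    have down: "(i, j - int n) \<in> X" if "(i, j) \<in> X" "- N < j - int n" for i j n
      using that(2)
    proof (induction n)
      case (Suc n)
      then have "(i, j - int n) \<in> X" by simp
      moreover have "(i, j - int n - 1) \<in> inner N"
        using calculation X(1) Suc.prems by (auto simp: inner_def)
      moreover have "gadj (i, j - int n) (i, j - int n - 1)" by (simp add: gadj_def nb_def)
      ultimately have "(i, j - int n - 1) \<in> X" by (rule cl)
      then show ?case by (simp add: algebra_simps)
    qed (use that in simp)
    have "inner N \<subseteq> X"
    proof
      fix q assume q: "q \<in> inner N"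
      obtain i j where ij: "(i, j) \<in> X" using X(2) by (metis ex_in_conv surj_pair)
      obtain k l where kl: "q = (k, l)" by (cases q)
      have b: "\<bar>k\<bar> < N" "\<bar>l\<bar> < N" using q kl by (auto simp: inner_def)
      have "(k, j) \<in> X"
        using right[OF ij, of "nat (k - i)"] left[OF ij, of "nat (i - k)"] b by (cases "k \<ge> i") auto
      then show "q \<in> X"
        unfolding kl using up[of k j "nat (l - j)"] down[of k j "nat (j - l)"] b by (cases "l \<ge> j") auto
    qed
    then show False using X by blast
  qed
qed

lemma inner_subset_box: "inner N \<subseteq> box N"
  by (auto simp: inner_def box_def)

section \<open>Spanning trees of the box that follow the tree of the graph\<close>

context model_tree
begin

text \<open>Interior pixels outside the branch sets belong to no vertex of the graph and may attach
  to any interior neighbour; the parents of ring pixels are prescribed.\<close>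

definition joint :: "int \<Rightarrow> pixel \<Rightarrow> pixel \<Rightarrow> bool" where
  "joint N s a \<longleftrightarrow> branch s a \<or> (s \<in> inner N - H \<and> a \<in> inner N \<and> gadj s a) \<or>
     (s \<in> box N - inner N \<and> a = ringpar N s)"

lemma grow_box:
  assumes N: "N > 0" "H \<subseteq> inner N" and U: "rpix \<in> U" "U \<subset> box N"
  shows "\<exists>s\<in>box N - U. \<exists>a\<in>U. joint N s a"
proof -
  consider "\<not> H \<subseteq> U" | "H \<subseteq> U" "\<not> inner N \<subseteq> U" | "inner N \<subseteq> U" by blast
  then show ?thesis
  proof cases
    case 1
    from grow_H[OF U(1) this] obtain s a where "s \<in> H - U" "a \<in> U" "branch s a" by blast
    moreover have "s \<in> box N" using calculation(1) N(2) inner_subset_box by blast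
    ultimately show ?thesis unfolding joint_def by blast
  next
    case 2
    have "rpix \<in> H" using rpix root0 H_I by blast
    then have "U \<inter> inner N \<noteq> {}" using U(1) N(2) by blast
    from linkedD[OF linked_inner this 2(2)] obtain a s where as: "a \<in> U \<inter> inner N" "s \<in> inner N - U" "gadj a s"
      by blast
    then have "gadj s a" using gadj_sym by blast
    then have "joint N s a" unfolding joint_def using as 2(1) by blast
    then show ?thesis using as inner_subset_box by blast
  next
    case 3
    obtain s where s: "s \<in> box N - U" and min: "\<And>t. t \<in> box N - U \<Longrightarrow> ringrank N s \<le> ringrank N t"
    proof -
      have "\<exists>s. s \<in> box N - U" using U(2) by blast
      then show thesis using ex_has_least_nat[of "\<lambda>s. s \<in> box N - U" _ "ringrank N"] that by blast
    qed
    have sr: "s \<in> box N" "s \<notin> inner N" using s 3 by blast+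
    have "ringpar N s \<in> U"
    proof (rule ccontr)
      assume n: "ringpar N s \<notin> U"
      then have "ringrank N s \<le> ringrank N (ringpar N s)" using min ringpar(1)[OF N(1) sr] by blast
      moreover have "ringpar N s \<notin> inner N" using n 3 by blast
      ultimately show False using ringpar(3)[OF N(1) sr] by simp
    qed
    then show ?thesis unfolding joint_def using s sr by blast
  qed
qed

lemma joint_props:
  assumes "N > 0" "H \<subseteq> inner N" "joint N s a"
  shows "gadj s a" "s \<in> H \<Longrightarrow> branch s a" "s \<in> box N - inner N \<Longrightarrow> a = ringpar N s"
proof -
  show "gadj s a" using assms(3) ringpar(2)[OF assms(1)] branch_H(3) unfolding joint_def by blast
  show "branch s a" if "s \<in> H" using that assms(2,3) unfolding joint_def by blast
  show "a = ringpar N s" if "s \<in> box N - inner N"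
    using that assms(2,3) branch_H(1) unfolding joint_def by blast
qed

end

section \<open>The box as the zone of one edge\<close>

definition indbox :: "int \<Rightarrow> pixel \<Rightarrow> bit" where
  "indbox N f = (if -N \<le> fst f \<and> fst f < N \<and> -N \<le> snd f \<and> snd f < N then 1 else 0)"

definition gap :: "int \<Rightarrow> pixel set" where
  "gap N = {(N - 1, N), (N, N)}"

lemma finite_indbox: "finite {f. indbox N f \<noteq> 0}"
proof -
  have "{f. indbox N f \<noteq> 0} \<subseteq> box N" by (auto simp: indbox_def box_def split: if_splits)
  then show ?thesis by (rule finite_subset) simp
qed

lemma gap_eq: "gap N = {(N - 1, N), (N - 1 + 1, N)}"
  by (simp add: gap_def)

lemma cob_indbox_gap: "N > 0 \<Longrightarrow> cob (indbox N) (gap N) = 1"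
  unfolding gap_eq cob_hor by (simp add: indbox_def)

lemma indbox_ring:
  assumes N: "N > 0" and e: "e \<in> gedge" "cob (indbox N) e \<noteq> 0"
  shows "e = gap N \<or> (\<exists>s\<in>box N - inner N. e = {s, ringpar N s})"
  using e(1)
proof (cases rule: gedge_cases)
  case (hor i j)
  have "indbox N (i, j) \<noteq> indbox N (i, j - 1)" using e(2)[unfolded hor cob_hor bit_add_zero_iff] .
  then have b: "-N \<le> i" "i < N" "j = N \<or> j = -N" by (auto simp: indbox_def split: if_splits)
  show ?thesis
  proof (cases "j = N")
    case True
    show ?thesis
    proof (cases "i = N - 1")
      case True
      then show ?thesis using hor \<open>j = N\<close> by (simp add: gap_def)
    next
      case False
      then have "ringpar N (i + 1, j) = (i, j)" using b N True unfolding ringpar_def Let_def by simp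
      moreover have "(i + 1, j) \<in> box N - inner N" using b N True unfolding box_def inner_def by simp
      ultimately show ?thesis using hor by (metis insert_commute)
    qed
  next
    case False
    then have j: "j = -N" using b by simp
    show ?thesis
    proof (cases "i = -N")
      case True
      then have "ringpar N (i, j) = (i + 1, j)" using j unfolding ringpar_def Let_def by simp
      moreover have "(i, j) \<in> box N - inner N" using b N j unfolding box_def inner_def by simp
      ultimately show ?thesis using hor by metis
    next
      case False
      then have "ringpar N (i + 1, j) = (i, j)" using b N j unfolding ringpar_def Let_def by simp
      moreover have "(i + 1, j) \<in> box N - inner N" using b N j unfolding box_def inner_def by simp
      ultimately show ?thesis using hor by (metis insert_commute)
    qed
  qed
next
  case (ver i j)
  have "indbox N (i, j) \<noteq> indbox N (i - 1, j)" using e(2)[unfolded ver cob_ver bit_add_zero_iff] .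
  then have b: "-N \<le> j" "j < N" "i = N \<or> i = -N" by (auto simp: indbox_def split: if_splits)
  have "ringpar N (i, j + 1) = (i, j)" using b N unfolding ringpar_def Let_def by auto
  moreover have "(i, j + 1) \<in> box N - inner N" using b N unfolding box_def inner_def by auto
  ultimately show ?thesis using ver by (metis insert_commute)
qed

lemma gap_not_ringpar:
  assumes "N > 0"
  shows "gap N \<noteq> {s, ringpar N s}"
proof
  assume eq: "gap N = {s, ringpar N s}"
  then have "s = (N - 1, N) \<and> ringpar N s = (N, N) \<or> s = (N, N) \<and> ringpar N s = (N - 1, N)"
    unfolding gap_def doubleton_eq_iff by metis
  moreover have "ringpar N (N - 1, N) \<noteq> (N, N)" "ringpar N (N, N) \<noteq> (N - 1, N)"
    using assms unfolding ringpar_def Let_def by simp_all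
  ultimately show False by metis
qed

lemma quad_box:
  assumes "indbox N f \<noteq> 0" "e \<in> quad f"
  shows "\<exists>s t. e = {s, t} \<and> s \<in> box N \<and> t \<in> box N \<and> gadj s t"
proof -
  obtain i j where f: "f = (i, j)" by (cases f)
  have b: "-N \<le> i" "i < N" "-N \<le> j" "j < N" using assms(1) unfolding f indbox_def by (simp_all split: if_splits)
  have in_box: "(i, j) \<in> box N" "(i + 1, j) \<in> box N" "(i, j + 1) \<in> box N" "(i + 1, j + 1) \<in> box N"
    using b unfolding box_def by auto
  have adj: "gadj (i, j) (i + 1, j)" "gadj (i, j + 1) (i + 1, j + 1)" "gadj (i, j) (i, j + 1)"
    "gadj (i + 1, j) (i + 1, j + 1)" unfolding gadj_def nb_def by simp_all
  from assms(2) show ?thesis unfolding f quad_def prod.case insert_iff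
    using in_box adj by blast
qed

text \<open>A pixel is read both as a vertex and as the square with this lower left corner. If no
  edge at a vertex is on the boundary of \<open>S\<close>, the squares around it agree; and the
  squares of two adjacent vertices both lie around one of the two.\<close>

lemma quiet_equal:
  assumes p: "\<And>q. gadj p q \<Longrightarrow> cob S {p, q} = 0" and q: "\<And>r. gadj q r \<Longrightarrow> cob S {q, r} = 0"
    and pq: "gadj p q"
  shows "S p = S q"
proof -
  have *: "S p = S (i - 1, j) \<and> S p = S (i, j - 1)"
    if p: "p = (i, j)" and quiet: "\<And>q. gadj p q \<Longrightarrow> cob S {p, q} = 0" for p i j
  proof -
    have "gadj p (i + 1, j)" "gadj p (i, j + 1)" using p unfolding gadj_def nb_def by simp_all
    then have "cob S {(i, j), (i + 1, j)} = 0" "cob S {(i, j), (i, j + 1)} = 0" using quiet p by blast+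
    then show ?thesis unfolding cob_hor cob_ver p by (simp only: bit_add_zero_iff)
  qed
  obtain i j where pi: "p = (i, j)" by (cases p)
  consider "q = (i + 1, j)" | "q = (i - 1, j)" | "q = (i, j + 1)" | "q = (i, j - 1)"
    using pq unfolding pi gadj_def nb_def by auto
  then show ?thesis
  proof cases
    case 1 then show ?thesis using *[OF 1 q, THEN conjunct1] pi by simp
  next
    case 2 then show ?thesis using *[OF pi p, THEN conjunct1] pi by simp
  next
    case 3 then show ?thesis using *[OF 3 q, THEN conjunct2] pi by simp
  next
    case 4 then show ?thesis using *[OF pi p, THEN conjunct2] pi by simp
  qed
qed

section \<open>From a balanced zone to a separator of the graph\<close>

context model_tree
begin

text \<open>The box provides the start and the hypothesis of the descent: the zone of
  \<open>gap N\<close> is the whole box, hence all zones lie in the box and all sides of their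
  squares are edges of the box. The squares counted are those of one representative pixel per branch
  set.\<close>

lemma balanced_box_zone:
  assumes "\<forall>w\<in>V. rep w \<in> B w"
  shows "\<exists>S s t par d M. rpix \<in> M \<and> s \<in> M \<and> t \<in> M \<and>
     (\<forall>s\<in>M. s \<noteq> rpix \<longrightarrow> par s \<in> M \<and> d (par s) < (d s :: nat)) \<and>
     (\<forall>s\<in>H. s \<noteq> rpix \<longrightarrow> branch s (par s)) \<and>
     (\<forall>e\<in>gedge. cob S e \<noteq> 0 \<longrightarrow> e \<subseteq> anc par rpix s \<union> anc par rpix t) \<and>
     card V \<le> 4 * card {w\<in>V. S (rep w) \<noteq> 0} \<and> 4 * card {w\<in>V. S (rep w) \<noteq> 0} \<le> 3 * card V + 1"
proof -
  have rep: "rep w \<in> B w" if "w \<in> V" for w using assms that by blast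
  obtain N :: int where N: "N > 0" and HN: "\<And>i j. (i, j) \<in> H \<Longrightarrow> \<bar>i\<bar> < N \<and> \<bar>j\<bar> < N"
    using finite_pixels_box[OF finite_H] by blast
  have HI: "H \<subseteq> inner N"
  proof
    fix p assume "p \<in> H"
    then show "p \<in> inner N" using HN[of "fst p" "snd p"] by (simp add: inner_def)
  qed
  have HB: "H \<subseteq> box N" using HI inner_subset_box by blast
  have rH: "rpix \<in> H" using rpix root0 H_I by blast
  then have rB: "rpix \<in> box N" using HB by blast
  obtain par and d :: "pixel \<Rightarrow> nat" where
    pd: "\<forall>s\<in>box N - {rpix}. par s \<in> box N \<and> joint N s (par s) \<and> d (par s) < d s"
    using grow_tree[OF finite_box rB, of "joint N"] grow_box[OF N HI] by blast
  interpret T: grid_tree "box N" rpix par d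
  proof
    fix s assume "s \<in> box N" "s \<noteq> rpix"
    then have "par s \<in> box N" "joint N s (par s)" "d (par s) < d s" using pd by blast+
    then show "par s \<in> box N \<and> gadj s (par s) \<and> d (par s) < d s" using joint_props(1)[OF N HI] by blast
  qed (use rB in simp_all)
  have ring: "par s = ringpar N s" if "s \<in> box N - inner N" for s
  proof -
    have "s \<noteq> rpix" using that rH HI by blast
    then have "joint N s (par s)" using pd that by blast
    then show ?thesis using joint_props(3)[OF N HI _ that] by blast
  qed
  have supp: "e \<in> T.tedges \<union> {gap N}" if e: "e \<in> gedge" "cob (indbox N) e \<noteq> 0" for e
  proof -
    consider "e = gap N" | s where "s \<in> box N - inner N" "e = {s, ringpar N s}"
      using indbox_ring[OF N e] by blast
    then show ?thesis
    proof cases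
      case 2
      then have "e = {s, par s}" "s \<in> box N" "s \<noteq> rpix" using ring[OF 2(1)] rH HI by (simp, blast, blast)
      then show ?thesis unfolding T.tedges_def by blast
    qed blast
  qed
  have gap_ends: "(N - 1, N) \<in> box N - inner N" "(N, N) \<in> box N - inner N"
    using N unfolding box_def inner_def by simp_all
  have gap_ked: "gap N \<in> T.cotree"
  proof -
    have "gap N \<notin> T.tedges"
    proof
      assume "gap N \<in> T.tedges"
      then obtain s where s: "gap N = {s, par s}" unfolding T.tedges_def by blast
      then have "s \<in> {(N - 1, N), (N, N)}" unfolding gap_def by blast
      then have "s \<in> box N - inner N" using gap_ends by blast
      from ring[OF this] s gap_not_ringpar[OF N] show False by metis
    qed
    moreover have "gadj (N - 1, N) (N, N)" unfolding gadj_def nb_def by simp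
    ultimately show ?thesis unfolding T.cotree_def gap_def using gap_ends by blast
  qed
  have zgap: "T.zone (gap N) f = indbox N f" for f
  proof -
    have "finite {gap N}" "{gap N} \<subseteq> T.cotree" using gap_ked by simp_all
    from T.zone_expansion[OF finite_indbox this supp] have "indbox N f = (\<Sum>k\<in>{gap N}. cob (indbox N) k * T.zone k f)" .
    also have "\<dots> = T.zone (gap N) f" using cob_indbox_gap[OF N] by simp
    finally show ?thesis by simp
  qed
  \<comment> \<open>Laminarity with respect to the zone of \<open>gap N\<close>. Both squares at
    \<open>k\<close> are in the box and exactly one of them is in the zone of \<open>k\<close>,
    which forces \<open>a = 1\<close> and \<open>b = 0\<close>.\<close>
  have zin: "indbox N f \<noteq> 0" if k: "k \<in> T.cotree" and f: "T.zone k f \<noteq> 0" for k f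
  proof (cases "k = gap N")
    case True
    then show ?thesis using f zgap by metis
  next
    case False
    obtain a b where ab: "\<And>f. T.zone k f * T.zone (gap N) f = a * T.zone k f + b * T.zone (gap N) f"
      using T.zone_mult[OF k gap_ked False] by blast
    have kg: "k \<in> gedge" using k T.cotree_gedge by blast
    have "k \<notin> T.tedges" using k unfolding T.cotree_def by blast
    then have c0: "cob (indbox N) k = 0" using supp[OF kg] False by blast
    have same: "indbox N (sq1 k) = indbox N (sq2 k)" using c0 unfolding cob_def by (simp only: bit_add_zero_iff)
    have kk: "k \<subseteq> box N" using k unfolding T.cotree_def by blast
    have "indbox N (sq1 k) = 1 \<or> indbox N (sq2 k) = 1"
      using kg
    proof (cases rule: gedge_cases)
      case (hor i j)
      then have "(i, j) \<in> box N" "(i + 1, j) \<in> box N" using kk by simp_all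
      then show ?thesis unfolding hor sq_hor box_def indbox_def by auto
    next
      case (ver i j)
      then have "(i, j) \<in> box N" "(i, j + 1) \<in> box N" using kk by simp_all
      then show ?thesis unfolding ver sq_ver box_def indbox_def by auto
    qed
    then have one: "indbox N (sq1 k) = 1" "indbox N (sq2 k) = 1" using same by simp_all
    have "T.zone k (sq1 k) + T.zone k (sq2 k) = 1" using T.zone(2)[OF k] unfolding cob_def .
    moreover have "T.zone k (sq1 k) = a * T.zone k (sq1 k) + b" "T.zone k (sq2 k) = a * T.zone k (sq2 k) + b"
      using ab[of "sq1 k"] ab[of "sq2 k"] one zgap by simp_all
    ultimately have "a = 1 \<and> b = 0"
      by (cases "T.zone k (sq1 k)"; cases "T.zone k (sq2 k)"; cases a; cases b) auto
    then have "T.zone k f * indbox N f = T.zone k f" using ab[of f] zgap by simp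
    then show ?thesis using f by (metis mult_zero_right)
  qed
  have quads: "quad f \<subseteq> T.tedges \<union> T.cotree" if "k \<in> T.cotree" "T.zone k f \<noteq> 0" for k f
  proof
    fix e assume "e \<in> quad f"
    from quad_box[OF zin[OF that] this] show "e \<in> T.tedges \<union> T.cotree" unfolding T.cotree_def by blast
  qed
  have inj: "inj_on rep V"
  proof (rule inj_onI)
    fix u w assume "u \<in> V" "w \<in> V" "rep u = rep w"
    then show "u = w" using B_disj[of u w "rep u"] rep[of u] rep[of w] by simp
  qed
  have cR: "card (rep ` V) = card V" by (rule card_image[OF inj])
  have repin: "T.zone (gap N) f \<noteq> 0" if "f \<in> rep ` V" for f
  proof -
    from that obtain w where "w \<in> V" "f = rep w" by blast
    then have "f \<in> inner N" using rep H_I HI by blast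
    then have "indbox N f = 1" unfolding inner_def indbox_def by auto
    then show ?thesis using zgap by simp
  qed
  have pos: "card (rep ` V) > 0" unfolding cR using finV root0 card_gt_0_iff by blast
  have "\<exists>k\<in>T.cotree. card (rep ` V) \<le> 4 * card {f \<in> rep ` V. T.zone k f \<noteq> 0} \<and>
    4 * card {f \<in> rep ` V. T.zone k f \<noteq> 0} \<le> 3 * card (rep ` V) + 1"
    by (rule T.balanced_zone[OF finite_imageI[OF finV] pos _ gap_ked]) (fact quads, fact repin)
  then obtain k where
    k: "k \<in> T.cotree" "card (rep ` V) \<le> 4 * card {f \<in> rep ` V. T.zone k f \<noteq> 0}"
    "4 * card {f \<in> rep ` V. T.zone k f \<noteq> 0} \<le> 3 * card (rep ` V) + 1" by blast
  have e1: "{f \<in> rep ` V. T.zone k f \<noteq> 0} = rep ` {w\<in>V. T.zone k (rep w) \<noteq> 0}" by blast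
  have e2: "inj_on rep {w\<in>V. T.zone k (rep w) \<noteq> 0}" using inj by (rule inj_on_subset) blast
  have cW: "card {f \<in> rep ` V. T.zone k f \<noteq> 0} = card {w\<in>V. T.zone k (rep w) \<noteq> 0}"
    unfolding e1 by (rule card_image[OF e2])
  obtain s t where st: "s \<in> box N" "t \<in> box N"
    "\<forall>e\<in>gedge. cob (T.zone k) e \<noteq> 0 \<longrightarrow> e \<subseteq> anc par rpix s \<union> anc par rpix t"
    using T.zone(4)[OF k(1)] by blast
  have br: "\<forall>s\<in>H. s \<noteq> rpix \<longrightarrow> branch s (par s)"
  proof (intro ballI impI)
    fix s assume s: "s \<in> H" "s \<noteq> rpix"
    then have "joint N s (par s)" using pd HB by blast
    then show "branch s (par s)" using joint_props(2)[OF N HI] s(1) by blast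
  qed
  have dec: "\<forall>s\<in>box N. s \<noteq> rpix \<longrightarrow> par s \<in> box N \<and> d (par s) < d s" using pd by blast
  show ?thesis
    by (rule exI[of _ "T.zone k"], rule exI[of _ s], rule exI[of _ t], rule exI[of _ par],
        rule exI[of _ d], rule exI[of _ "box N"], intro conjI)
      (fact rB, fact st(1), fact st(2), fact dec, fact br, fact st(3), fact k(2)[unfolded cW cR], fact k(3)[unfolded cW cR])
qed

text \<open>\<open>Z\<close> consists of the vertices whose branch set touches the cycle. On any
  other branch set \<open>S\<close> is constant, which decides between \<open>L\<close> and
  \<open>R\<close>. Each bound counts \<open>Z\<close> with the side, because the firefighters save
  the separator along with it.\<close>

theorem separator:
  "\<exists>Z L R x y. Z \<union> L \<union> R = V \<and> Z \<inter> L = {} \<and> Z \<inter> R = {} \<and> L \<inter> R = {} \<and>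
     (\<forall>u\<in>L. \<forall>w\<in>R. {u, w} \<notin> E) \<and> x \<in> V \<and> y \<in> V \<and> Z \<subseteq> anc par0 r0 x \<union> anc par0 r0 y \<and>
     card V \<le> 4 * card (L \<union> Z) \<and> card V \<le> 4 * card (R \<union> Z) + 1"
proof -
  define rep where "rep w = (SOME p. p \<in> B w)" for w
  have rep: "rep w \<in> B w" if "w \<in> V" for w using B_ne[OF that] unfolding rep_def by (simp add: some_in_eq)
  have "\<forall>w\<in>V. rep w \<in> B w" using rep by blast
  from balanced_box_zone[OF this] obtain S s t par and d :: "pixel \<Rightarrow> nat" and M where
    zone: "rpix \<in> M \<and> s \<in> M \<and> t \<in> M \<and>
     (\<forall>s\<in>M. s \<noteq> rpix \<longrightarrow> par s \<in> M \<and> d (par s) < (d s :: nat)) \<and>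
     (\<forall>s\<in>H. s \<noteq> rpix \<longrightarrow> branch s (par s)) \<and>
     (\<forall>e\<in>gedge. cob S e \<noteq> 0 \<longrightarrow> e \<subseteq> anc par rpix s \<union> anc par rpix t) \<and>
     card V \<le> 4 * card {w\<in>V. S (rep w) \<noteq> 0} \<and> 4 * card {w\<in>V. S (rep w) \<noteq> 0} \<le> 3 * card V + 1"
    by (elim exE)
  from zone have st: "rpix \<in> M" "s \<in> M" "t \<in> M" and tr: "\<forall>s\<in>M. s \<noteq> rpix \<longrightarrow> par s \<in> M \<and> d (par s) < d s"
    and br: "\<forall>s\<in>H. s \<noteq> rpix \<longrightarrow> branch s (par s)"
    and supp: "\<forall>e\<in>gedge. cob S e \<noteq> 0 \<longrightarrow> e \<subseteq> anc par rpix s \<union> anc par rpix t"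
    and c: "card V \<le> 4 * card {w\<in>V. S (rep w) \<noteq> 0}" "4 * card {w\<in>V. S (rep w) \<noteq> 0} \<le> 3 * card V + 1"
    by - (elim conjE, assumption)+
  obtain x where x: "x \<in> V" "\<And>p w. p \<in> anc par rpix s \<Longrightarrow> w \<in> V \<Longrightarrow> p \<in> B w \<Longrightarrow> w \<in> anc par0 r0 x"
    using anc_project[of M par d s] tr br st(2) by blast
  obtain y where y: "y \<in> V" "\<And>p w. p \<in> anc par rpix t \<Longrightarrow> w \<in> V \<Longrightarrow> p \<in> B w \<Longrightarrow> w \<in> anc par0 r0 y"
    using anc_project[of M par d t] tr br st(3) by blast
  define Z where "Z = {w\<in>V. \<exists>p\<in>B w. \<exists>q. gadj p q \<and> cob S {p, q} \<noteq> 0}"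
  define L where "L = {w\<in>V - Z. S (rep w) \<noteq> 0}"
  define R where "R = {w\<in>V - Z. S (rep w) = 0}"
  have quiet: "cob S {p, q} = 0" if "w \<in> V" "w \<notin> Z" "p \<in> B w" "gadj p q" for w p q
    using that unfolding Z_def by blast
  have step: "S p = S q" if "u \<in> V" "u \<notin> Z" "w \<in> V" "w \<notin> Z" "p \<in> B u" "q \<in> B w" "gadj p q" for u w p q
    using quiet_equal[OF quiet[OF that(1,2,5)] quiet[OF that(3,4,6)] that(7)] .
  have const: "S p = S (rep w)" if w: "w \<in> V" "w \<notin> Z" "p \<in> B w" for w p
  proof -
    have "B w \<subseteq> {p. S p = S (rep w)}"
    proof (rule linked_closed[OF B_linked[OF w(1)] _ rep[OF w(1)]])
      fix a b assume "a \<in> {p. S p = S (rep w)}" "a \<in> B w" "b \<in> B w" "gadj a b"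
      then show "b \<in> {p. S p = S (rep w)}" using step[OF w(1,2) w(1,2), of a b] by simp
    qed simp
    then show ?thesis using w(3) by blast
  qed
  have noedge: "{u, w} \<notin> E" if "u \<in> L" "w \<in> R" for u w
  proof
    assume e: "{u, w} \<in> E"
    have uw: "u \<in> V" "u \<notin> Z" "w \<in> V" "w \<notin> Z" "u \<noteq> w" using that unfolding L_def R_def by auto
    note p = port[OF uw(1,3,5) e]
    have "S (rep u) = S (rep w)"
      using step[OF uw(1-4) p] const[OF uw(1,2) p(1)] const[OF uw(3,4) p(2)] by simp
    then show False using that unfolding L_def R_def by simp
  qed
  have Zsub: "Z \<subseteq> anc par0 r0 x \<union> anc par0 r0 y"
  proof
    fix w assume "w \<in> Z"
    then obtain p q where pq: "w \<in> V" "p \<in> B w" "gadj p q" "cob S {p, q} \<noteq> 0" unfolding Z_def by blast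
    then have "{p, q} \<in> gedge" unfolding gedge_def by blast
    then have "p \<in> anc par rpix s \<union> anc par rpix t" using supp pq(4) by blast
    then show "w \<in> anc par0 r0 x \<union> anc par0 r0 y" using x(2) y(2) pq by blast
  qed
  have "{w\<in>V. S (rep w) \<noteq> 0} \<subseteq> L \<union> Z" unfolding L_def by blast
  then have "card {w\<in>V. S (rep w) \<noteq> 0} \<le> card (L \<union> Z)"
    by (intro card_mono) (simp_all add: finV L_def Z_def)
  then have c1: "card V \<le> 4 * card (L \<union> Z)" using c(1) by simp
  have "V = {w\<in>V. S (rep w) \<noteq> 0} \<union> {w\<in>V. S (rep w) = 0}" by blast
  then have "card V = card ({w\<in>V. S (rep w) \<noteq> 0} \<union> {w\<in>V. S (rep w) = 0})" by simp
  also have "\<dots> \<le> card {w\<in>V. S (rep w) \<noteq> 0} + card {w\<in>V. S (rep w) = 0}" by (rule card_Un_le)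
  finally have "card V \<le> card {w\<in>V. S (rep w) \<noteq> 0} + card {w\<in>V. S (rep w) = 0}" .
  moreover have "card {w\<in>V. S (rep w) = 0} \<le> card (R \<union> Z)"
    by (intro card_mono) (auto simp: finV R_def Z_def)
  ultimately have c2: "card V \<le> 4 * card (R \<union> Z) + 1" using c(2) by simp
  have "Z \<union> L \<union> R = V" "Z \<inter> L = {}" "Z \<inter> R = {}" "L \<inter> R = {}" unfolding Z_def L_def R_def by auto
  with noedge x(1) y(1) Zsub c1 c2 show ?thesis by blast
qed

end

section \<open>The edge bound for triangle-free graphs\<close>

lemma edge_subset:
  assumes "simple_graph V E" "g \<in> E"
  shows "g \<subseteq> V"
proof -
  obtain u v where "u \<in> V" "v \<in> V" "g = {u, v}" using assms unfolding simple_graph_def by metis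
  then show ?thesis by simp
qed

lemma finite_edges:
  assumes "simple_graph V E"
  shows "finite E"
proof -
  have "E \<subseteq> Pow V" using edge_subset[OF assms] by blast
  moreover have "finite V" using assms unfolding simple_graph_def by blast
  ultimately show ?thesis using finite_subset by blast
qed

text \<open>An edge \<open>{a, b}\<close> extends to edges \<open>{a, c}\<close> and
  \<open>{b, d}\<close>, where \<open>c\<close> and \<open>d\<close> differ for lack of triangles. A
  second edge \<open>{c, f}\<close> at \<open>c\<close> is new, since \<open>f\<close> is not
  \<open>a\<close>, and not \<open>b\<close> either for the same reason.\<close>

lemma min_degree_two_card_ge_4:
  assumes gr: "simple_graph V E" and tf: "triangle_free V E"
    and D: "finite D" "D \<subseteq> E" "D \<noteq> {}"
    and deg: "\<And>g w. g \<in> D \<Longrightarrow> w \<in> g \<Longrightarrow> \<exists>g'\<in>D. g' \<noteq> g \<and> w \<in> g'"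
  shows "card D \<ge> 4"
proof -
  have ed: "\<exists>u v. u \<in> V \<and> v \<in> V \<and> u \<noteq> v \<and> e = {u, v}" if "e \<in> E" for e
    using gr that unfolding simple_graph_def by blast
  have other: "\<exists>z. z \<in> V \<and> w \<in> V \<and> z \<noteq> w \<and> g' = {w, z}" if "g' \<in> E" "w \<in> g'" for g' w
    using ed[OF that(1)] that(2) by (metis empty_iff insert_commute insert_iff)
  have next_edge: "\<exists>z. z \<in> V \<and> z \<noteq> w \<and> z \<noteq> a \<and> {w, z} \<in> D" if "{w, a} \<in> D" for w a
  proof -
    from deg[OF that, of w] obtain g' where g': "g' \<in> D" "g' \<noteq> {w, a}" "w \<in> g'" by blast
    with other[of g' w] D(2) obtain z where "z \<in> V" "z \<noteq> w" "g' = {w, z}" by blast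
    then show ?thesis using g' by blast
  qed
  obtain g where "g \<in> D" using D(3) by blast
  then obtain a b where ab: "a \<in> V" "b \<in> V" "a \<noteq> b" "{a, b} \<in> D" using ed D(2) by blast
  obtain c where c: "c \<in> V" "c \<noteq> a" "c \<noteq> b" "{a, c} \<in> D" using next_edge[OF ab(4)] by blast
  have "{b, a} \<in> D" using ab(4) by (simp add: insert_commute)
  from next_edge[OF this] obtain d where d: "d \<in> V" "d \<noteq> b" "d \<noteq> a" "{b, d} \<in> D" by blast
  have "{c, a} \<in> D" using c(4) by (simp add: insert_commute)
  from next_edge[OF this] obtain f where f: "f \<in> V" "f \<noteq> c" "f \<noteq> a" "{c, f} \<in> D" by blast
  have nbc: "{b, c} \<notin> E"
    using tf ab c D(2) unfolding triangle_free_def by blast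
  have "d \<noteq> c" using d(4) nbc D(2) by blast
  have "f \<noteq> b"
  proof
    assume "f = b"
    then have "{b, c} \<in> D" using f(4) by (simp add: insert_commute)
    then show False using nbc D(2) by blast
  qed
  have dist: "distinct [{a, b}, {a, c}, {b, d}, {c, f}]"
    using ab c d f \<open>d \<noteq> c\<close> \<open>f \<noteq> b\<close> by (simp add: doubleton_eq_iff)
  have "4 = length [{a, b}, {a, c}, {b, d}, {c, f}]" by simp
  also have "\<dots> = card (set [{a, b}, {a, c}, {b, d}, {c, f}])" using distinct_card[OF dist] by simp
  also have "\<dots> \<le> card D" by (rule card_mono) (use D(1) ab c d f in simp_all)
  finally show ?thesis .
qed

text \<open>Every edge inside \<open>A\<close> is counted from both of its ends.\<close>

lemma inner_sum_zero:
  fixes x :: "pixel set \<Rightarrow> bit"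
  assumes "finite A"
  shows "(\<Sum>p\<in>A. \<Sum>q\<in>nb p \<inter> A. x {p, q}) = 0"
  using assms
proof (induction A rule: finite_induct)
  case (insert b A)
  have b: "nb b \<inter> insert b A = nb b \<inter> A" using gadj_irrefl[of b] unfolding gadj_def by blast
  have "(\<Sum>q\<in>nb p \<inter> insert b A. x {p, q}) = (if b \<in> nb p then x {p, b} else 0) + (\<Sum>q\<in>nb p \<inter> A. x {p, q})"
    if "p \<in> A" for p
  proof (cases "b \<in> nb p")
    case True
    then have "nb p \<inter> insert b A = insert b (nb p \<inter> A)" by blast
    then show ?thesis using True insert.hyps by simp
  next
    case False
    then have "nb p \<inter> insert b A = nb p \<inter> A" by blast
    then show ?thesis using False by simp
  qed
  then have "(\<Sum>p\<in>A. \<Sum>q\<in>nb p \<inter> insert b A. x {p, q}) =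
    (\<Sum>p\<in>A. if b \<in> nb p then x {p, b} else 0) + (\<Sum>p\<in>A. \<Sum>q\<in>nb p \<inter> A. x {p, q})"
    by (simp add: sum.distrib)
  also have "(\<Sum>p\<in>A. if b \<in> nb p then x {p, b} else 0) = (\<Sum>p\<in>A \<inter> {p. b \<in> nb p}. x {p, b})"
    using insert.hyps(1) by (simp add: sum.inter_restrict)
  also have "A \<inter> {p. b \<in> nb p} = nb b \<inter> A" using gadj_sym[of b] unfolding gadj_def by blast
  also have "(\<Sum>p\<in>nb b \<inter> A. x {p, b}) = (\<Sum>q\<in>nb b \<inter> A. x {b, q})" by (simp add: insert_commute)
  finally show ?case using insert.hyps insert.IH b by simp
qed simp

section \<open>Edges of the graph as edges of the grid\<close>

context model_tree
begin

definition treeE :: "'a set set" where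
  "treeE = {{w, par0 w} | w. w \<in> V \<and> w \<noteq> r0}"

text \<open>A direction is needed because \<open>port u v\<close> and \<open>port v u\<close> are
  separate choices. Tree edges point to the parent, so that \<open>pedge\<close> sends them to the
  very grid edges that \<open>branch\<close> uses.\<close>

definition orient :: "'a set \<Rightarrow> 'a \<times> 'a" where
  "orient g = (SOME uv. g = {fst uv, snd uv} \<and> fst uv \<in> V \<and> snd uv \<in> V \<and> fst uv \<noteq> snd uv \<and>
     (g \<in> treeE \<longrightarrow> fst uv \<noteq> r0 \<and> snd uv = par0 (fst uv)))"

definition pedge :: "'a set \<Rightarrow> pixel set" where
  "pedge g = {fst (port (fst (orient g)) (snd (orient g))), snd (port (fst (orient g)) (snd (orient g)))}"

lemma treeE_E: "treeE \<subseteq> E"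
  unfolding treeE_def using par0 by blast

lemma card_treeE: "card treeE \<le> card V - 1"
proof -
  have "treeE = (\<lambda>w. {w, par0 w}) ` (V - {r0})" unfolding treeE_def by blast
  then have "card treeE \<le> card (V - {r0})" using finV by (simp add: card_image_le)
  then show ?thesis using root0 finV by simp
qed

lemma orient:
  assumes gr: "simple_graph V E" and g: "g \<in> E"
  shows "g = {fst (orient g), snd (orient g)}" "fst (orient g) \<in> V" "snd (orient g) \<in> V"
    "fst (orient g) \<noteq> snd (orient g)" "g \<in> treeE \<Longrightarrow> fst (orient g) \<noteq> r0 \<and> snd (orient g) = par0 (fst (orient g))"
proof -
  have "\<exists>uv. g = {fst uv, snd uv} \<and> fst uv \<in> V \<and> snd uv \<in> V \<and> fst uv \<noteq> snd uv \<and>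
     (g \<in> treeE \<longrightarrow> fst uv \<noteq> r0 \<and> snd uv = par0 (fst uv))"
  proof (cases "g \<in> treeE")
    case True
    then obtain w where w: "g = {w, par0 w}" "w \<in> V" "w \<noteq> r0" unfolding treeE_def by blast
    show ?thesis by (rule exI[of _ "(w, par0 w)"]) (use w par0[OF w(2,3)] par0_neq[OF w(2,3)] in auto)
  next
    case False
    obtain u v where "u \<in> V" "v \<in> V" "u \<noteq> v" "g = {u, v}" using gr g unfolding simple_graph_def by blast
    then show ?thesis using False by (intro exI[of _ "(u, v)"]) simp
  qed
  note o = someI_ex[OF this, folded orient_def]
  from o show "g = {fst (orient g), snd (orient g)}" "fst (orient g) \<in> V" "snd (orient g) \<in> V"
    "fst (orient g) \<noteq> snd (orient g)"
    by - (elim conjE, assumption)+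
  from o have "g \<in> treeE \<longrightarrow> fst (orient g) \<noteq> r0 \<and> snd (orient g) = par0 (fst (orient g))"
    by - (elim conjE, assumption)
  then show "g \<in> treeE \<Longrightarrow> fst (orient g) \<noteq> r0 \<and> snd (orient g) = par0 (fst (orient g))" by (rule mp)
qed

lemma pedge:
  assumes gr: "simple_graph V E" and g: "g \<in> E"
  obtains u v a b where "g = {u, v}" "u \<in> V" "v \<in> V" "u \<noteq> v" "pedge g = {a, b}" "a \<in> B u" "b \<in> B v" "gadj a b"
proof -
  note o = orient[OF gr g]
  from o(1) g have "{fst (orient g), snd (orient g)} \<in> E" by simp
  note p = port[OF o(2,3,4) this]
  show thesis by (rule that[OF o(1,2,3,4) pedge_def p])
qed

lemma pedge_touch:
  assumes gr: "simple_graph V E" and g: "g \<in> E" and w: "w \<in> V"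
  shows "w \<in> g \<longleftrightarrow> B w \<inter> pedge g \<noteq> {}"
proof -
  obtain u v a b where p: "g = {u, v}" "u \<in> V" "v \<in> V" "u \<noteq> v" "pedge g = {a, b}" "a \<in> B u" "b \<in> B v" "gadj a b"
    using pedge[OF gr g] by blast
  show ?thesis
  proof
    assume "w \<in> g" then show "B w \<inter> pedge g \<noteq> {}" using p by blast
  next
    assume "B w \<inter> pedge g \<noteq> {}"
    then have "B w \<inter> {a, b} \<noteq> {}" using p(5) by simp
    then have "a \<in> B w \<or> b \<in> B w" by blast
    then show "w \<in> g" using B_disj[OF p(2) w p(6)] B_disj[OF p(3) w p(7)] p(1) by blast
  qed
qed

lemma pedge_inj:
  assumes gr: "simple_graph V E"
  shows "inj_on pedge E"
proof (rule inj_onI)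
  fix g h assume g: "g \<in> E" "h \<in> E" "pedge g = pedge h"
  have "g \<subseteq> V" "h \<subseteq> V" using edge_subset[OF gr] g by simp_all
  moreover have "w \<in> g \<longleftrightarrow> w \<in> h" if "w \<in> V" for w
    using pedge_touch[OF gr g(1) that] pedge_touch[OF gr g(2) that] g(3) by simp
  ultimately show "g = h" by blast
qed

lemma branch_edge:
  assumes gr: "simple_graph V E" and br: "branch s a"
  shows "(\<exists>w\<in>V. {s, a} \<subseteq> B w) \<or> {s, a} \<in> pedge ` treeE"
  using br
proof (cases rule: branch_cases)
  case (inside w)
  then show ?thesis by blast
next
  case (up w)
  let ?g = "{w, par0 w}"
  have g: "?g \<in> treeE" unfolding treeE_def using up by blast
  then have "?g \<in> E" using treeE_E by blast
  note o = orient[OF gr this]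
  have f: "fst (orient ?g) \<noteq> r0" "snd (orient ?g) = par0 (fst (orient ?g))" using o(5)[OF g] by blast+
  have "fst (orient ?g) = w"
  proof (rule ccontr)
    assume n: "fst (orient ?g) \<noteq> w"
    then have "fst (orient ?g) = par0 w" "snd (orient ?g) = w" using o(1) by (auto simp: doubleton_eq_iff)
    then have "par0 (par0 w) = w" "par0 w \<noteq> r0" using f by simp_all
    then show False using par0[OF up(1,2)] par0[OF up(6)] by fastforce
  qed
  then have "pedge ?g = {fst (port w (par0 w)), snd (port w (par0 w))}" unfolding pedge_def using f by simp
  also have "\<dots> = {s, a}" unfolding up(3)[symmetric] by simp
  finally show ?thesis using g by blast
qed

text \<open>Sum \<open>bd (cob S)\<close> over \<open>B w\<close>. Edges inside \<open>B w\<close>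
  cancel, and the edges leaving it that lie on the boundary of \<open>S\<close> represent graph
  edges at \<open>w\<close>. So the graph edges on the boundary of a set of squares have even degree
  everywhere.\<close>

lemma vertex_parity:
  assumes gr: "simple_graph V E" and w: "w \<in> V"
    and supp: "\<And>e. e \<in> gedge \<Longrightarrow> cob S e \<noteq> 0 \<Longrightarrow> (\<exists>u\<in>V. e \<subseteq> B u) \<or> e \<in> pedge ` E"
  shows "(\<Sum>g\<in>{g\<in>E. w \<in> g}. cob S (pedge g)) = 0"
proof -
  define Q where "Q = (SIGMA p:B w. nb p - B w)"
  have finQ: "finite Q" unfolding Q_def using B_fin[OF w] by simp
  define ori where "ori g = (SOME ab. fst ab \<in> B w \<and> snd ab \<notin> B w \<and> gadj (fst ab) (snd ab) \<and> pedge g = {fst ab, snd ab})" for g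
  have ori: "fst (ori g) \<in> B w \<and> snd (ori g) \<notin> B w \<and> gadj (fst (ori g)) (snd (ori g)) \<and> pedge g = {fst (ori g), snd (ori g)}"
    if g: "g \<in> {g\<in>E. w \<in> g}" for g
  proof -
    obtain u v a b where p: "g = {u, v}" "u \<in> V" "v \<in> V" "u \<noteq> v" "pedge g = {a, b}" "a \<in> B u" "b \<in> B v" "gadj a b"
      using pedge[OF gr, of g] g by blast
    have "\<exists>ab. fst ab \<in> B w \<and> snd ab \<notin> B w \<and> gadj (fst ab) (snd ab) \<and> pedge g = {fst ab, snd ab}"
    proof (cases "u = w")
      case True
      then have "b \<notin> B w" using B_disj[OF p(3) w p(7)] p(4) by blast
      then show ?thesis using p True by (intro exI[of _ "(a, b)"]) simp
    next
      case False
      then have "v = w" using g p(1) by blast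
      moreover have "a \<notin> B w" using B_disj[OF p(2) w p(6)] False by blast
      moreover have "gadj b a" using p(8) gadj_sym by blast
      ultimately show ?thesis using p by (intro exI[of _ "(b, a)"]) (simp add: insert_commute)
    qed
    from someI_ex[OF this, folded ori_def] show ?thesis .
  qed
  have inj: "inj_on ori {g\<in>E. w \<in> g}"
  proof (rule inj_onI)
    fix g h assume g: "g \<in> {g\<in>E. w \<in> g}" and h: "h \<in> {g\<in>E. w \<in> g}" and eq: "ori g = ori h"
    have "pedge g = pedge h" using ori[OF g] ori[OF h] eq by simp
    then show "g = h" using pedge_inj[OF gr] g h unfolding inj_on_def by blast
  qed
  have sub: "ori ` {g\<in>E. w \<in> g} \<subseteq> Q"
  proof
    fix z assume "z \<in> ori ` {g\<in>E. w \<in> g}"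
    then obtain g where g: "g \<in> {g\<in>E. w \<in> g}" "z = ori g" by blast
    obtain p q where pq: "z = (p, q)" by (cases z)
    have og: "ori g = (p, q)" using g(2) pq by simp
    have "p \<in> B w" "q \<notin> B w" "q \<in> nb p" using ori[OF g(1)] unfolding og gadj_def by simp_all
    then show "z \<in> Q" unfolding Q_def pq by blast
  qed
  have zero: "cob S {fst z, snd z} = 0" if z: "z \<in> Q - ori ` {g\<in>E. w \<in> g}" for z
  proof (rule ccontr)
    assume nz: "cob S {fst z, snd z} \<noteq> 0"
    obtain p q where pq: "z = (p, q)" by (cases z)
    have m: "p \<in> B w" "q \<in> nb p" "q \<notin> B w" using z pq unfolding Q_def by auto
    have "{p, q} \<in> gedge" using m(2) unfolding gedge_def gadj_def by blast
    moreover have "cob S {p, q} \<noteq> 0" using nz unfolding pq fst_conv snd_conv .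
    ultimately have "(\<exists>u\<in>V. {p, q} \<subseteq> B u) \<or> {p, q} \<in> pedge ` E" by (rule supp)
    moreover have "\<not> (\<exists>u\<in>V. {p, q} \<subseteq> B u)" using m B_disj[OF w _ m(1)] by blast
    ultimately obtain g where g: "g \<in> E" "pedge g = {p, q}" by blast
    have "w \<in> g" using pedge_touch[OF gr g(1) w] g(2) m(1) by blast
    then have gw: "g \<in> {g\<in>E. w \<in> g}" using g(1) by blast
    have o: "fst (ori g) \<in> B w" "snd (ori g) \<notin> B w" "{p, q} = {fst (ori g), snd (ori g)}"
      using ori[OF gw] g(2) by simp_all
    have "fst (ori g) = p" "snd (ori g) = q" using o m by (metis doubleton_eq_iff)+
    then have "z = ori g" using pq by (simp add: prod_eq_iff)
    then show False using z gw by blast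
  qed
  have "0 = (\<Sum>p\<in>B w. bd (cob S) p)" by (simp add: bd_cob)
  also have "\<dots> = (\<Sum>p\<in>B w. (\<Sum>q\<in>nb p \<inter> B w. cob S {p, q}) + (\<Sum>q\<in>nb p - B w. cob S {p, q}))"
    unfolding bd_def by (intro sum.cong refl) (simp add: sum.Int_Diff[OF finite_nb])
  also have "\<dots> = (\<Sum>p\<in>B w. \<Sum>q\<in>nb p - B w. cob S {p, q})"
    unfolding sum.distrib inner_sum_zero[OF B_fin[OF w]] by simp
  also have "\<dots> = (\<Sum>z\<in>Q. cob S {fst z, snd z})"
    unfolding Q_def using B_fin[OF w] by (simp add: sum.Sigma case_prod_beta)
  also have "\<dots> = (\<Sum>z\<in>ori ` {g\<in>E. w \<in> g}. cob S {fst z, snd z})"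
    by (rule sum.mono_neutral_right[OF finQ sub]) (use zero in blast)
  also have "\<dots> = (\<Sum>g\<in>{g\<in>E. w \<in> g}. cob S {fst (ori g), snd (ori g)})"
    by (simp add: sum.reindex[OF inj])
  also have "\<dots> = (\<Sum>g\<in>{g\<in>E. w \<in> g}. cob S (pedge g))"
    by (intro sum.cong refl) (use ori in simp)
  finally show ?thesis by simp
qed

end

section \<open>Double counting of edges and classes of squares\<close>

context model_tree
begin

text \<open>Assign each square to the smallest zone containing it. The resulting classes are as many as the
  non-tree edges plus one, the boundary of each class has at least four edges of the graph, and each
  edge lies on the boundary of at most two classes.\<close>

lemma edge_bound_connected:
  assumes gr: "simple_graph V E" and tf: "triangle_free V E"
  shows "card E \<le> 2 * card V"
proof -
  note finE = finite_edges[OF gr]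
  have rH: "rpix \<in> H" using rpix root0 H_I by blast
  have "\<exists>s\<in>H - U. \<exists>a\<in>U. branch s a" if "rpix \<in> U" "U \<subset> H" for U
    using grow_H[OF that(1)] that(2) by blast
  from grow_tree[OF finite_H rH, of branch, OF this] obtain par and d :: "pixel \<Rightarrow> nat" where
    pd: "\<forall>s\<in>H - {rpix}. par s \<in> H \<and> branch s (par s) \<and> d (par s) < d s" by blast
  interpret T: grid_tree H rpix par d
  proof
    fix s assume "s \<in> H" "s \<noteq> rpix"
    then have "par s \<in> H" "branch s (par s)" "d (par s) < d s" using pd by blast+
    then show "par s \<in> H \<and> gadj s (par s) \<and> d (par s) < d s" using branch_H(3) by blast
  qed (use rH finite_H in simp_all)
  have tree_kind: "(\<exists>w\<in>V. e \<subseteq> B w) \<or> e \<in> pedge ` treeE" if te: "e \<in> T.tedges" for e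
  proof -
    obtain s where s: "e = {s, par s}" "s \<in> H" "s \<noteq> rpix" using te unfolding T.tedges_def by blast
    then have "branch s (par s)" using pd by blast
    then show ?thesis using branch_edge[OF gr] s(1) by blast
  qed
  define K where "K = pedge ` (E - treeE)"
  have finK: "finite K" unfolding K_def using finE by simp
  have K_ked: "K \<subseteq> T.cotree"
  proof
    fix k assume "k \<in> K"
    then obtain g where g: "g \<in> E" "g \<notin> treeE" "k = pedge g" unfolding K_def by blast
    obtain u v a b where p: "g = {u, v}" "u \<in> V" "v \<in> V" "u \<noteq> v" "pedge g = {a, b}" "a \<in> B u" "b \<in> B v" "gadj a b"
      using pedge[OF gr g(1)] by blast
    have "a \<in> H" "b \<in> H" using H_I p by blast+
    moreover have "k \<notin> T.tedges"
    proof
      assume "k \<in> T.tedges"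
      from tree_kind[OF this] show False
      proof
        assume "\<exists>w\<in>V. k \<subseteq> B w"
        then obtain w where w: "w \<in> V" "a \<in> B w" "b \<in> B w" using g(3) p(5) by blast
        then show False using B_disj[OF p(2) w(1) p(6)] B_disj[OF p(3) w(1) p(7)] p(4) by blast
      next
        assume "k \<in> pedge ` treeE"
        then obtain g' where g': "g' \<in> treeE" "pedge g = pedge g'" using g(3) by blast
        then have "g = g'" using pedge_inj[OF gr] treeE_E g(1) unfolding inj_on_def by blast
        then show False using g'(1) g(2) by blast
      qed
    qed
    ultimately show "k \<in> T.cotree" unfolding T.cotree_def using p(5,8) g(3) by blast
  qed
  have cardK: "card E \<le> card K + (card V - 1)"
  proof -
    have "card K = card (E - treeE)" unfolding K_def
      by (rule card_image) (use pedge_inj[OF gr] inj_on_subset in blast)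
    moreover have "card E = card (E - treeE) + card treeE"
      using treeE_E finE by (metis Diff_subset card_Diff_subset card_mono finite_subset le_add_diff_inverse2)
    ultimately show ?thesis using card_treeE by simp
  qed
  show ?thesis
  proof (cases "K = {}")
    case True
    then show ?thesis using cardK by simp
  next
    case False
    define I where "I f = {k\<in>K. T.zone k f \<noteq> 0}" for f
    define size where "size k = card {f. T.zone k f \<noteq> 0}" for k
    define cl where "cl f = (if I f = {} then None else Some (SOME k. k \<in> I f \<and> (\<forall>k'\<in>I f. size k \<le> size k')))" for f
    define S where "S c f = (if cl f = c then 1 else 0 :: bit)" for c f
    define D where "D c = {g\<in>E. cob (S c) (pedge g) \<noteq> 0}" for c
    define C where "C = insert None (Some ` K)"
    have finC: "finite C" unfolding C_def using finK by simp
    have cardC: "card C = card K + 1" unfolding C_def using finK by (simp add: card_image)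
    have clI: "cl f = cl g" if "I f = I g" for f g unfolding cl_def that ..
    have supp0: "e \<in> T.tedges \<union> K" if e: "e \<in> gedge" "cob (S c) e \<noteq> 0" for e c
    proof (rule ccontr)
      assume n: "e \<notin> T.tedges \<union> K"
      have "T.zone k (sq1 e) = T.zone k (sq2 e)" if "k \<in> K" for k
      proof -
        have "k \<in> T.cotree" using K_ked that by blast
        then have "cob (T.zone k) e = 0" using T.zone(3)[of k e] e(1) n that by blast
        then show ?thesis unfolding cob_def by (simp only: bit_add_zero_iff)
      qed
      then have "I (sq1 e) = I (sq2 e)" unfolding I_def by (intro Collect_cong conj_cong refl) simp
      then have "cl (sq1 e) = cl (sq2 e)" by (rule clI)
      then have "cob (S c) e = 0" unfolding cob_def S_def by simp
      then show False using e(2) by blast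
    qed
    have supp: "(\<exists>u\<in>V. e \<subseteq> B u) \<or> e \<in> pedge ` E" if e: "e \<in> gedge" "cob (S c) e \<noteq> 0" for e c
      using supp0[OF e] tree_kind[of e] treeE_E unfolding K_def by blast
    have deg: "\<exists>g'\<in>D c. g' \<noteq> g \<and> w \<in> g'" if g: "g \<in> D c" "w \<in> g" for c g w
    proof (rule ccontr)
      assume n: "\<not> ?thesis"
      have gE: "g \<in> E" "cob (S c) (pedge g) \<noteq> 0" using g(1) unfolding D_def by blast+
      have wV: "w \<in> V" using edge_subset[OF gr gE(1)] g(2) by blast
      have "cob (S c) (pedge h) = 0" if "h \<in> {g\<in>E. w \<in> g} - {g}" for h
        using n that unfolding D_def by blast
      then have "(\<Sum>h\<in>{g\<in>E. w \<in> g} - {g}. cob (S c) (pedge h)) = 0" by (intro sum.neutral) blast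
      moreover have "(\<Sum>h\<in>{g\<in>E. w \<in> g}. cob (S c) (pedge h)) =
          cob (S c) (pedge g) + (\<Sum>h\<in>{g\<in>E. w \<in> g} - {g}. cob (S c) (pedge h))"
        by (rule sum.remove) (use finE gE g(2) in simp_all)
      moreover have "(\<Sum>h\<in>{g\<in>E. w \<in> g}. cob (S c) (pedge h)) = 0"
        by (rule vertex_parity[OF gr wV supp])
      ultimately show False using gE(2) by simp
    qed
    \<comment> \<open>On its inner side, \<open>k\<close> itself is the smallest zone. Any other
      zone containing that square also contains the square across \<open>k\<close>, so by laminarity
      it properly contains the zone of \<open>k\<close>.\<close>
    have clK: "cl f = Some k" if k: "k \<in> K" "k \<in> I f" "k \<notin> I g" and side: "\<And>S. cob S k = S f + S g" for k f g
    proof -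
      have kk: "k \<in> T.cotree" using k(1) K_ked by blast
      have min: "size k < size k'" if k': "k' \<in> I f" "k' \<noteq> k" for k'
      proof -
        have k'K: "k' \<in> T.cotree" using k'(1) K_ked unfolding I_def by blast
        obtain a b where ab: "\<And>f. T.zone k f * T.zone k' f = a * T.zone k f + b * T.zone k' f"
          using T.zone_mult[OF kk k'K] k'(2) by metis
        have f1: "T.zone k f = 1" "T.zone k' f = 1" using k(2) k'(1) unfolding I_def by simp_all
        have g0: "T.zone k g = 0" using k(1,3) unfolding I_def by simp
        have "cob (T.zone k') k = 0" by (rule T.zone_other[OF k'K kk k'(2)])
        then have g1: "T.zone k' g = 1" unfolding side f1 by (simp only: bit_add_zero_iff)
        have b: "b = 0" using ab[of g] g0 g1 by simp
        then have "a = 1" using ab[of f] f1 by simp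
        then have sub: "T.zone k h * T.zone k' h = T.zone k h" for h using ab[of h] b by simp
        have "{h. T.zone k h \<noteq> 0} \<subset> {h. T.zone k' h \<noteq> 0}"
        proof
          show "{h. T.zone k h \<noteq> 0} \<subseteq> {h. T.zone k' h \<noteq> 0}"
          proof
            fix h assume h: "h \<in> {h. T.zone k h \<noteq> 0}"
            have "T.zone k' h \<noteq> 0"
            proof
              assume "T.zone k' h = 0"
              then show False using sub[of h] h by simp
            qed
            then show "h \<in> {h. T.zone k' h \<noteq> 0}" by blast
          qed
          have "g \<in> {h. T.zone k' h \<noteq> 0}" "g \<notin> {h. T.zone k h \<noteq> 0}" using g0 g1 by simp_all
          then show "{h. T.zone k h \<noteq> 0} \<noteq> {h. T.zone k' h \<noteq> 0}" by blast
        qed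
        then show ?thesis unfolding size_def by (rule psubset_card_mono[OF T.zone(1)[OF k'K]])
      qed
      have "(SOME k. k \<in> I f \<and> (\<forall>k'\<in>I f. size k \<le> size k')) = k"
      proof (rule some_equality)
        show "k \<in> I f \<and> (\<forall>k'\<in>I f. size k \<le> size k')" using k(2) min by (metis less_imp_le order_refl)
        fix k' assume k': "k' \<in> I f \<and> (\<forall>j\<in>I f. size k' \<le> size j)"
        show "k' = k"
        proof (rule ccontr)
          assume "k' \<noteq> k"
          then have "size k < size k'" using min k' by blast
          then show False using k' k(2) by fastforce
        qed
      qed
      then show ?thesis unfolding cl_def using k(2) by auto
    qed
    have sides: "\<exists>f g. k \<in> I f \<and> k \<notin> I g \<and> (\<forall>S. cob S k = S f + S g)" if k: "k \<in> K" for k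
    proof -
      have kk: "k \<in> T.cotree" using k K_ked by blast
      obtain f where f: "k \<in> quad f" "T.zone k f = 1" using T.inner_side[OF kk] by blast
      obtain g where g: "\<And>S. cob S k = S f + S g" using other_side[OF f(1)] by blast
      have "T.zone k g = 0" using T.zone(2)[OF kk] f(2) unfolding g by (cases "T.zone k g") auto
      then show ?thesis using f g k unfolding I_def by (intro exI[of _ f] exI[of _ g]) simp
    qed
    have ne: "D c \<noteq> {}" if "c \<in> C" for c
    proof (cases c)
      case (Some k)
      then have k: "k \<in> K" using that unfolding C_def by blast
      obtain f g where fg: "k \<in> I f" "k \<notin> I g" "\<And>S. cob S k = S f + S g" using sides[OF k] by blast
      have 1: "cl f = c" using clK[OF k fg] Some by simp
      have "cl g \<noteq> c"
      proof
        assume cg: "cl g = c"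
        then have "I g \<noteq> {}" using Some unfolding cl_def by (metis option.distinct(1))
        moreover have "finite (I g)" unfolding I_def using finK by simp
        ultimately have "\<exists>j. j \<in> I g \<and> (\<forall>k'\<in>I g. size j \<le> size k')"
          using ex_has_least_nat[of "\<lambda>j. j \<in> I g" _ size] by blast
        from someI_ex[OF this] have "(SOME k. k \<in> I g \<and> (\<forall>k'\<in>I g. size k \<le> size k')) \<in> I g" by blast
        moreover have "cl g = Some (SOME k. k \<in> I g \<and> (\<forall>k'\<in>I g. size k \<le> size k'))"
          unfolding cl_def using \<open>I g \<noteq> {}\<close> by simp
        ultimately show False using cg Some fg(2) by simp
      qed
      then have "cob (S c) k = 1" unfolding fg(3) S_def using 1 by simp
      then show ?thesis using k unfolding D_def K_def by auto
    next
      case None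
      show ?thesis
      proof
        assume empty: "D c = {}"
        have z: "cob (S c) e = 0" if e: "e \<in> gedge" for e
        proof (rule T.tree_acyclic[OF _ bd_cob e])
          fix e assume e: "e \<in> gedge" "cob (S c) e \<noteq> 0"
          have "e \<notin> K"
          proof
            assume "e \<in> K"
            then obtain g where "g \<in> E" "e = pedge g" unfolding K_def by blast
            then show False using e(2) empty unfolding D_def by blast
          qed
          then show "e \<in> T.tedges" using supp0[OF e] by blast
        qed
        \<comment> \<open>The class \<open>None\<close> is infinite, so its complement is used. With
          no graph edge outside the tree on its boundary, this finite set would be empty, yet it
          contains a square inside the zone of each edge of \<open>K\<close>.\<close>
        define S' where "S' f = 1 + S c f" for f
        have "cob S' e = cob (S c) e" for e unfolding cob_def S'_def
          by (cases "S c (sq1 e)"; cases "S c (sq2 e)") auto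
        then have z': "cob S' e = 0" if "e \<in> gedge" for e using z[OF that] by simp
        have S'1: "S' f \<noteq> 0 \<longleftrightarrow> I f \<noteq> {}" for f unfolding S'_def S_def None cl_def by simp
        have "{f. S' f \<noteq> 0} \<subseteq> (\<Union>k\<in>K. {f. T.zone k f \<noteq> 0})" unfolding S'1 I_def by blast
        moreover have "finite (\<Union>k\<in>K. {f. T.zone k f \<noteq> 0})" using finK T.zone(1) K_ked by blast
        ultimately have "finite {f. S' f \<noteq> 0}" by (rule finite_subset)
        from cob_zero[OF this z'] have "S' f = 0" for f .
        then have "I f = {}" for f using S'1 by blast
        moreover obtain k where "k \<in> K" using \<open>K \<noteq> {}\<close> by blast
        ultimately show False using sides[of k] by blast
      qed
    qed
    have four: "4 \<le> card (D c)" if "c \<in> C" for c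
      by (rule min_degree_two_card_ge_4[OF gr tf _ _ ne[OF that] deg]) (use finE in \<open>auto simp: D_def\<close>)
    have "4 * card C = (\<Sum>c\<in>C. 4)" by simp
    also have "\<dots> \<le> (\<Sum>c\<in>C. card (D c))" by (rule sum_mono) (rule four)
    also have "\<dots> = (\<Sum>c\<in>C. \<Sum>g\<in>E. if g \<in> D c then 1 else 0)"
    proof (rule sum.cong[OF refl])
      fix c
      have "D c = E \<inter> D c" unfolding D_def by blast
      then show "card (D c) = (\<Sum>g\<in>E. if g \<in> D c then 1 else 0)"
        using finE by (simp add: sum.If_cases)
    qed
    also have "\<dots> = (\<Sum>g\<in>E. \<Sum>c\<in>C. if g \<in> D c then 1 else 0)" by (rule sum.swap)
    also have "\<dots> \<le> (\<Sum>g\<in>E. 2)"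
    proof (rule sum_mono)
      fix g assume "g \<in> E"
      have "c \<in> {cl (sq1 (pedge g)), cl (sq2 (pedge g))}" if "g \<in> D c" for c
        using that unfolding D_def cob_def S_def by (auto split: if_splits)
      then have "C \<inter> {c. g \<in> D c} \<subseteq> {cl (sq1 (pedge g)), cl (sq2 (pedge g))}" by blast
      then have "card (C \<inter> {c. g \<in> D c}) \<le> card {cl (sq1 (pedge g)), cl (sq2 (pedge g))}" by (intro card_mono) simp_all
      also have "\<dots> \<le> 2" by (simp add: card_insert_if)
      finally show "(\<Sum>c\<in>C. if g \<in> D c then 1 else 0) \<le> (2::nat)" using finC by (simp add: sum.If_cases)
    qed
    \<comment> \<open>Together with \<open>cardK\<close> this is Euler's bound: twice the number of
      edges is at most \<open>4 * card V - 8\<close>.\<close>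
    finally have "4 * (card K + 1) \<le> 2 * card E" unfolding cardC by simp
    then show ?thesis using cardK by simp
  qed
qed

end

section \<open>From planar drawings to grid minors\<close>

definition cell :: "real \<Rightarrow> pixel \<Rightarrow> complex set" where
  "cell \<delta> p = {z. of_int (fst p) * \<delta> \<le> Re z \<and> Re z \<le> (of_int (fst p) + 1) * \<delta> \<and>
     of_int (snd p) * \<delta> \<le> Im z \<and> Im z \<le> (of_int (snd p) + 1) * \<delta>}"

definition cover :: "real \<Rightarrow> complex set \<Rightarrow> pixel set" where
  "cover \<delta> A = {p. cell \<delta> p \<inter> A \<noteq> {}}"

lemma closed_cell: "closed (cell \<delta> p)"
  unfolding cell_def by (intro closed_Collect_conj closed_Collect_le continuous_intros)

lemma cell_diam:
  assumes "z \<in> cell \<delta> p" "w \<in> cell \<delta> p"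
  shows "dist z w \<le> 2 * \<delta>"
proof -
  have "dist z w \<le> \<bar>Re (z - w)\<bar> + \<bar>Im (z - w)\<bar>" unfolding dist_norm by (rule cmod_le)
  also have "\<dots> \<le> \<delta> + \<delta>" using assms unfolding cell_def by (intro add_mono) (auto simp: algebra_simps)
  finally show ?thesis by simp
qed

lemma cell_exists:
  assumes "\<delta> > 0"
  shows "z \<in> cell \<delta> (\<lfloor>Re z / \<delta>\<rfloor>, \<lfloor>Im z / \<delta>\<rfloor>)"
proof -
  have "of_int \<lfloor>x / \<delta>\<rfloor> * \<delta> \<le> x \<and> x \<le> (of_int \<lfloor>x / \<delta>\<rfloor> + 1) * \<delta>" for x
  proof
    have "of_int \<lfloor>x / \<delta>\<rfloor> * \<delta> \<le> (x / \<delta>) * \<delta>" using assms by (intro mult_right_mono) auto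
    then show "of_int \<lfloor>x / \<delta>\<rfloor> * \<delta> \<le> x" using assms by simp
    have "(x / \<delta>) * \<delta> \<le> (of_int \<lfloor>x / \<delta>\<rfloor> + 1) * \<delta>" using assms
      by (intro mult_right_mono) (auto intro: less_imp_le floor_correct[THEN conjunct2])
    then show "x \<le> (of_int \<lfloor>x / \<delta>\<rfloor> + 1) * \<delta>" using assms by simp
  qed
  then show ?thesis unfolding cell_def by simp
qed

lemma cover_nonempty: "\<delta> > 0 \<Longrightarrow> A \<noteq> {} \<Longrightarrow> cover \<delta> A \<noteq> {}"
  unfolding cover_def using cell_exists by blast

lemma finite_cover:
  assumes "\<delta> > 0" "bounded A"
  shows "finite (cover \<delta> A)"
proof -
  obtain R where R: "\<And>z. z \<in> A \<Longrightarrow> cmod z \<le> R" using assms(2) unfolding bounded_iff by blast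
  define c where "c = \<lceil>R / \<delta> + 1\<rceil>"
  have bound: "\<bar>i\<bar> \<le> c" if "of_int i * \<delta> \<le> x" "x \<le> (of_int i + 1) * \<delta>" "\<bar>x\<bar> \<le> R" for i x
  proof -
    have "of_int i * \<delta> \<le> R" "- R \<le> (of_int i + 1) * \<delta>" using that by linarith+
    then have "of_int i \<le> R / \<delta>" "- (R / \<delta>) \<le> of_int i + 1"
      using assms(1) by (simp_all add: field_simps)
    then have "\<bar>of_int i\<bar> \<le> R / \<delta> + 1" by linarith
    then have "of_int \<bar>i\<bar> \<le> R / \<delta> + 1" by simp
    then have "of_int \<bar>i\<bar> \<le> (of_int c :: real)" unfolding c_def using le_of_int_ceiling order_trans by blast
    then show ?thesis by linarith
  qed
  have "cover \<delta> A \<subseteq> {-c..c} \<times> {-c..c}"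
  proof
    fix p assume "p \<in> cover \<delta> A"
    then obtain z where z: "z \<in> cell \<delta> p" "z \<in> A" unfolding cover_def by blast
    have "\<bar>Re z\<bar> \<le> R" "\<bar>Im z\<bar> \<le> R"
      using R[OF z(2)] abs_Re_le_cmod[of z] abs_Im_le_cmod[of z] by linarith+
    then have "\<bar>fst p\<bar> \<le> c" "\<bar>snd p\<bar> \<le> c" using z(1) bound unfolding cell_def by blast+
    then show "p \<in> {-c..c} \<times> {-c..c}" by (cases p) auto
  qed
  then show ?thesis by (rule finite_subset) simp
qed

text \<open>Finitely many closed cells cover the connected set \<open>A\<close>, so cells on the two
  sides of a cut share a point of \<open>A\<close>. They may touch in a corner only, but the cell
  \<open>m\<close> in the column of \<open>p\<close> and the row of \<open>q\<close> contains this
  point as well and supplies a grid edge across the cut.\<close>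

lemma cover_linked:
  assumes \<delta>: "\<delta> > 0" and A: "bounded A" "connected A"
  shows "linked gadj (cover \<delta> A)"
  unfolding linked_def
proof (intro allI impI)
  fix X assume X: "X \<subseteq> cover \<delta> A" "X \<noteq> {}" "X \<noteq> cover \<delta> A"
  let ?Y = "cover \<delta> A - X"
  have fin: "finite X" "finite ?Y" using finite_cover[OF \<delta> A(1)] X(1) finite_subset by auto
  let ?U = "\<Union>p\<in>X. cell \<delta> p" and ?W = "\<Union>p\<in>?Y. cell \<delta> p"
  have "closed ?U" "closed ?W" using fin closed_cell by (intro closed_UN; simp)+
  moreover have "A \<subseteq> ?U \<union> ?W"
  proof
    fix z assume z: "z \<in> A"
    obtain p where "z \<in> cell \<delta> p" using cell_exists[OF \<delta>] by blast
    moreover from this z have "p \<in> cover \<delta> A" unfolding cover_def by blast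
    ultimately show "z \<in> ?U \<union> ?W" by blast
  qed
  moreover have hit: "(\<Union>p\<in>S. cell \<delta> p) \<inter> A \<noteq> {}" if S: "S \<subseteq> cover \<delta> A" "S \<noteq> {}" for S
  proof -
    obtain p where p: "p \<in> S" using S(2) by blast
    then have "cell \<delta> p \<inter> A \<noteq> {}" using S(1) unfolding cover_def by blast
    then show ?thesis using p by blast
  qed
  have "?U \<inter> A \<noteq> {}" using hit[OF X(1,2)] .
  moreover have "?Y \<noteq> {}" using X(1,3) by blast
  then have "?W \<inter> A \<noteq> {}" by (intro hit) simp_all
  ultimately have "\<not> ?U \<inter> ?W \<inter> A = {}"
    using A(2)[unfolded connected_closed, simplified, rule_format, of ?U ?W] by blast
  then obtain z p q where z: "z \<in> A" "p \<in> X" "q \<in> ?Y" "z \<in> cell \<delta> p" "z \<in> cell \<delta> q" by blast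
  define m where "m = (fst p, snd q)"
  have "z \<in> cell \<delta> m" using z(4,5) unfolding cell_def m_def by simp
  then have mc: "m \<in> cover \<delta> A" using z(1) unfolding cover_def by blast
  have close: "\<bar>i - j\<bar> \<le> 1" if "of_int i * \<delta> \<le> x" "x \<le> (of_int i + 1) * \<delta>" "of_int j * \<delta> \<le> x" "x \<le> (of_int j + 1) * \<delta>" for i j x
  proof -
    have "of_int i * \<delta> \<le> (of_int j + 1) * \<delta>" "of_int j * \<delta> \<le> (of_int i + 1) * \<delta>" using that by linarith+
    then have "(of_int i :: real) \<le> of_int j + 1" "(of_int j :: real) \<le> of_int i + 1" using \<delta> by simp_all
    then show ?thesis by linarith
  qed
  have d: "\<bar>fst p - fst q\<bar> \<le> 1" "\<bar>snd p - snd q\<bar> \<le> 1"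
    using z(4,5) close unfolding cell_def by blast+
  show "\<exists>a\<in>X. \<exists>b\<in>?Y. gadj a b"
  proof (cases "m \<in> X")
    case True
    then have "m \<noteq> q" using z(3) by blast
    then have "fst p \<noteq> fst q" unfolding m_def by (metis prod.collapse)
    then have "gadj m q" using d(1) unfolding m_def gadj_def nb_def by (cases q) auto
    then show ?thesis using True z(3) by blast
  next
    case False
    then have "m \<noteq> p" using z(2) by blast
    then have "snd p \<noteq> snd q" unfolding m_def by (metis prod.collapse)
    then have "gadj p m" using d(2) unfolding m_def gadj_def nb_def by (cases p) auto
    then show ?thesis using False mc z(2) by blast
  qed
qed

text \<open>Disjoint compact sets have positive distance, and the diameter of a cell tends to
  0.\<close>

lemma covers_disjoint:
  assumes "compact A" "compact B" "A \<inter> B = {}"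
  shows "\<forall>\<^sub>F \<delta> in at_right 0. cover \<delta> A \<inter> cover \<delta> B = {}"
proof -
  obtain d where d: "d > 0" "\<And>x y. x \<in> A \<Longrightarrow> y \<in> B \<Longrightarrow> d \<le> dist x y"
    using separate_compact_closed[OF assms(1) compact_imp_closed[OF assms(2)] assms(3)] by blast
  have "cover \<delta> A \<inter> cover \<delta> B = {}" if "0 < \<delta>" "\<delta> < d / 2" for \<delta>
  proof (rule ccontr)
    assume "cover \<delta> A \<inter> cover \<delta> B \<noteq> {}"
    then obtain p x y where "x \<in> cell \<delta> p" "x \<in> A" "y \<in> cell \<delta> p" "y \<in> B" unfolding cover_def by blast
    then show False using cell_diam[of x \<delta> p y] d(2)[of x y] that by simp
  qed
  then show ?thesis unfolding eventually_at_right_field using d(1) by (intro exI[of _ "d / 2"]) auto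
qed

section \<open>From overlapping covers to disjoint branch sets\<close>

lemma linked_Un:
  assumes "linked adj A" "linked adj B" "A \<inter> B \<noteq> {}"
  shows "linked adj (A \<union> B)"
  unfolding linked_def
proof (intro allI impI)
  fix X assume X: "X \<subseteq> A \<union> B" "X \<noteq> {}" "X \<noteq> A \<union> B"
  consider "X \<inter> A \<noteq> {}" "\<not> A \<subseteq> X" | "X \<inter> B \<noteq> {}" "\<not> B \<subseteq> X"
    using X assms(3) by blast
  then show "\<exists>a\<in>X. \<exists>b\<in>A \<union> B - X. adj a b"
  proof cases
    case 1 then show ?thesis using linkedD[OF assms(1) 1] by blast
  next
    case 2 then show ?thesis using linkedD[OF assms(2) 2] by blast
  qed
qed

lemma linked_pair:
  assumes "adj a b" "adj b a"
  shows "linked adj {a, b}"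
  unfolding linked_def
proof (intro allI impI)
  fix X assume "X \<subseteq> {a, b}" "X \<noteq> {}" "X \<noteq> {a, b}"
  then have "X = {a} \<and> b \<notin> X \<or> X = {b} \<and> a \<notin> X" by blast
  then show "\<exists>x\<in>X. \<exists>y\<in>{a, b} - X. adj x y" using assms by blast
qed

lemma linked_insert:
  assumes "linked adj A" "a \<in> A" "adj a b" "adj b a"
  shows "linked adj (insert b A)"
proof -
  have "linked adj (A \<union> {a, b})" using linked_Un[OF assms(1) linked_pair[of adj a b]] assms by blast
  moreover have "A \<union> {a, b} = insert b A" using assms(2) by blast
  ultimately show ?thesis by simp
qed

text \<open>The cover of an edge overlaps those of its ends in an uncontrolled way, so its cells are
  distributed by maximality: of all disjoint connected families between \<open>PV\<close> and
  \<open>star\<close>, one of largest total size is taken. If the branch sets of the ends of an edge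
  were not adjacent, a cell of that edge next to \<open>B u\<close> could still be added to
  \<open>B u\<close>.\<close>

lemma model_from_covers:
  assumes gr: "simple_graph V E"
    and PV: "\<And>v. v \<in> V \<Longrightarrow> finite (PV v) \<and> PV v \<noteq> {} \<and> linked gadj (PV v)"
    and PE: "\<And>e. e \<in> E \<Longrightarrow> finite (PE e) \<and> linked gadj (PE e)"
    and dVV: "\<And>u v. u \<in> V \<Longrightarrow> v \<in> V \<Longrightarrow> u \<noteq> v \<Longrightarrow> PV u \<inter> PV v = {}"
    and dEV: "\<And>e w. e \<in> E \<Longrightarrow> w \<in> V \<Longrightarrow> w \<notin> e \<Longrightarrow> PE e \<inter> PV w = {}"
    and dEE: "\<And>e e'. e \<in> E \<Longrightarrow> e' \<in> E \<Longrightarrow> e \<noteq> e' \<Longrightarrow> PE e \<inter> PE e' = {}"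
    and inc: "\<And>e u. e \<in> E \<Longrightarrow> u \<in> e \<Longrightarrow> PE e \<inter> PV u \<noteq> {}"
  shows "\<exists>B. minor_model gadj V E B"
proof -
  have finV: "finite V" using gr unfolding simple_graph_def by blast
  note finE = finite_edges[OF gr]
  define star where "star v = PV v \<union> (\<Union>e\<in>{e\<in>E. v \<in> e}. PE e)" for v
  have fin_star: "finite (star v)" if "v \<in> V" for v
  proof -
    have "finite (\<Union>e\<in>{e\<in>E. v \<in> e}. PE e)" using PE finE by (intro finite_UN_I) simp_all
    then show ?thesis unfolding star_def using PV[OF that] by simp
  qed
  define P where "P B \<longleftrightarrow> (\<forall>v\<in>V. PV v \<subseteq> B v \<and> B v \<subseteq> star v \<and> linked gadj (B v)) \<and>
    (\<forall>u\<in>V. \<forall>v\<in>V. u \<noteq> v \<longrightarrow> B u \<inter> B v = {})" for B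
  define tot where "tot B = (\<Sum>v\<in>V. card (B v))" for B :: "'a \<Rightarrow> pixel set"
  have P0: "P PV" unfolding P_def
  proof (intro conjI ballI impI)
    fix v assume "v \<in> V"
    then show "linked gadj (PV v)" using PV by simp
  next
    fix u v assume "u \<in> V" "v \<in> V" "u \<noteq> v"
    then show "PV u \<inter> PV v = {}" by (rule dVV)
  qed (simp_all add: star_def)
  have P_star: "B v \<subseteq> star v" if "P B" "v \<in> V" for B v
    using that unfolding P_def by (elim conjE) (drule (1) bspec, elim conjE)
  have bound: "tot B < Suc (\<Sum>v\<in>V. card (star v))" if "P B" for B
  proof -
    have "card (B v) \<le> card (star v)" if "v \<in> V" for v
      by (rule card_mono[OF fin_star[OF that] P_star[OF \<open>P B\<close> that]])
    then have "tot B \<le> (\<Sum>v\<in>V. card (star v))" unfolding tot_def by (rule sum_mono)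
    then show ?thesis by simp
  qed
  then have "\<forall>B. P B \<longrightarrow> tot B < Suc (\<Sum>v\<in>V. card (star v))" by blast
  from ex_has_greatest_nat[of P PV tot, OF P0 this]
  obtain B where B: "P B" and max: "\<And>B'. P B' \<Longrightarrow> tot B' \<le> tot B" by (elim exE conjE) metis
  have Bv: "PV v \<subseteq> B v" "B v \<subseteq> star v" "linked gadj (B v)" "finite (B v)" if "v \<in> V" for v
  proof -
    show "PV v \<subseteq> B v" "linked gadj (B v)" using B that unfolding P_def by simp_all
    show "B v \<subseteq> star v" by (rule P_star[OF B that])
    then show "finite (B v)" using fin_star[OF that] finite_subset by blast
  qed
  have Bd: "B u \<inter> B v = {}" if "u \<in> V" "v \<in> V" "u \<noteq> v" for u v
    using B that unfolding P_def by blast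
  have adj: "\<exists>a\<in>B u. \<exists>b\<in>B v. gadj a b" if uv: "u \<in> V" "v \<in> V" "u \<noteq> v" "{u, v} \<in> E" for u v
  proof (rule ccontr)
    assume no: "\<not> ?thesis"
    let ?e = "{u, v}"
    let ?W = "PV u \<union> PE ?e \<union> PV v"
    have i: "PE ?e \<inter> PV u \<noteq> {}" "PE ?e \<inter> PV v \<noteq> {}" using inc[OF uv(4)] by blast+
    have "linked gadj (PV u \<union> PE ?e)" by (rule linked_Un) (use PV[OF uv(1)] PE[OF uv(4)] i in blast)+
    then have W: "linked gadj ?W" by (rule linked_Un) (use PV[OF uv(2)] i in blast)+
    have "B u \<inter> ?W \<noteq> {}" using Bv(1)[OF uv(1)] PV[OF uv(1)] by blast
    moreover have "\<not> ?W \<subseteq> B u" using Bd[OF uv(1-3)] Bv(1)[OF uv(2)] PV[OF uv(2)] by blast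
    ultimately obtain a b where ab: "a \<in> B u" "b \<in> ?W" "b \<notin> B u" "gadj a b" using linkedD[OF W, of "B u"] by blast
    have bv: "b \<notin> B v" using no ab(1,4) by blast
    then have be: "b \<in> PE ?e" using ab(2,3) Bv(1)[OF uv(1)] Bv(1)[OF uv(2)] by blast
    \<comment> \<open>Cells of \<open>PE ?e\<close> occur only in the stars of \<open>u\<close> and
      \<open>v\<close>, so no third branch set can have claimed \<open>b\<close>.\<close>
    have fresh: "b \<notin> B w" if w: "w \<in> V" "w \<noteq> u" for w
    proof
      assume bw: "b \<in> B w"
      have "w \<noteq> v" using bw bv by blast
      then have we: "w \<notin> ?e" using w(2) by blast
      have "b \<in> star w" using bw Bv(2)[OF w(1)] by blast
      then show False unfolding star_def using dEV[OF uv(4) w(1) we] dEE[OF uv(4)] be we by blast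
    qed
    define B' where "B' = B(u := insert b (B u))"
    have "P B'" unfolding P_def
    proof (intro conjI ballI impI)
      fix w assume w: "w \<in> V"
      show "PV w \<subseteq> B' w" using Bv(1)[OF w] unfolding B'_def by auto
      show "B' w \<subseteq> star w" using Bv(2)[OF w] be uv(4) unfolding B'_def star_def by auto
      show "linked gadj (B' w)"
        using Bv(3)[OF w] linked_insert[OF Bv(3)[OF uv(1)] ab(1,4)] ab(4) gadj_sym unfolding B'_def by auto
    next
      fix w w' assume w: "w \<in> V" "w' \<in> V" "w \<noteq> w'"
      show "B' w \<inter> B' w' = {}" using Bd[OF w] fresh w unfolding B'_def by auto
    qed
    then have "tot B' \<le> tot B" by (rule max)
    moreover have "tot B < tot B'" unfolding tot_def
    proof (rule sum_strict_mono_ex1[OF finV])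
      show "\<forall>x\<in>V. card (B x) \<le> card (B' x)" unfolding B'_def using Bv(4)[OF uv(1)] by (simp add: card_insert_le)
      show "\<exists>a\<in>V. card (B a) < card (B' a)" unfolding B'_def using Bv(4)[OF uv(1)] ab(3) uv(1)
        by (intro bexI[of _ u]) simp_all
    qed
    ultimately show False by simp
  qed
  have "B v \<noteq> {}" if "v \<in> V" for v using Bv(1)[OF that] PV[OF that] by blast
  then have "minor_model gadj V E B"
    unfolding minor_model_def by (intro conjI ballI impI) (simp_all add: Bv(3,4) Bd adj)
  then show ?thesis by blast
qed

theorem planar_minor_model:
  assumes gr: "simple_graph V E" and pl: "planar V E"
  shows "\<exists>B. minor_model gadj V E B"
proof -
  obtain pos :: "'a \<Rightarrow> complex" and \<gamma> :: "'a set \<Rightarrow> real \<Rightarrow> complex" where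
    inj: "inj_on pos V" and arcs: "\<forall>e\<in>E. arc (\<gamma> e) \<and> {pathstart (\<gamma> e), pathfinish (\<gamma> e)} = pos ` e"
    and thru: "\<forall>e\<in>E. \<forall>v\<in>V. pos v \<in> path_image (\<gamma> e) \<longrightarrow> v \<in> e"
    and cross: "\<forall>e\<in>E. \<forall>e'\<in>E. e \<noteq> e' \<longrightarrow> path_image (\<gamma> e) \<inter> path_image (\<gamma> e') \<subseteq> pos ` (e \<inter> e')"
    using pl unfolding planar_def by (elim exE conjE)
  have finV: "finite V" using gr unfolding simple_graph_def by blast
  note sub = edge_subset[OF gr]
  note finE = finite_edges[OF gr]
  have cont: "continuous_on {0..1} (\<gamma> e)" and ginj: "inj_on (\<gamma> e) {0..1}"
    and ends: "{\<gamma> e 0, \<gamma> e 1} = pos ` e" if "e \<in> E" for e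
    using arcs that unfolding arc_def path_def pathstart_def pathfinish_def by simp_all
  have img: "\<gamma> e ` {a..b} \<subseteq> path_image (\<gamma> e)" if "0 \<le> a" "b \<le> 1" for e a b
    unfolding path_image_def using that by (intro image_mono) simp
  have seg: "compact (\<gamma> e ` {a..b})" "connected (\<gamma> e ` {a..b})" if "e \<in> E" "0 \<le> a" "b \<le> 1" for e a b
  proof -
    have "continuous_on {a..b} (\<gamma> e)" by (rule continuous_on_subset[OF cont[OF that(1)]]) (use that in simp)
    then show "compact (\<gamma> e ` {a..b})" "connected (\<gamma> e ` {a..b})"
      by (intro compact_continuous_image connected_continuous_image; simp)+
  qed
  have geq: "s = t" if "e \<in> E" "\<gamma> e s = \<gamma> e t" "0 \<le> s" "s \<le> 1" "0 \<le> t" "t \<le> 1" for e s t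
    using ginj[OF that(1)] that(2-) unfolding inj_on_def by simp
  have onv: "pos w = \<gamma> e 0 \<or> pos w = \<gamma> e 1" if "e \<in> E" "w \<in> V" "pos w \<in> path_image (\<gamma> e)" for e w
  proof -
    have "w \<in> e" using thru that by blast
    then have "pos w \<in> {\<gamma> e 0, \<gamma> e 1}" using ends[OF that(1)] by blast
    then show ?thesis by simp
  qed
  \<comment> \<open>Arcs share end points, so they are cut into thirds. The end thirds join the
    vertices, giving the stars \<open>K v\<close>, and the middle third remains with the edge. These
    compact sets meet only if an edge and one of its ends are involved, and a fine enough grid
    preserves this.\<close>
  define near where "near e v = (if \<gamma> e 0 = pos v then \<gamma> e ` {0..1/3} else \<gamma> e ` {2/3..1})" for e v
  define mid where "mid e = \<gamma> e ` {1/3..2/3}" for e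
  have near_img: "near e v \<subseteq> path_image (\<gamma> e)" for e v
    unfolding near_def using img[of 0 "1/3" e] img[of "2/3" 1 e] by simp
  have mid_img: "mid e \<subseteq> path_image (\<gamma> e)" for e unfolding mid_def using img[of "1/3" "2/3" e] by simp
  have near_top: "compact (near e v)" "connected (near e v)" if "e \<in> E" for e v
    unfolding near_def using seg[OF that, of 0 "1/3"] seg[OF that, of "2/3" 1] by simp_all
  have mid_top: "compact (mid e)" "connected (mid e)" if "e \<in> E" for e
    unfolding mid_def using seg[OF that, of "1/3" "2/3"] by simp_all
  have endv: "\<gamma> e 0 = pos v \<or> \<gamma> e 1 = pos v" if "e \<in> E" "v \<in> e" for e v
  proof -
    have "pos v \<in> {\<gamma> e 0, \<gamma> e 1}" using ends[OF that(1)] that(2) by simp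
    then show ?thesis by auto
  qed
  have near_self: "pos v \<in> near e v" if "e \<in> E" "v \<in> e" for e v
  proof (cases "\<gamma> e 0 = pos v")
    case True
    have "\<gamma> e 0 \<in> \<gamma> e ` {0..1/3}" by (rule imageI) simp
    then have "pos v \<in> \<gamma> e ` {0..1/3}" unfolding True .
    then show ?thesis using True unfolding near_def by simp
  next
    case False
    then have g: "\<gamma> e 1 = pos v" using endv[OF that] by simp
    have "\<gamma> e 1 \<in> \<gamma> e ` {2/3..1}" by (rule imageI) simp
    then have "pos v \<in> \<gamma> e ` {2/3..1}" unfolding g .
    then show ?thesis using False unfolding near_def by simp
  qed
  have near_only: "w = v" if e: "e \<in> E" "v \<in> e" and w: "w \<in> V" "pos w \<in> near e v" for e v w
  proof -
    have vV: "v \<in> V" using sub[OF e(1)] e(2) by blast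
    have pw: "pos w = \<gamma> e 0 \<or> pos w = \<gamma> e 1" using onv[OF e(1) w(1)] w(2) near_img by blast
    have "pos w = pos v"
    proof (cases "\<gamma> e 0 = pos v")
      case True
      then obtain t where t: "pos w = \<gamma> e t" "0 \<le> t" "t \<le> 1/3" using w(2) unfolding near_def by auto
      have "pos w \<noteq> \<gamma> e 1"
      proof
        assume "pos w = \<gamma> e 1"
        then have "t = 1" using geq[OF e(1), of t 1] t by simp
        then show False using t by simp
      qed
      then show ?thesis using pw True by simp
    next
      case False
      then obtain t where t: "pos w = \<gamma> e t" "2/3 \<le> t" "t \<le> 1" using w(2) unfolding near_def by auto
      have "pos w \<noteq> \<gamma> e 0"
      proof
        assume "pos w = \<gamma> e 0"
        then have "t = 0" using geq[OF e(1), of t 0] t by simp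
        then show False using t by simp
      qed
      then show ?thesis using pw False endv[OF e] by simp
    qed
    then show ?thesis using inj w(1) vV unfolding inj_on_def by blast
  qed
  have mid_no: "pos w \<notin> mid e" if e: "e \<in> E" and w: "w \<in> V" for e w
  proof
    assume m: "pos w \<in> mid e"
    then obtain t where t: "pos w = \<gamma> e t" "1/3 \<le> t" "t \<le> 2/3" unfolding mid_def by auto
    have "pos w = \<gamma> e 0 \<or> pos w = \<gamma> e 1" using onv[OF e w] m mid_img by blast
    then show False using geq[OF e, of t 0] geq[OF e, of t 1] t by auto
  qed
  have near_disj: "near e u \<inter> near e' v = {}" if e: "e \<in> E" "u \<in> e" "e' \<in> E" "v \<in> e'" "u \<noteq> v" for e e' u v
  proof (cases "e = e'")
    case False
    show ?thesis
    proof (rule ccontr)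
      assume "near e u \<inter> near e' v \<noteq> {}"
      then obtain z where z: "z \<in> near e u" "z \<in> near e' v" by blast
      then have "z \<in> path_image (\<gamma> e) \<inter> path_image (\<gamma> e')" using near_img by blast
      then have "z \<in> pos ` (e \<inter> e')" using cross e(1,3) False by blast
      then obtain w where w: "w \<in> e" "z = pos w" by blast
      have wV: "w \<in> V" using sub[OF e(1)] w(1) by blast
      have "w = u" "w = v" using near_only[OF e(1,2) wV] near_only[OF e(3,4) wV] z w(2) by simp_all
      then show False using e(5) by simp
    qed
  next
    case True
    have uv: "u \<in> V" "v \<in> V" using sub[OF e(1)] sub[OF e(3)] e(2,4) by blast+
    then have neq: "pos u \<noteq> pos v" using inj e(5) unfolding inj_on_def by blast
    have "(\<gamma> e 0 = pos u) \<noteq> (\<gamma> e 0 = pos v)"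
      using endv[OF e(1,2)] endv[OF e(3,4)] neq True by metis
    moreover have "\<gamma> e ` {0..1/3} \<inter> \<gamma> e ` {2/3..1} = {}"
    proof (rule ccontr)
      assume "\<gamma> e ` {0..1/3} \<inter> \<gamma> e ` {2/3..1} \<noteq> {}"
      then obtain s t where st: "0 \<le> s" "s \<le> 1/3" "2/3 \<le> t" "t \<le> 1" "\<gamma> e s = \<gamma> e t" by auto
      then show False using geq[OF e(1), of s t] by simp
    qed
    ultimately show ?thesis unfolding near_def True[symmetric] by auto
  qed
  define K where "K v = \<Union>(insert {pos v} ((\<lambda>e. near e v) ` {e\<in>E. v \<in> e}))" for v
  have K_compact: "compact (K v)" for v
    unfolding K_def using finE near_top(1) by (intro compact_Union) auto
  have K_connected: "connected (K v)" for v
    unfolding K_def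
  proof (rule connected_Union)
    show "\<Inter>(insert {pos v} ((\<lambda>e. near e v) ` {e\<in>E. v \<in> e})) \<noteq> {}" using near_self by blast
  qed (use near_top(2) in auto)
  have K_cases: "z = pos v \<or> (\<exists>e\<in>E. v \<in> e \<and> z \<in> near e v)" if "z \<in> K v" for z v
    using that unfolding K_def by blast
  have K_pos: "pos v \<in> K v" for v unfolding K_def by simp
  have pos_near: "pos u \<notin> near e v" if "u \<in> V" "e \<in> E" "v \<in> e" "u \<noteq> v" for u e v
    using near_only[OF that(2,3,1)] that(4) by blast
  have K_disj: "K u \<inter> K v = {}" if uv: "u \<in> V" "v \<in> V" "u \<noteq> v" for u v
  proof (rule ccontr)
    assume "K u \<inter> K v \<noteq> {}"
    then obtain z where z: "z \<in> K u" "z \<in> K v" by blast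
    have neq: "pos u \<noteq> pos v" using inj uv unfolding inj_on_def by blast
    from K_cases[OF z(1)] K_cases[OF z(2)] show False
    proof (elim disjE bexE conjE)
      assume "z = pos u" "z = pos v" then show False using neq by simp
    next
      fix e assume "z = pos u" "e \<in> E" "v \<in> e" "z \<in> near e v"
      then show False using pos_near[of u e v] uv by simp
    next
      fix e assume "z = pos v" "e \<in> E" "u \<in> e" "z \<in> near e u"
      then show False using pos_near[of v e u] uv by simp
    next
      fix e e' assume "e \<in> E" "u \<in> e" "z \<in> near e u" "e' \<in> E" "v \<in> e'" "z \<in> near e' v"
      then show False using near_disj[of e u e' v] uv(3) by blast
    qed
  qed
  have mid_cross: "mid e \<inter> path_image (\<gamma> e') = {}" if "e \<in> E" "e' \<in> E" "e \<noteq> e'" for e e'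
  proof (rule ccontr)
    assume "mid e \<inter> path_image (\<gamma> e') \<noteq> {}"
    then obtain z where z: "z \<in> mid e" "z \<in> path_image (\<gamma> e')" by blast
    then have "z \<in> pos ` (e \<inter> e')" using cross that mid_img by blast
    then obtain w where "w \<in> e" "z = pos w" by blast
    then show False using mid_no[OF that(1), of w] sub[OF that(1)] z(1) by blast
  qed
  have mid_K: "mid e \<inter> K w = {}" if "e \<in> E" "w \<in> V" "w \<notin> e" for e w
  proof (rule ccontr)
    assume "mid e \<inter> K w \<noteq> {}"
    then obtain z where z: "z \<in> mid e" "z \<in> K w" by blast
    from K_cases[OF z(2)] show False
    proof (elim disjE bexE conjE)
      assume "z = pos w" then show False using mid_no[OF that(1,2)] z(1) by simp
    next
      fix e' assume "e' \<in> E" "w \<in> e'" "z \<in> near e' w"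
      then show False using mid_cross[OF that(1), of e'] that(3) z(1) near_img by blast
    qed
  qed
  have mid_mid: "mid e \<inter> mid e' = {}" if "e \<in> E" "e' \<in> E" "e \<noteq> e'" for e e'
    using mid_cross[OF that] mid_img by blast
  have mid_inc: "mid e \<inter> K u \<noteq> {}" if "e \<in> E" "u \<in> e" for e u
  proof -
    have "near e u \<subseteq> K u" unfolding K_def using that by blast
    moreover have "mid e \<inter> near e u \<noteq> {}"
    proof (cases "\<gamma> e 0 = pos u")
      case True
      have "\<gamma> e (1/3) \<in> \<gamma> e ` {0..1/3}" by (rule imageI) simp
      then have "\<gamma> e (1/3) \<in> near e u" using True unfolding near_def by simp
      moreover have "\<gamma> e (1/3) \<in> mid e" unfolding mid_def by (rule imageI) simp
      ultimately show ?thesis by blast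
    next
      case False
      have "\<gamma> e (2/3) \<in> \<gamma> e ` {2/3..1}" by (rule imageI) simp
      then have "\<gamma> e (2/3) \<in> near e u" using False unfolding near_def by simp
      moreover have "\<gamma> e (2/3) \<in> mid e" unfolding mid_def by (rule imageI) simp
      ultimately show ?thesis by blast
    qed
    ultimately show ?thesis by blast
  qed
  have ev1: "\<forall>\<^sub>F \<delta> in at_right 0. \<forall>u\<in>V. \<forall>v\<in>V. u \<noteq> v \<longrightarrow> cover \<delta> (K u) \<inter> cover \<delta> (K v) = {}"
  proof (intro eventually_ball_finite[OF finV] ballI)
    fix u v assume "u \<in> V" "v \<in> V"
    then show "\<forall>\<^sub>F \<delta> in at_right 0. u \<noteq> v \<longrightarrow> cover \<delta> (K u) \<inter> cover \<delta> (K v) = {}"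
      using covers_disjoint[OF K_compact K_compact K_disj] by (cases "u = v") simp_all
  qed
  have ev2: "\<forall>\<^sub>F \<delta> in at_right 0. \<forall>e\<in>E. \<forall>v\<in>V. v \<notin> e \<longrightarrow> cover \<delta> (mid e) \<inter> cover \<delta> (K v) = {}"
  proof (intro eventually_ball_finite[OF finE] eventually_ball_finite[OF finV] ballI)
    fix e v assume "e \<in> E" "v \<in> V"
    then show "\<forall>\<^sub>F \<delta> in at_right 0. v \<notin> e \<longrightarrow> cover \<delta> (mid e) \<inter> cover \<delta> (K v) = {}"
      using covers_disjoint[OF mid_top(1) K_compact mid_K] by (cases "v \<in> e") simp_all
  qed
  have ev3: "\<forall>\<^sub>F \<delta> in at_right 0. \<forall>e\<in>E. \<forall>e'\<in>E. e \<noteq> e' \<longrightarrow> cover \<delta> (mid e) \<inter> cover \<delta> (mid e') = {}"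
  proof (intro eventually_ball_finite[OF finE] ballI)
    fix e e' assume "e \<in> E" "e' \<in> E"
    then show "\<forall>\<^sub>F \<delta> in at_right 0. e \<noteq> e' \<longrightarrow> cover \<delta> (mid e) \<inter> cover \<delta> (mid e') = {}"
      using covers_disjoint[OF mid_top(1) mid_top(1) mid_mid] by (cases "e = e'") simp_all
  qed
  have ev0: "\<forall>\<^sub>F \<delta> :: real in at_right 0. 0 < \<delta>" by (rule eventually_at_right_less)
  define Q where "Q \<delta> \<longleftrightarrow> 0 < \<delta> \<and> (\<forall>u\<in>V. \<forall>v\<in>V. u \<noteq> v \<longrightarrow> cover \<delta> (K u) \<inter> cover \<delta> (K v) = {}) \<and>
    (\<forall>e\<in>E. \<forall>v\<in>V. v \<notin> e \<longrightarrow> cover \<delta> (mid e) \<inter> cover \<delta> (K v) = {}) \<and>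
    (\<forall>e\<in>E. \<forall>e'\<in>E. e \<noteq> e' \<longrightarrow> cover \<delta> (mid e) \<inter> cover \<delta> (mid e') = {})" for \<delta> :: real
  have "\<forall>\<^sub>F \<delta> in at_right 0. Q \<delta>"
    unfolding Q_def by (intro eventually_conj ev0 ev1 ev2 ev3)
  then have "\<exists>\<delta>. Q \<delta>" by (rule eventually_happens'[OF trivial_limit_at_right_real])
  then obtain \<delta> where "Q \<delta>" by blast
  then have \<delta>: "0 < \<delta>"
    and d1: "\<forall>u\<in>V. \<forall>v\<in>V. u \<noteq> v \<longrightarrow> cover \<delta> (K u) \<inter> cover \<delta> (K v) = {}"
    and d2: "\<forall>e\<in>E. \<forall>v\<in>V. v \<notin> e \<longrightarrow> cover \<delta> (mid e) \<inter> cover \<delta> (K v) = {}"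
    and d3: "\<forall>e\<in>E. \<forall>e'\<in>E. e \<noteq> e' \<longrightarrow> cover \<delta> (mid e) \<inter> cover \<delta> (mid e') = {}"
    unfolding Q_def by - (elim conjE, assumption)+
  show ?thesis
  proof (rule model_from_covers[OF gr, of "\<lambda>v. cover \<delta> (K v)" "\<lambda>e. cover \<delta> (mid e)"])
    fix v assume "v \<in> V"
    have b: "bounded (K v)" using K_compact compact_imp_bounded by blast
    have "K v \<noteq> {}" using K_pos by blast
    then show "finite (cover \<delta> (K v)) \<and> cover \<delta> (K v) \<noteq> {} \<and> linked gadj (cover \<delta> (K v))"
      using finite_cover[OF \<delta> b] cover_nonempty[OF \<delta>] cover_linked[OF \<delta> b K_connected] by simp
  next
    fix e assume e: "e \<in> E"
    have b: "bounded (mid e)" using mid_top(1)[OF e] compact_imp_bounded by blast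
    show "finite (cover \<delta> (mid e)) \<and> linked gadj (cover \<delta> (mid e))"
      using finite_cover[OF \<delta> b] cover_linked[OF \<delta> b mid_top(2)[OF e]] by simp
  next
    fix e u assume "e \<in> E" "u \<in> e"
    from mid_inc[OF this] obtain z where z: "z \<in> mid e" "z \<in> K u" by blast
    obtain p where "z \<in> cell \<delta> p" using cell_exists[OF \<delta>] by blast
    then have "p \<in> cover \<delta> (mid e)" "p \<in> cover \<delta> (K u)" unfolding cover_def using z by blast+
    then show "cover \<delta> (mid e) \<inter> cover \<delta> (K u) \<noteq> {}" by blast
  next
    fix u v assume "u \<in> V" "v \<in> V" "u \<noteq> v"
    then show "cover \<delta> (K u) \<inter> cover \<delta> (K v) = {}" using d1 by simp
  next
    fix e w assume "e \<in> E" "w \<in> V" "w \<notin> e"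
    then show "cover \<delta> (mid e) \<inter> cover \<delta> (K w) = {}" using d2 by simp
  next
    fix e e' assume "e \<in> E" "e' \<in> E" "e \<noteq> e'"
    then show "cover \<delta> (mid e) \<inter> cover \<delta> (mid e') = {}" using d3 by simp
  qed
qed

section \<open>Subgraphs, and the edge bound without connectedness\<close>

lemma minor_model_subset:
  assumes "minor_model adj V E B" "V' \<subseteq> V" "E' \<subseteq> E"
  shows "minor_model adj V' E' B"
  unfolding minor_model_def
proof (intro conjI ballI impI)
  fix v assume "v \<in> V'"
  then have "v \<in> V" using assms(2) by blast
  then show "finite (B v)" "B v \<noteq> {}" "linked adj (B v)" using assms(1) unfolding minor_model_def by simp_all
next
  fix u v assume "u \<in> V'" "v \<in> V'" "u \<noteq> v"
  then have "u \<in> V" "v \<in> V" "u \<noteq> v" using assms(2) by blast+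
  then show "B u \<inter> B v = {}" using assms(1) unfolding minor_model_def by simp
next
  fix u v assume "u \<in> V'" "v \<in> V'" "u \<noteq> v" "{u, v} \<in> E'"
  then have "u \<in> V" "v \<in> V" "u \<noteq> v" "{u, v} \<in> E" using assms(2,3) by blast+
  then show "\<exists>a\<in>B u. \<exists>b\<in>B v. adj a b" using assms(1) unfolding minor_model_def by simp
qed

lemma simple_graph_subset:
  assumes "simple_graph V E" "V' \<subseteq> V" "E' = {e\<in>E. e \<subseteq> V'}"
  shows "simple_graph V' E'"
  unfolding simple_graph_def
proof (intro conjI ballI)
  show "finite V'" using assms(1,2) finite_subset unfolding simple_graph_def by blast
  fix e assume e: "e \<in> E'"
  then have "e \<in> E" "e \<subseteq> V'" unfolding assms(3) by simp_all
  then obtain u v where "u \<noteq> v" "e = {u, v}" using assms(1) unfolding simple_graph_def by metis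
  then show "\<exists>u v. u \<in> V' \<and> v \<in> V' \<and> u \<noteq> v \<and> e = {u, v}" using \<open>e \<subseteq> V'\<close> by blast
qed

text \<open>If the search from \<open>r\<close> stops at a set \<open>U\<close>, no edge joins
  \<open>U\<close> to the rest, and the bound is additive over the two parts.\<close>

theorem edge_bound:
  assumes "simple_graph V E" "triangle_free V E" "minor_model gadj V E B"
  shows "card E \<le> 2 * card V"
  using assms
proof (induction "card V" arbitrary: V E rule: less_induct)
  case less
  have finV: "finite V" using less.prems(1) unfolding simple_graph_def by blast
  note finE = finite_edges[OF less.prems(1)]
  show ?case
  proof (cases "V = {}")
    case True
    then have "E = {}" using edge_subset[OF less.prems(1)] less.prems(1) unfolding simple_graph_def by blast
    then show ?thesis by simp
  next
    case False
    then obtain r where r: "r \<in> V" by blast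
    show ?thesis
    proof (cases "\<forall>U. r \<in> U \<longrightarrow> U \<subset> V \<longrightarrow> (\<exists>s\<in>V - U. \<exists>a\<in>U. {s, a} \<in> E)")
      case True
      then have "\<exists>s\<in>V - U. \<exists>a\<in>U. {s, a} \<in> E" if "r \<in> U" "U \<subset> V" for U using that by blast
      obtain par and d :: "'a \<Rightarrow> nat" where
        pd: "\<forall>s\<in>V - {r}. par s \<in> V \<and> {s, par s} \<in> E \<and> d (par s) < d s"
        using grow_tree[OF finV r, of "\<lambda>s a. {s, a} \<in> E"] \<open>\<And>U. r \<in> U \<Longrightarrow> U \<subset> V \<Longrightarrow> \<exists>s\<in>V - U. \<exists>a\<in>U. {s, a} \<in> E\<close> by blast
      then have "span_tree V E r par d" unfolding span_tree_def using r by blast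
      then interpret model_tree V E B r par d using finV less.prems(3) by unfold_locales
      show ?thesis by (rule edge_bound_connected[OF less.prems(1,2)])
    next
      case False
      then obtain U where U: "r \<in> U" "U \<subset> V" "\<And>s a. s \<in> V - U \<Longrightarrow> a \<in> U \<Longrightarrow> {s, a} \<notin> E" by blast
      define E1 where "E1 = {e\<in>E. e \<subseteq> U}"
      define E2 where "E2 = {e\<in>E. e \<subseteq> V - U}"
      have "E \<subseteq> E1 \<union> E2"
      proof
        fix e assume e: "e \<in> E"
        then obtain u v where uv: "u \<in> V" "v \<in> V" "e = {u, v}" using less.prems(1) unfolding simple_graph_def by metis
        have "{u, v} \<in> E" "{v, u} \<in> E" using e uv(3) by (simp_all add: insert_commute)
        then have "u \<in> U \<longleftrightarrow> v \<in> U" using U(3) uv(1,2) by blast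
        then show "e \<in> E1 \<union> E2" unfolding E1_def E2_def using e uv by blast
      qed
      then have "card E \<le> card (E1 \<union> E2)" using finE by (intro card_mono) (auto simp: E1_def E2_def)
      then have cE: "card E \<le> card E1 + card E2" using card_Un_le[of E1 E2] by linarith
      have cV: "card U + card (V - U) = card V" "card U < card V" "card (V - U) < card V"
      proof -
        have finU: "finite U" using U(2) finV finite_subset by blast
        show "card U < card V" using U(2) finV by (rule psubset_card_mono[rotated])
        show s: "card U + card (V - U) = card V" using U(2) finU finV card_Diff_subset[OF finU, of V] card_mono[OF finV, of U] by simp
        have "card U > 0" using U(1) finU card_gt_0_iff by blast
        then show "card (V - U) < card V" using s by linarith
      qed
      have tf: "triangle_free V' E'" if "V' \<subseteq> V" "E' \<subseteq> E" for V' E'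
        using less.prems(2) that unfolding triangle_free_def by (meson subsetD)
      have "card E1 \<le> 2 * card U"
        by (rule less.hyps[OF cV(2)])
          (use U(2) in \<open>auto intro!: simple_graph_subset[OF less.prems(1)] tf minor_model_subset[OF less.prems(3)] simp: E1_def\<close>)
      moreover have "card E2 \<le> 2 * card (V - U)"
        by (rule less.hyps[OF cV(3)])
          (auto intro!: simple_graph_subset[OF less.prems(1)] tf minor_model_subset[OF less.prems(3)] simp: E2_def)
      ultimately show ?thesis using cE cV(1) by linarith
    qed
  qed
qed

section \<open>The brick wall lattice\<close>

text \<open>In the brick wall lattice every pixel has at most three neighbours. This is what makes it possible
  to cut a branch set with four exits into two connected parts with two exits each.\<close>

definition badj :: "pixel \<Rightarrow> pixel \<Rightarrow> bool" where
  "badj p q \<longleftrightarrow> (snd p = snd q \<and> \<bar>fst p - fst q\<bar> = 1) \<or>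
     (fst p = fst q \<and> \<bar>snd p - snd q\<bar> = 1 \<and> even (fst p + min (snd p) (snd q)))"

text \<open>Contracts the bricks. Of the pixels \<open>(2 * i, j)\<close> and
  \<open>(2 * i + 1, j)\<close> one has its vertical edge upwards and the other downwards, so the
  contracted lattice is the square grid.\<close>

definition halve :: "pixel \<Rightarrow> pixel" where
  "halve p = (fst p div 2, snd p)"

lemma badj_sym: "badj p q \<Longrightarrow> badj q p"
  unfolding badj_def by (auto simp: min.commute abs_minus_commute)

lemma badj_gadj: "badj p q \<Longrightarrow> gadj p q"
proof -
  obtain a b where p: "p = (a, b)" by (cases p)
  obtain c d where q: "q = (c, d)" by (cases q)
  show "badj p q \<Longrightarrow> gadj p q" unfolding p q badj_def gadj_def nb_def by auto
qed

lemma badj_degree: "finite {q. badj p q} \<and> card {q. badj p q} \<le> 3"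
proof -
  obtain a b where p: "p = (a, b)" by (cases p)
  define A where "A = set [(a + 1, b), (a - 1, b), (a, if even (a + b) then b + 1 else b - 1)]"
  have "{q. badj p q} \<subseteq> A"
  proof
    fix q assume "q \<in> {q. badj p q}"
    then have h: "badj p q" by simp
    obtain c d where q: "q = (c, d)" by (cases q)
    from h consider "b = d" "\<bar>a - c\<bar> = 1" | "a = c" "\<bar>b - d\<bar> = 1" "even (a + min b d)"
      unfolding p q badj_def by auto
    then show "q \<in> A"
    proof cases
      case 1
      then have "c = a + 1 \<or> c = a - 1" by linarith
      then show ?thesis unfolding A_def q using 1 by auto
    next
      case 2
      then have "d = b + 1 \<or> d = b - 1" by linarith
      then show ?thesis
      proof
        assume d: "d = b + 1"
        then show ?thesis unfolding A_def q using 2 by simp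
      next
        assume d: "d = b - 1"
        then have "min b d = d" by simp
        then have "even (a + d)" using 2(3) by simp
        then have "odd (a + b)" using d by presburger
        then show ?thesis unfolding A_def q using 2 d by simp
      qed
    qed
  qed
  moreover have "finite A" unfolding A_def by (rule finite_set)
  moreover have "card A \<le> 3" unfolding A_def by (rule order_trans[OF card_length]) simp
  ultimately show ?thesis using finite_subset card_mono order_trans by metis
qed

lemma badj_twin:
  assumes "halve p = halve q" "p \<noteq> q"
  shows "badj p q"
proof -
  obtain a b where p: "p = (a, b)" by (cases p)
  obtain c d where q: "q = (c, d)" by (cases q)
  have "a div 2 = c div 2" "b = d" using assms(1) unfolding p q halve_def by simp_all
  moreover have "a \<noteq> c" using assms(2) p q calculation(2) by simp
  ultimately have "\<bar>a - c\<bar> = 1" by presburger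
  then show ?thesis unfolding p q badj_def using \<open>b = d\<close> by simp
qed

lemma badj_lift:
  assumes "gadj p q"
  shows "\<exists>p' q'. halve p' = p \<and> halve q' = q \<and> badj p' q'"
proof -
  obtain i j where p: "p = (i, j)" by (cases p)
  consider "q = (i + 1, j)" | "q = (i - 1, j)" | "q = (i, j + 1)" | "q = (i, j - 1)"
    using assms unfolding p gadj_def nb_def by auto
  then show ?thesis
  proof cases
    case 1
    then show ?thesis by (intro exI[of _ "(2 * i + 1, j)"] exI[of _ "(2 * i + 2, j)"]) (simp add: p halve_def badj_def)
  next
    case 2
    have "(2 * i - 1) div 2 = i - 1" by presburger
    then show ?thesis using 2 by (intro exI[of _ "(2 * i, j)"] exI[of _ "(2 * i - 1, j)"]) (simp add: p halve_def badj_def)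
  next
    case 3
    \<comment> \<open>The pixel of the brick whose vertical edge goes up.\<close>
    define x where "x = (if even j then 2 * i else 2 * i + 1)"
    have "x div 2 = i" "even (x + j)" unfolding x_def by simp_all
    then show ?thesis using 3 by (intro exI[of _ "(x, j)"] exI[of _ "(x, j + 1)"]) (simp add: p halve_def badj_def)
  next
    case 4
    define x where "x = (if even j then 2 * i + 1 else 2 * i)"
    have "x div 2 = i" "even (x + (j - 1))" unfolding x_def by simp_all
    then show ?thesis using 4 by (intro exI[of _ "(x, j)"] exI[of _ "(x, j - 1)"]) (simp add: p halve_def badj_def)
  qed
qed

theorem brick_model:
  assumes "minor_model gadj V E B"
  shows "minor_model badj V E (\<lambda>v. halve -` B v)"
  unfolding minor_model_def
proof (intro conjI ballI impI)
  have surj: "\<exists>p'. halve p' = p" for p by (rule exI[of _ "(2 * fst p, snd p)"]) (simp add: halve_def)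
  fix v assume v: "v \<in> V"
  have Bv: "finite (B v)" "B v \<noteq> {}" "linked gadj (B v)" using assms v unfolding minor_model_def by simp_all
  have "halve -` B v \<subseteq> (\<lambda>p. (2 * fst p, snd p)) ` B v \<union> (\<lambda>p. (2 * fst p + 1, snd p)) ` B v"
  proof
    fix p assume "p \<in> halve -` B v"
    then have h: "halve p \<in> B v" by simp
    have "fst p = 2 * (fst p div 2) \<or> fst p = 2 * (fst p div 2) + 1" by presburger
    then have "p = (\<lambda>p. (2 * fst p, snd p)) (halve p) \<or> p = (\<lambda>p. (2 * fst p + 1, snd p)) (halve p)"
      unfolding halve_def by (simp add: prod_eq_iff)
    then show "p \<in> (\<lambda>p. (2 * fst p, snd p)) ` B v \<union> (\<lambda>p. (2 * fst p + 1, snd p)) ` B v" using h by blast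
  qed
  then show "finite (halve -` B v)" by (rule finite_subset) (use Bv(1) in simp)
  show "halve -` B v \<noteq> {}" using Bv(2) surj by blast
  show "linked badj (halve -` B v)"
    unfolding linked_def
  proof (intro allI impI)
    fix X assume X: "X \<subseteq> halve -` B v" "X \<noteq> {}" "X \<noteq> halve -` B v"
    show "\<exists>a\<in>X. \<exists>b\<in>halve -` B v - X. badj a b"
    proof (cases "\<exists>p\<in>X. \<exists>q\<in>halve -` B v - X. halve p = halve q")
      case True
      then obtain p q where "p \<in> X" "q \<in> halve -` B v - X" "halve p = halve q" by blast
      moreover from this have "p \<noteq> q" by blast
      ultimately show ?thesis using badj_twin by blast
    next
      case False
      have "halve ` X \<inter> B v \<noteq> {}" using X(1,2) by blast
      moreover have "\<not> B v \<subseteq> halve ` X"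
      proof
        assume s: "B v \<subseteq> halve ` X"
        obtain q where q: "q \<in> halve -` B v - X" using X(1,3) by blast
        then have "halve q \<in> halve ` X" using s by blast
        then obtain p where "p \<in> X" "halve q = halve p" by blast
        then show False using False q by metis
      qed
      ultimately obtain a b where ab: "a \<in> halve ` X \<inter> B v" "b \<in> B v - halve ` X" "gadj a b"
        using linkedD[OF Bv(3), of "halve ` X"] by blast
      obtain p' q' where pq: "halve p' = a" "halve q' = b" "badj p' q'" using badj_lift[OF ab(3)] by blast
      obtain p where p: "p \<in> X" "a = halve p" using ab(1) by blast
      have "p' \<in> halve -` B v" using pq(1) ab(1) by blast
      then have "p' \<in> X" using False p pq(1) by (metis DiffI)
      moreover have "q' \<in> halve -` B v - X" using pq(2) ab(2) by blast
      ultimately show ?thesis using pq(3) by blast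
    qed
  qed
next
  fix u v assume "u \<in> V" "v \<in> V" "u \<noteq> v"
  then have "B u \<inter> B v = {}" using assms unfolding minor_model_def by simp
  then show "halve -` B u \<inter> halve -` B v = {}" by blast
next
  fix u v assume "u \<in> V" "v \<in> V" "u \<noteq> v" "{u, v} \<in> E"
  then have "\<exists>a\<in>B u. \<exists>b\<in>B v. gadj a b" using assms unfolding minor_model_def by simp
  then obtain a b where ab: "a \<in> B u" "b \<in> B v" "gadj a b" by blast
  obtain p' q' where h: "halve p' = a" "halve q' = b" "badj p' q'" using badj_lift[OF ab(3)] by blast
  have "p' \<in> halve -` B u" "q' \<in> halve -` B v" using h(1,2) ab(1,2) by simp_all
  with h(3) show "\<exists>a\<in>halve -` B u. \<exists>b\<in>halve -` B v. badj a b" by blast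
qed

section \<open>Splitting a vertex of degree 4\<close>

definition comp :: "('b \<Rightarrow> 'b \<Rightarrow> bool) \<Rightarrow> 'b set \<Rightarrow> 'b \<Rightarrow> 'b set" where
  "comp adj M a = {b. (a, b) \<in> {(x, y). x \<in> M \<and> y \<in> M \<and> adj x y}\<^sup>*}"

lemma comp_self: "a \<in> comp adj M a"
  by (simp add: comp_def)

lemma comp_subset:
  assumes "a \<in> M"
  shows "comp adj M a \<subseteq> M"
proof
  fix b assume "b \<in> comp adj M a"
  then have "(a, b) \<in> {(x, y). x \<in> M \<and> y \<in> M \<and> adj x y}\<^sup>*" by (simp add: comp_def)
  then show "b \<in> M" by (induction rule: rtrancl_induct) (use assms in auto)
qed

lemma comp_closed:
  assumes "y \<in> comp adj M a" "y \<in> M" "z \<in> M" "adj y z"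
  shows "z \<in> comp adj M a"
  using assms unfolding comp_def by (auto intro: rtrancl_into_rtrancl)

lemma comp_sym:
  assumes "\<And>x y. adj x y \<Longrightarrow> adj y x" "b \<in> comp adj M a"
  shows "a \<in> comp adj M b"
proof -
  have "sym {(x, y). x \<in> M \<and> y \<in> M \<and> adj x y}" using assms(1) by (auto intro: symI)
  then have "sym ({(x, y). x \<in> M \<and> y \<in> M \<and> adj x y}\<^sup>*)" by (rule sym_rtrancl)
  then show ?thesis using assms(2) unfolding comp_def by (auto dest: symD)
qed

lemma comp_trans: "b \<in> comp adj M a \<Longrightarrow> c \<in> comp adj M b \<Longrightarrow> c \<in> comp adj M a"
  unfolding comp_def by auto

lemma linked_comp:
  assumes sym: "\<And>x y. adj x y \<Longrightarrow> adj y x" and a: "a \<in> M"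
  shows "linked adj (comp adj M a)"
proof -
  let ?C = "comp adj M a"
  have cross: "\<exists>w\<in>W. \<exists>z\<in>?C - W. adj w z" if W: "a \<in> W" "W \<noteq> ?C" "W \<subseteq> ?C" for W
  proof (rule ccontr)
    assume n: "\<not> ?thesis"
    have "b \<in> W" if "b \<in> ?C" for b
    proof -
      have "(a, b) \<in> {(x, y). x \<in> M \<and> y \<in> M \<and> adj x y}\<^sup>*" using that by (simp add: comp_def)
      then show ?thesis
      proof (induction rule: rtrancl_induct)
        case (step y z)
        have y: "y \<in> ?C" using step(3) W(3) by blast
        have "y \<in> M" "z \<in> M" "adj y z" using step(2) by auto
        then have "z \<in> ?C" using comp_closed[OF y] by blast
        then show ?case using n step(3) \<open>adj y z\<close> by blast
      qed (rule W(1))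
    qed
    then show False using W by blast
  qed
  show ?thesis unfolding linked_def
  proof (intro allI impI)
    fix X assume X: "X \<subseteq> ?C" "X \<noteq> {}" "X \<noteq> ?C"
    show "\<exists>x\<in>X. \<exists>y\<in>?C - X. adj x y"
    proof (cases "a \<in> X")
      case True
      then show ?thesis using cross X by blast
    next
      case False
      then have "a \<in> ?C - X" using comp_self[of a adj M] by blast
      moreover have "?C - X \<noteq> ?C" using X by blast
      ultimately obtain w z where wz: "w \<in> ?C - X" "z \<in> ?C - (?C - X)" "adj w z" using cross[of "?C - X"] by blast
      then have "z \<in> X" "adj z w" using sym X(1) by blast+
      then show ?thesis using wz(1) by blast
    qed
  qed
qed

lemma linked_center:
  assumes "\<And>c. c \<in> M \<Longrightarrow> \<exists>N\<subseteq>M. linked adj N \<and> c \<in> N \<and> x \<in> N"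
  shows "linked adj M"
  unfolding linked_def
proof (intro allI impI)
  fix X assume X: "X \<subseteq> M" "X \<noteq> {}" "X \<noteq> M"
  obtain a b where ab: "a \<in> X" "b \<in> M" "b \<notin> X" using X by blast
  have "\<exists>N\<subseteq>M. linked adj N \<and> N \<inter> X \<noteq> {} \<and> \<not> N \<subseteq> X"
  proof (cases "x \<in> X")
    case True
    obtain N where N: "N \<subseteq> M" "linked adj N" "b \<in> N" "x \<in> N" using assms[OF ab(2)] by blast
    then show ?thesis using True ab(3) by blast
  next
    case False
    have "a \<in> M" using ab(1) X(1) by blast
    then obtain N where N: "N \<subseteq> M" "linked adj N" "a \<in> N" "x \<in> N" using assms by blast
    then show ?thesis using False ab(1) by blast
  qed
  then obtain N where N: "N \<subseteq> M" "linked adj N" "X \<inter> N \<noteq> {}" "\<not> N \<subseteq> X" by blast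
  from linkedD[OF N(2,3,4)] show "\<exists>a\<in>X. \<exists>b\<in>M - X. adj a b" using N(1) by blast
qed

lemma linked_singleton: "linked adj {x}"
  unfolding linked_def by (simp add: subset_singleton_iff)

theorem balanced_split:
  fixes plc out :: "'k \<Rightarrow> 'b"
  assumes finB: "finite B" and lB: "linked adj B" and sym: "\<And>x y. adj x y \<Longrightarrow> adj y x"
    and deg: "\<And>x. finite {y. adj x y} \<and> card {y. adj x y} \<le> 3"
    and tok: "\<And>k. k \<in> T \<Longrightarrow> plc k \<in> B \<and> out k \<notin> B \<and> adj (plc k) (out k)"
    and inj: "inj_on out T" and cT: "card T = 4"
  shows "\<exists>X\<subseteq>B. linked adj X \<and> linked adj (B - X) \<and> X \<noteq> {} \<and> B - X \<noteq> {} \<and> card {k\<in>T. plc k \<in> X} = 2"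
proof -
  define tk where "tk X = {k\<in>T. plc k \<in> X}" for X
  have finT: "finite T" using cT card.infinite by fastforce
  have fin_tk: "finite (tk X)" for X unfolding tk_def using finT by simp
  define good where "good X \<longleftrightarrow> X \<subseteq> B \<and> linked adj X \<and> linked adj (B - X) \<and> X \<noteq> {} \<and> card (tk X) \<ge> 2" for X
  have tkB: "tk B = T" unfolding tk_def using tok by blast
  have "T \<noteq> {}" using cT by auto
  then have "B \<noteq> {}" using tok by blast
  moreover have "linked adj (B - B)" unfolding linked_def by simp
  ultimately have "good B" unfolding good_def using lB cT tkB by simp
  then obtain X where X: "good X" and min: "\<And>Y. good Y \<Longrightarrow> card X \<le> card Y"
    using ex_has_least_nat[of good B card] by blast
  have XB: "X \<subseteq> B" "linked adj X" "linked adj (B - X)" "X \<noteq> {}" "card (tk X) \<ge> 2"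
    using X unfolding good_def by simp_all
  have finX: "finite X" using XB(1) finB finite_subset by blast
  \<comment> \<open>\<open>F\<close> holds the neighbour of \<open>x\<close> reserved for the
    complement and is empty if \<open>X = B\<close>, so that one count serves both cases.\<close>
  obtain x F where x: "x \<in> X" and F: "F \<subseteq> {y. adj x y}" "F \<subseteq> B - X" "finite F"
    and F1: "X = B \<Longrightarrow> F = {}" and F2: "X \<noteq> B \<Longrightarrow> card F = 1"
  proof (cases "X = B")
    case True
    obtain x where "x \<in> X" using XB(4) by blast
    then show thesis using that[of x "{}"] True by simp
  next
    case False
    then have "\<not> B \<subseteq> X" "X \<inter> B \<noteq> {}" using XB(1,4) by blast+
    then obtain x b where "x \<in> X" "b \<in> B - X" "adj x b" using linkedD[OF lB, of X] by blast
    then show thesis using that[of x "{b}"] False by simp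
  qed
  let ?M = "X - {x}"
  have gate: "\<exists>y. adj x y \<and> y \<in> comp adj ?M a" if a: "a \<in> ?M" for a
  proof -
    let ?Y = "comp adj ?M a"
    have Y: "?Y \<subseteq> ?M" by (rule comp_subset[OF a])
    have "?Y \<inter> X \<noteq> {}" using comp_self[of a adj ?M] a by blast
    moreover have "\<not> X \<subseteq> ?Y" using x Y by blast
    ultimately obtain u z where uz: "u \<in> ?Y \<inter> X" "z \<in> X - ?Y" "adj u z" using linkedD[OF XB(2), of ?Y] by blast
    have "z = x"
    proof (rule ccontr)
      assume "z \<noteq> x"
      then have "z \<in> ?Y" using comp_closed[of u adj ?M a z] uz Y by blast
      then show False using uz(2) by blast
    qed
    then show ?thesis using uz sym by blast
  qed
  \<comment> \<open>A component with two exits would be a smaller candidate: the other components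
    and \<open>B - X\<close> stay connected through \<open>x\<close>.\<close>
  have few: "card (tk (comp adj ?M a)) \<le> 1" if a: "a \<in> ?M" for a
  proof (rule ccontr)
    let ?Y = "comp adj ?M a"
    assume "\<not> ?thesis"
    then have two: "card (tk ?Y) \<ge> 2" by simp
    have Y: "?Y \<subseteq> ?M" by (rule comp_subset[OF a])
    have "linked adj (B - ?Y)"
    proof (rule linked_center[of _ _ x])
      fix c assume c: "c \<in> B - ?Y"
      consider "c \<notin> X" | "c = x" | "c \<in> ?M" using c by blast
      then show "\<exists>N\<subseteq>B - ?Y. linked adj N \<and> c \<in> N \<and> x \<in> N"
      proof cases
        case 1
        then have "X \<noteq> B" using c by blast
        then obtain b where b: "b \<in> F" using F2 by (metis card_eq_0_iff ex_in_conv zero_neq_one)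
        then have "adj x b" "adj b x" "b \<in> B - X" using F sym by blast+
        then have "linked adj (insert x (B - X))" using linked_insert[OF XB(3)] by blast
        moreover have "insert x (B - X) \<subseteq> B - ?Y" using Y x XB(1) by blast
        ultimately show ?thesis using 1 c by blast
      next
        case 2
        have "{x} \<subseteq> B - ?Y" using c 2 by simp
        then show ?thesis using linked_singleton[of adj x] 2 by blast
      next
        case 3
        let ?C = "comp adj ?M c"
        obtain y where y: "adj x y" "y \<in> ?C" using gate[OF 3] by blast
        have "linked adj (insert x ?C)"
          using linked_insert[OF linked_comp[OF sym 3] y(2) sym[OF y(1)] y(1)] .
        moreover have "?C \<inter> ?Y = {}"
        proof (rule ccontr)
          assume "?C \<inter> ?Y \<noteq> {}"
          then obtain z where z: "z \<in> ?C" "z \<in> ?Y" by blast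
          have "c \<in> comp adj ?M z" using comp_sym[OF sym z(1)] .
          then have "c \<in> ?Y" using comp_trans[OF z(2)] by blast
          then show False using c by blast
        qed
        moreover have "?C \<subseteq> ?M" by (rule comp_subset[OF 3])
        ultimately have "linked adj (insert x ?C)" "insert x ?C \<subseteq> B - ?Y" using Y x XB(1) by blast+
        then show ?thesis using comp_self[of c adj ?M] by blast
      qed
    qed
    moreover have "?Y \<subseteq> B" using Y XB(1) by blast
    moreover have "linked adj ?Y" by (rule linked_comp[OF sym a])
    moreover have "?Y \<noteq> {}" using comp_self[of a adj ?M] by blast
    ultimately have "good ?Y" unfolding good_def using two by (intro conjI)
    then have "card X \<le> card ?Y" by (rule min)
    moreover have "card ?Y < card X"
      by (rule psubset_card_mono[OF finX]) (use Y x in blast)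
    ultimately show False by simp
  qed
  define \<phi> where "\<phi> k = (if plc k = x then out k else (SOME y. adj x y \<and> y \<in> comp adj ?M (plc k)))" for k
  have phi: "adj x (\<phi> k) \<and> \<phi> k \<in> comp adj ?M (plc k)" if "plc k \<in> ?M" for k
  proof -
    have eq: "\<phi> k = (SOME y. adj x y \<and> y \<in> comp adj ?M (plc k))" using that unfolding \<phi>_def by simp
    show ?thesis unfolding eq by (rule someI_ex[OF gate[OF that]])
  qed
  have phi_cases: "plc k = x \<and> \<phi> k = out k \<or> plc k \<in> ?M \<and> \<phi> k \<in> ?M" if "k \<in> tk X" for k
  proof (cases "plc k = x")
    case True
    then have "\<phi> k = out k" unfolding \<phi>_def by simp
    then show ?thesis using True by blast
  next
    case False
    then have m: "plc k \<in> ?M" using that unfolding tk_def by blast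
    have "\<phi> k \<in> ?M" using phi[OF m] comp_subset[OF m, of adj] by blast
    then show ?thesis using m by blast
  qed
  have "inj_on \<phi> (tk X)"
  proof (rule inj_onI, rule ccontr)
    fix k l assume k: "k \<in> tk X" and l: "l \<in> tk X" and eq: "\<phi> k = \<phi> l" and ne: "k \<noteq> l"
    have kT: "k \<in> T" "l \<in> T" using k l unfolding tk_def by blast+
    have outX: "out k \<notin> X" "out l \<notin> X" using tok[OF kT(1)] tok[OF kT(2)] XB(1) by blast+
    from phi_cases[OF k] phi_cases[OF l] show False
    proof (elim disjE conjE)
      assume "\<phi> k = out k" "\<phi> l = out l"
      then show False using eq ne inj kT unfolding inj_on_def by metis
    next
      assume "\<phi> k = out k" "\<phi> l \<in> ?M"
      then show False using eq outX by simp
    next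
      assume "\<phi> k \<in> ?M" "\<phi> l = out l"
      then show False using eq outX by simp
    next
      assume m: "plc k \<in> ?M" "plc l \<in> ?M"
      have "\<phi> k \<in> comp adj ?M (plc l)" using phi[OF m(2)] unfolding eq by blast
      from comp_sym[OF sym this] have "plc l \<in> comp adj ?M (\<phi> k)" .
      with phi[OF m(1)] have "plc l \<in> comp adj ?M (plc k)" using comp_trans[of "\<phi> k" adj ?M "plc k"] by blast
      then have "{k, l} \<subseteq> tk (comp adj ?M (plc k))" unfolding tk_def using kT comp_self[of "plc k"] by blast
      then have "card {k, l} \<le> card (tk (comp adj ?M (plc k)))" by (rule card_mono[OF fin_tk])
      then show False using few[OF m(1)] ne by simp
    qed
  qed
  then have "card (tk X) = card (\<phi> ` tk X)" by (simp add: card_image)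
  also have "\<dots> \<le> card ({y. adj x y} - F)"
  proof (rule card_mono)
    show "finite ({y. adj x y} - F)" using deg by simp
    show "\<phi> ` tk X \<subseteq> {y. adj x y} - F"
    proof
      fix z assume "z \<in> \<phi> ` tk X"
      then obtain k where k: "k \<in> tk X" "z = \<phi> k" by blast
      have kT: "k \<in> T" using k unfolding tk_def by blast
      from phi_cases[OF k(1)] show "z \<in> {y. adj x y} - F"
      proof (elim disjE conjE)
        assume "plc k = x" "\<phi> k = out k"
        then show ?thesis using tok[OF kT] k(2) F(2) by auto
      next
        assume "plc k \<in> ?M" "\<phi> k \<in> ?M"
        then show ?thesis using phi[of k] k(2) F(2) by blast
      qed
    qed
  qed
  also have "\<dots> = card {y. adj x y} - card F" using F(1,3) by (simp add: card_Diff_subset)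
  finally have bound: "card (tk X) \<le> 3 - card F" using deg[of x] by linarith
  have "X \<noteq> B"
  proof
    assume "X = B"
    then show False using bound F1 tkB cT by simp
  qed
  then have "card (tk X) = 2" using bound F2 XB(5) by simp
  moreover have "B - X \<noteq> {}" using \<open>X \<noteq> B\<close> XB(1) by blast
  ultimately show ?thesis using XB unfolding tk_def by blast
qed

text \<open>The additive 4 absorbs the vertex lost when the two halves of a split vertex are
  identified again: \<open>separator\<close> itself gives 1.\<close>

definition sep :: "'a set \<Rightarrow> 'a set set \<Rightarrow> 'a \<Rightarrow> ('a \<Rightarrow> 'a) \<Rightarrow> 'a set \<Rightarrow> 'a set \<Rightarrow> 'a set \<Rightarrow> 'a \<Rightarrow> 'a \<Rightarrow> bool" where
  "sep V E r par Z L R x y \<longleftrightarrow> Z \<union> L \<union> R = V \<and> Z \<inter> L = {} \<and> Z \<inter> R = {} \<and> L \<inter> R = {} \<and>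
     (\<forall>u\<in>L. \<forall>w\<in>R. {u, w} \<notin> E) \<and> x \<in> V \<and> y \<in> V \<and> Z \<subseteq> anc par r x \<union> anc par r y \<and>
     card V \<le> 4 * card (L \<union> Z) + 4 \<and> card V \<le> 4 * card (R \<union> Z) + 4"

lemma minor_model_brick_grid:
  assumes "minor_model badj V E B"
  shows "minor_model gadj V E B"
proof -
  have "linked gadj (B v)" if "v \<in> V" for v
  proof -
    have "linked badj (B v)" using assms that unfolding minor_model_def by simp
    then show ?thesis unfolding linked_def using badj_gadj by meson
  qed
  then show ?thesis using assms badj_gadj unfolding minor_model_def by meson
qed

lemma brick_separator:
  assumes "finite V" "minor_model badj V E B" "span_tree V E r par lev"
  shows "\<exists>Z L R x y. sep V E r par Z L R x y \<and> card V \<le> 4 * card (L \<union> Z) + 1 \<and> card V \<le> 4 * card (R \<union> Z) + 1"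
proof -
  interpret model_tree V E B r par lev
    using assms minor_model_brick_grid by unfold_locales
  obtain Z L R x y where *: "Z \<union> L \<union> R = V \<and> Z \<inter> L = {} \<and> Z \<inter> R = {} \<and> L \<inter> R = {} \<and>
     (\<forall>u\<in>L. \<forall>w\<in>R. {u, w} \<notin> E) \<and> x \<in> V \<and> y \<in> V \<and> Z \<subseteq> anc par r x \<union> anc par r y \<and>
     card V \<le> 4 * card (L \<union> Z) \<and> card V \<le> 4 * card (R \<union> Z) + 1"
    using separator by (elim exE)
  from * have "sep V E r par Z L R x y" unfolding sep_def by simp
  moreover from * have "card V \<le> 4 * card (L \<union> Z) + 1" "card V \<le> 4 * card (R \<union> Z) + 1" by simp_all
  ultimately show ?thesis by blast
qed

section \<open>The split graph and its separators\<close>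

text \<open>Splitting \<open>v\<close> into two adjacent vertices, \<open>None\<close> with the neighbours in \<open>N1\<close> and \<open>Some v\<close> with the
  others, yields a planar graph again. A separator path through the two neighbours kept by \<open>Some v\<close>
  avoids \<open>None\<close>, so the vertices of \<open>N1\<close> lie on one side.\<close>

definition unsplit :: "'a \<Rightarrow> 'a option \<Rightarrow> 'a" where
  "unsplit v p = (case p of None \<Rightarrow> v | Some w \<Rightarrow> w)"

definition splitadj :: "'a set set \<Rightarrow> 'a \<Rightarrow> 'a set \<Rightarrow> 'a option \<Rightarrow> 'a option \<Rightarrow> bool" where
  "splitadj E v N1 p q = (case p of
     None \<Rightarrow> (case q of None \<Rightarrow> False | Some w \<Rightarrow> w = v \<or> w \<in> N1)
   | Some u \<Rightarrow> (case q of None \<Rightarrow> u = v \<or> u \<in> N1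
       | Some w \<Rightarrow> {u, w} \<in> E \<and> \<not> (u = v \<and> w \<in> N1) \<and> \<not> (w = v \<and> u \<in> N1)))"

lemma splitadj_sym: "splitadj E v N1 p q \<longleftrightarrow> splitadj E v N1 q p"
  unfolding splitadj_def by (cases p; cases q) (auto simp: insert_commute)

definition splitE :: "'a set set \<Rightarrow> 'a \<Rightarrow> 'a set \<Rightarrow> 'a option set set" where
  "splitE E v N1 = {{p, q} | p q. splitadj E v N1 p q}"

lemma splitE_iff: "{p, q} \<in> splitE E v N1 \<longleftrightarrow> splitadj E v N1 p q"
  unfolding splitE_def using splitadj_sym[of E v N1] by (auto simp: doubleton_eq_iff)

text \<open>The exits in \<open>balanced_split\<close> are the edges chosen towards the four
  neighbours. Which pairs of neighbours stay together is therefore determined by the model.\<close>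

lemma split_model:
  assumes model: "minor_model badj V E B" and v: "v \<in> V"
    and N: "N = {w. {v, w} \<in> E}" "N \<subseteq> V - {v}" "card N = 4"
  shows "\<exists>N1 B'. N1 \<subseteq> N \<and> card (N - N1) = 2 \<and>
    minor_model badj (insert None (Some ` V)) (splitE E v N1) B'"
proof -
  have Bv: "finite (B v)" "B v \<noteq> {}" "linked badj (B v)" using model v unfolding minor_model_def by simp_all
  have disj: "B u \<inter> B w = {}" if "u \<in> V" "w \<in> V" "u \<noteq> w" for u w
    using model that unfolding minor_model_def by simp
  have "\<forall>w\<in>N. \<exists>ab. fst ab \<in> B v \<and> snd ab \<in> B w \<and> badj (fst ab) (snd ab)"
  proof
    fix w assume w: "w \<in> N"
    then have "{v, w} \<in> E" "w \<in> V" "v \<noteq> w" using N(1,2) by blast+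
    then have "\<exists>a\<in>B v. \<exists>b\<in>B w. badj a b" using model v unfolding minor_model_def by simp
    then show "\<exists>ab. fst ab \<in> B v \<and> snd ab \<in> B w \<and> badj (fst ab) (snd ab)" by force
  qed
  from bchoice[OF this] obtain f where
    f: "\<forall>w\<in>N. fst (f w) \<in> B v \<and> snd (f w) \<in> B w \<and> badj (fst (f w)) (snd (f w))" ..
  have tok: "fst (f w) \<in> B v \<and> snd (f w) \<notin> B v \<and> badj (fst (f w)) (snd (f w))" if "w \<in> N" for w
  proof -
    have "w \<in> V" "w \<noteq> v" using that N(2) by blast+
    then show ?thesis using f that disj[OF \<open>w \<in> V\<close> v] by blast
  qed
  have inj: "inj_on (\<lambda>w. snd (f w)) N"
  proof (rule inj_onI, rule ccontr)
    fix u w assume uw: "u \<in> N" "w \<in> N" "snd (f u) = snd (f w)" "u \<noteq> w"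
    then have "snd (f u) \<in> B u" "snd (f u) \<in> B w" "u \<in> V" "w \<in> V" using f N(2) by auto
    then show False using disj uw(4) by blast
  qed
  have "\<exists>X\<subseteq>B v. linked badj X \<and> linked badj (B v - X) \<and> X \<noteq> {} \<and> B v - X \<noteq> {} \<and> card {w\<in>N. fst (f w) \<in> X} = 2"
    by (rule balanced_split[OF Bv(1,3) badj_sym badj_degree tok inj N(3)])
  then obtain X where X: "X \<subseteq> B v" "linked badj X" "linked badj (B v - X)" "X \<noteq> {}" "B v - X \<noteq> {}"
    "card {w\<in>N. fst (f w) \<in> X} = 2" by blast
  define N1 where "N1 = {w\<in>N. fst (f w) \<notin> X}"
  have N1: "N1 \<subseteq> N" "N - N1 = {w\<in>N. fst (f w) \<in> X}" unfolding N1_def by blast+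
  define B' where "B' p = (case p of None \<Rightarrow> B v - X | Some w \<Rightarrow> if w = v then X else B w)" for p
  have B'N: "B' None = B v - X" and B'v: "B' (Some v) = X" and B'w: "w \<noteq> v \<Longrightarrow> B' (Some w) = B w" for w
    unfolding B'_def by simp_all
  have seam: "\<exists>a\<in>X. \<exists>b\<in>B v - X. badj a b"
  proof -
    have "X \<inter> B v \<noteq> {}" "\<not> B v \<subseteq> X" using X by blast+
    from linkedD[OF Bv(3) this] show ?thesis by blast
  qed
  have adj: "\<exists>a\<in>B' p. \<exists>b\<in>B' q. badj a b"
    if pq: "splitadj E v N1 p q" "p \<in> insert None (Some ` V)" "q \<in> insert None (Some ` V)" "p \<noteq> q" for p q
  proof -
    have flip: "\<exists>a\<in>P. \<exists>b\<in>Q. badj a b" if "\<exists>a\<in>Q. \<exists>b\<in>P. badj a b" for P Q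
      using that badj_sym by blast
    have none: "\<exists>a\<in>B' None. \<exists>b\<in>B' (Some w). badj a b" if "w = v \<or> w \<in> N1" for w
    proof (cases "w = v")
      case True
      show ?thesis unfolding True B'N B'v by (rule flip[OF seam])
    next
      case False
      then have w: "w \<in> N1" using that by blast
      then have "fst (f w) \<in> B v - X" "snd (f w) \<in> B w" "badj (fst (f w)) (snd (f w))"
        using tok f unfolding N1_def by blast+
      then show ?thesis unfolding B'N B'w[OF False] by blast
    qed
    have some: "\<exists>a\<in>B' (Some v). \<exists>b\<in>B' (Some w). badj a b" if "{v, w} \<in> E" "w \<notin> N1" for w
    proof -
      have w: "w \<in> N" using that(1) N(1) by blast
      then have "fst (f w) \<in> X" using that(2) unfolding N1_def by blast
      moreover have "snd (f w) \<in> B w" "badj (fst (f w)) (snd (f w))" using f w by blast+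
      moreover have "w \<noteq> v" using w N(2) by blast
      ultimately show ?thesis using B'v B'w[of w] by blast
    qed
    show ?thesis
    proof (cases p)
      case None
      then obtain w where q: "q = Some w" using pq(4) by (cases q) auto
      have "w = v \<or> w \<in> N1" using pq(1) unfolding None q splitadj_def by simp
      then show ?thesis using none unfolding None q by blast
    next
      case p: (Some u)
      show ?thesis
      proof (cases q)
        case None
        have "u = v \<or> u \<in> N1" using pq(1) unfolding None p splitadj_def by simp
        then show ?thesis using flip[OF none] unfolding None p by blast
      next
        case q: (Some w)
        have e: "{u, w} \<in> E" "\<not> (u = v \<and> w \<in> N1)" "\<not> (w = v \<and> u \<in> N1)"
          using pq(1) unfolding p q splitadj_def by simp_all
        have uw: "u \<in> V" "w \<in> V" "u \<noteq> w" using pq p q by auto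
        consider "u = v" | "w = v" | "u \<noteq> v" "w \<noteq> v" by blast
        then show ?thesis
        proof cases
          case 1
          then have "{v, w} \<in> E" "w \<notin> N1" using e by simp_all
          from some[OF this] show ?thesis unfolding p q 1 .
        next
          case 2
          then have "{v, u} \<in> E" "u \<notin> N1" using e by (simp_all add: insert_commute)
          from flip[OF some[OF this]] show ?thesis unfolding p q 2 .
        next
          case 3
          have "\<exists>a\<in>B u. \<exists>b\<in>B w. badj a b" using model uw e(1) unfolding minor_model_def by simp
          then show ?thesis unfolding p q using B'w 3 by simp
        qed
      qed
    qed
  qed
  have "minor_model badj (insert None (Some ` V)) (splitE E v N1) B'"
    unfolding minor_model_def
  proof (intro conjI ballI impI)
    fix p assume p: "p \<in> insert None (Some ` V)"
    have Bw: "finite (B w)" "B w \<noteq> {}" "linked badj (B w)" if "w \<in> V" for w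
      using model that unfolding minor_model_def by simp_all
    have finX: "finite X" using X(1) Bv(1) finite_subset by blast
    show "finite (B' p)" "B' p \<noteq> {}" "linked badj (B' p)"
      using p Bv(1) finX X Bw by (auto simp: B'_def split: option.split)
  next
    fix p q assume p: "p \<in> insert None (Some ` V)" and q: "q \<in> insert None (Some ` V)" and pq: "p \<noteq> q"
    have "B' p \<subseteq> B (unsplit v p)" for p unfolding B'_def unsplit_def using X(1) by (cases p) auto
    then have sub: "B' p \<subseteq> B (unsplit v p)" "B' q \<subseteq> B (unsplit v q)" by blast+
    show "B' p \<inter> B' q = {}"
    proof (cases "unsplit v p = unsplit v q")
      case True
      then have "(p = None \<and> q = Some v) \<or> (p = Some v \<and> q = None)"
        using pq unfolding unsplit_def by (cases p; cases q) auto
      then show ?thesis using B'N B'v by blast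
    next
      case False
      have "unsplit v p \<in> V" "unsplit v q \<in> V" using p q v unfolding unsplit_def by auto
      from disj[OF this False] show ?thesis using sub by blast
    qed
  next
    fix p q assume "p \<in> insert None (Some ` V)" "q \<in> insert None (Some ` V)" "p \<noteq> q" "{p, q} \<in> splitE E v N1"
    then show "\<exists>a\<in>B' p. \<exists>b\<in>B' q. badj a b" using adj splitE_iff by metis
  qed
  then show ?thesis using N1 X(6) by metis
qed

text \<open>The pair \<open>N2\<close> comes before the quantifier over trees, because the tree to
  be used has ties broken by priorities that depend on \<open>N2\<close>.\<close>

theorem split_separator:
  assumes finV: "finite V" and model: "minor_model badj V E B" and v: "v \<in> V"
    and N: "N = {w. {v, w} \<in> E}" "N \<subseteq> V - {v}" "card N = 4"
  shows "\<exists>N2\<subseteq>N. card N2 = 2 \<and> (\<forall>par lev. span_tree V E v par lev \<longrightarrow> (\<forall>w\<in>N. par w = v) \<longrightarrow>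
    (\<exists>Z L R x y. sep V E v par Z L R x y \<and> (N2 \<subseteq> Z \<longrightarrow> N \<inter> L = {} \<or> N \<inter> R = {})))"
proof -
  obtain N1 B' where N1: "N1 \<subseteq> N" "card (N - N1) = 2"
    and model': "minor_model badj (insert None (Some ` V)) (splitE E v N1) B'"
    using split_model[OF model v N] by blast
  let ?V = "insert None (Some ` V)" and ?E = "splitE E v N1"
  have "\<exists>Z L R x y. sep V E v par Z L R x y \<and> (N - N1 \<subseteq> Z \<longrightarrow> N \<inter> L = {} \<or> N \<inter> R = {})"
    if tree: "span_tree V E v par lev" and parN: "\<forall>w\<in>N. par w = v" for par lev
  proof -
    \<comment> \<open>The tree of the split graph has \<open>None\<close> between
      \<open>Some v\<close> and \<open>N1\<close>. Levels are doubled to make room for it.\<close>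
    define par' where "par' p = (case p of None \<Rightarrow> Some v | Some w \<Rightarrow> if w \<in> N1 then None else Some (par w))" for p
    define lev' where "lev' p = (case p of None \<Rightarrow> 2 * lev v + 1 | Some w \<Rightarrow> 2 * lev w)" for p
    have pt: "par w \<in> V \<and> {w, par w} \<in> E \<and> lev (par w) < lev w" if "w \<in> V" "w \<noteq> v" for w
      using tree that unfolding span_tree_def by blast
    have vN1: "v \<notin> N1" using N(2) N1(1) by blast
    have parN1: "par w = v" if "w \<in> N1" for w using parN N1(1) that by blast
    have tree': "span_tree ?V ?E (Some v) par' lev'"
      unfolding span_tree_def
    proof (intro conjI ballI impI)
      show "Some v \<in> ?V" using v by simp
      fix p assume p: "p \<in> ?V" "p \<noteq> Some v"
      have "par' p \<in> ?V \<and> splitadj E v N1 p (par' p) \<and> lev' (par' p) < lev' p"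
      proof (cases p)
        case None
        then show ?thesis using v unfolding par'_def lev'_def splitadj_def by simp
      next
        case (Some w)
        then have w: "w \<in> V" "w \<noteq> v" using p by auto
        note h = pt[OF w]
        show ?thesis
        proof (cases "w \<in> N1")
          case True
          then have "lev v < lev w" using h parN1 by simp
          then show ?thesis using True Some unfolding par'_def lev'_def splitadj_def by simp
        next
          case False
          have "\<not> (par w = v \<and> w \<in> N1)" using False by blast
          then show ?thesis using False Some h w unfolding par'_def lev'_def splitadj_def by simp
        qed
      qed
      then show "par' p \<in> ?V" "{p, par' p} \<in> ?E" "lev' (par' p) < lev' p" using splitE_iff[of p "par' p"] by simp_all
    qed
    have fin': "finite ?V" using finV by simp
    obtain Z' L' R' x' y' where s': "sep ?V ?E (Some v) par' Z' L' R' x' y' \<and>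
      card ?V \<le> 4 * card (L' \<union> Z') + 1 \<and> card ?V \<le> 4 * card (R' \<union> Z') + 1"
      using brick_separator[OF fin' model' tree'] by (elim exE)
    have part: "Z' \<union> L' \<union> R' = ?V" "Z' \<inter> L' = {}" "Z' \<inter> R' = {}" "L' \<inter> R' = {}"
      and noe: "\<And>p q. p \<in> L' \<Longrightarrow> q \<in> R' \<Longrightarrow> \<not> splitadj E v N1 p q"
      and xy: "x' \<in> ?V" "y' \<in> ?V" and Zanc: "Z' \<subseteq> anc par' (Some v) x' \<union> anc par' (Some v) y'"
      and cL: "card ?V \<le> 4 * card (L' \<union> Z') + 1" and cR: "card ?V \<le> 4 * card (R' \<union> Z') + 1"
      using s' splitE_iff[of _ _ E v N1] unfolding sep_def by simp_all
    define Z where "Z = {w\<in>V. Some w \<in> Z' \<or> (w = v \<and> None \<in> Z')}"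
    define L where "L = {w\<in>V. Some w \<in> L'} - Z"
    define R where "R = {w\<in>V. Some w \<in> R'} - Z"
    have "Some w \<in> Z' \<union> L' \<union> R'" if "w \<in> V" for w using part(1) that by blast
    then have U: "Z \<union> L \<union> R = V" unfolding Z_def L_def R_def by blast
    have D: "Z \<inter> L = {}" "Z \<inter> R = {}" "L \<inter> R = {}" unfolding L_def R_def using part(4) by blast+
    have None_side: "None \<in> L' \<or> None \<in> R'" if "None \<notin> Z'" using part(1) that by blast
    have noedge: "{u, w} \<notin> E" if uw: "u \<in> L" "w \<in> R" for u w
    proof
      assume e: "{u, w} \<in> E"
      have s: "Some u \<in> L'" "Some w \<in> R'" "u \<in> V" "w \<in> V" "u \<notin> Z" "w \<notin> Z" using uw unfolding L_def R_def by blast+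
      \<comment> \<open>Only edges from \<open>v\<close> to \<open>N1\<close> are missing in the
        split graph. Such an edge between \<open>L\<close> and \<open>R\<close> would have
        \<open>v\<close> outside \<open>Z\<close>, so \<open>None\<close> lies on a side too,
        although it is adjacent to both sides.\<close>
      have "u = v \<and> w \<in> N1 \<or> w = v \<and> u \<in> N1" using noe[OF s(1,2)] e unfolding splitadj_def by auto
      then show False
      proof
        assume h: "u = v \<and> w \<in> N1"
        then have "None \<notin> Z'" using s(3,5) unfolding Z_def by blast
        moreover have "None \<notin> R'" using noe[OF s(1), of None] h unfolding splitadj_def by auto
        moreover have "None \<notin> L'" using noe[OF _ s(2), of None] h unfolding splitadj_def by auto
        ultimately show False using None_side by blast
      next
        assume h: "w = v \<and> u \<in> N1"
        then have "None \<notin> Z'" using s(4,6) unfolding Z_def by blast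
        moreover have "None \<notin> R'" using noe[OF s(1), of None] h unfolding splitadj_def by auto
        moreover have "None \<notin> L'" using noe[OF _ s(2), of None] h unfolding splitadj_def by auto
        ultimately show False using None_side by blast
      qed
    qed
    have anc_map: "unsplit v p \<in> anc par v (unsplit v q)" if "p \<in> anc par' (Some v) q" for p q
    proof -
      have "(q, p) \<in> {(w, par' w) | w. w \<noteq> Some v}\<^sup>*" using that unfolding anc_def by simp
      then show ?thesis
      proof (induction rule: rtrancl_induct)
        case (step a b)
        then have ab: "b = par' a" "a \<noteq> Some v" by auto
        have "unsplit v b = unsplit v a \<or> (unsplit v a \<noteq> v \<and> unsplit v b = par (unsplit v a))"
          using ab parN1 unfolding unsplit_def par'_def by (cases a) auto
        then show ?case
        proof
          assume h: "unsplit v a \<noteq> v \<and> unsplit v b = par (unsplit v a)"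
          then have "(unsplit v a, unsplit v b) \<in> {(w, par w) | w. w \<noteq> v}" by auto
          then show ?thesis using step.IH unfolding anc_def by (auto intro: rtrancl_into_rtrancl)
        qed (use step.IH in simp)
      qed simp
    qed
    have Zsub: "Z \<subseteq> anc par v (unsplit v x') \<union> anc par v (unsplit v y')"
    proof
      fix w assume "w \<in> Z"
      then obtain p where p: "p \<in> Z'" "unsplit v p = w" unfolding Z_def unsplit_def by force
      then have "p \<in> anc par' (Some v) x' \<or> p \<in> anc par' (Some v) y'" using Zanc by blast
      then show "w \<in> anc par v (unsplit v x') \<union> anc par v (unsplit v y')" using anc_map p(2) by blast
    qed
    have cV: "card ?V = card V + 1" using finV by (simp add: card_image)
    have cmp: "card (S' \<union> Z') \<le> card (S \<union> Z) + 1"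
      if "S = {w\<in>V. Some w \<in> S'} - Z" "S' \<subseteq> ?V" for S S'
    proof -
      have "Z' \<subseteq> ?V" using part(1) by blast
      then have "S' \<union> Z' \<subseteq> insert None (Some ` (S \<union> Z))" using that unfolding Z_def by auto
      moreover have fin: "finite (S \<union> Z)" using that(1) finV unfolding Z_def by simp
      ultimately have "card (S' \<union> Z') \<le> card (insert None (Some ` (S \<union> Z)))" by (intro card_mono) simp_all
      also have "\<dots> \<le> Suc (card (Some ` (S \<union> Z)))" by (rule card_insert_le_m1) simp_all
      also have "card (Some ` (S \<union> Z)) = card (S \<union> Z)" by (simp add: card_image)
      finally show ?thesis by simp
    qed
    have "L' \<subseteq> ?V" "R' \<subseteq> ?V" using part(1) by blast+
    note cmp[OF L_def this(1)] cmp[OF R_def this(2)]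
    then have cards: "card V \<le> 4 * card (L \<union> Z) + 4" "card V \<le> 4 * card (R \<union> Z) + 4"
      using cV cL cR by linarith+
    have pair: "N \<inter> L = {} \<or> N \<inter> R = {}" if sub: "N - N1 \<subseteq> Z"
    proof -
      obtain c3 c4 where c: "N - N1 = {c3, c4}" "c3 \<noteq> c4" using N1(2) by (meson card_2_iff)
      have cZ: "Some w \<in> Z' \<and> w \<noteq> v \<and> w \<notin> N1 \<and> par w = v" if "w \<in> {c3, c4}" for w
      proof -
        have w: "w \<in> N" "w \<notin> N1" "w \<in> Z" using that c(1) sub by blast+
        then have wv: "w \<noteq> v" using N(2) by blast
        have "Some w \<in> Z'" using w(3) wv unfolding Z_def by simp
        moreover have "par w = v" using parN w(1) by simp
        ultimately show ?thesis using wv w(2) by simp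
      qed
      \<comment> \<open>A root path contains at most one child of the root. The children
        \<open>c3\<close> and \<open>c4\<close> occupy both paths, which leaves none for the child
        \<open>None\<close>.\<close>
      have incomp: "\<not> (a \<in> anc par' (Some v) q \<and> b \<in> anc par' (Some v) q)"
        if ab: "a \<noteq> b" "a \<noteq> Some v" "b \<noteq> Some v" "par' a = Some v" "par' b = Some v" for a b q
      proof
        assume q: "a \<in> anc par' (Some v) q \<and> b \<in> anc par' (Some v) q"
        have "anc par' (Some v) a = {a, Some v}" "anc par' (Some v) b = {b, Some v}"
          unfolding anc_step[OF ab(2), of par'] anc_step[OF ab(3), of par'] ab(4,5) anc_root by simp_all
        then show False using anc_linear[OF q[THEN conjunct1] q[THEN conjunct2]] ab(1-3) by simp
      qed
      have p3: "Some c3 \<noteq> Some v" "par' (Some c3) = Some v" and p4: "Some c4 \<noteq> Some v" "par' (Some c4) = Some v"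
        using cZ[of c3] cZ[of c4] unfolding par'_def by simp_all
      have pN: "None \<noteq> Some v" "par' None = Some v" unfolding par'_def by simp_all
      have "None \<notin> Z'"
      proof
        assume "None \<in> Z'"
        then have m: "None \<in> anc par' (Some v) x' \<or> None \<in> anc par' (Some v) y'"
          "Some c3 \<in> anc par' (Some v) x' \<or> Some c3 \<in> anc par' (Some v) y'"
          "Some c4 \<in> anc par' (Some v) x' \<or> Some c4 \<in> anc par' (Some v) y'"
          using Zanc cZ[of c3] cZ[of c4] by blast+
        have i: "\<not> (None \<in> anc par' (Some v) q \<and> Some c3 \<in> anc par' (Some v) q)"
          "\<not> (None \<in> anc par' (Some v) q \<and> Some c4 \<in> anc par' (Some v) q)"
          "\<not> (Some c3 \<in> anc par' (Some v) q \<and> Some c4 \<in> anc par' (Some v) q)" for q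
          using incomp[of None "Some c3" q] incomp[of None "Some c4" q] incomp[of "Some c3" "Some c4" q] p3 p4 pN c(2)
          by simp_all
        show False using m i[of x'] i[of y'] by blast
      qed
      from None_side[OF this] show ?thesis
      proof
        assume "None \<in> L'"
        have "w \<notin> R" if w: "w \<in> N" for w
        proof (cases "w \<in> N1")
          case True
          then show ?thesis using noe[OF \<open>None \<in> L'\<close>, of "Some w"] unfolding R_def splitadj_def by auto
        next
          case False
          then show ?thesis using w sub unfolding R_def by blast
        qed
        then show ?thesis by blast
      next
        assume "None \<in> R'"
        have "w \<notin> L" if w: "w \<in> N" for w
        proof (cases "w \<in> N1")
          case True
          then show ?thesis using noe[OF _ \<open>None \<in> R'\<close>, of "Some w"] unfolding L_def splitadj_def by auto
        next
          case False
          then show ?thesis using w sub unfolding L_def by blast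
        qed
        then show ?thesis by blast
      qed
    qed
    have uV: "unsplit v x' \<in> V" "unsplit v y' \<in> V" using xy v unfolding unsplit_def by auto
    have "\<forall>u\<in>L. \<forall>w\<in>R. {u, w} \<notin> E" using noedge by blast
    then have "sep V E v par Z L R (unsplit v x') (unsplit v y')"
      unfolding sep_def using U D uV Zsub cards by (intro conjI)
    then show ?thesis using pair by blast
  qed
  then show ?thesis using N1 by (intro exI[of _ "N - N1"]) blast
qed

section \<open>Fire fighting strategies\<close>

lemma sn_ge:
  assumes "finite V" "valid_strategy k V E v S"
  shows "card (saved V E S v) \<le> sn k V E v"
  unfolding sn_def
proof (rule Max_ge)
  have "{card (saved V E S v) | S. valid_strategy k V E v S} \<subseteq> {..card V}"
    using card_mono[OF assms(1)] unfolding saved_def by blast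
  then show "finite {card (saved V E S v) | S. valid_strategy k V E v S}" by (rule finite_subset) simp
qed (use assms(2) in blast)

locale fire =
  fixes V :: "'a set" and E :: "'a set set" and v :: 'a
  assumes gr: "simple_graph V E" and v: "v \<in> V"
begin

definition adjR :: "('a \<times> 'a) set" where
  "adjR = {(a, b). {a, b} \<in> E}"

definition U :: "'a set" where
  "U = {u. \<exists>n. (v, u) \<in> adjR ^^ n}"

definition dst :: "'a \<Rightarrow> nat" where
  "dst u = (LEAST n. (v, u) \<in> adjR ^^ n)"

text \<open>The second vertices of the geodesics from \<open>v\<close> to \<open>u\<close>.\<close>

definition First :: "'a \<Rightarrow> 'a set" where
  "First u = {f. {v, f} \<in> E \<and> (f, u) \<in> adjR ^^ (dst u - 1)}"

definition N :: "'a set" where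
  "N = {w. {v, w} \<in> E}"

section \<open>Distances and geodesics from the source of the fire\<close>

lemma finV: "finite V"
  using gr unfolding simple_graph_def by blast

lemma edgeD:
  assumes "{a, b} \<in> E"
  shows "a \<in> V" "b \<in> V" "a \<noteq> b"
proof -
  obtain x y where "x \<in> V" "y \<in> V" "x \<noteq> y" "{a, b} = {x, y}" using gr assms unfolding simple_graph_def by metis
  then show "a \<in> V" "b \<in> V" "a \<noteq> b" by (auto simp: doubleton_eq_iff)
qed

lemma edge_sym: "{a, b} \<in> E \<longleftrightarrow> {b, a} \<in> E"
  by (simp add: insert_commute)

lemma dst_path: "u \<in> U \<Longrightarrow> (v, u) \<in> adjR ^^ dst u"
  unfolding U_def dst_def by (auto intro: LeastI)

lemma dst_le: "(v, u) \<in> adjR ^^ n \<Longrightarrow> u \<in> U \<and> dst u \<le> n"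
  unfolding U_def dst_def by (auto intro: Least_le)

lemma v_U: "v \<in> U" and dst_v: "dst v = 0"
  using dst_le[of v 0] by simp_all

lemma dst_0: "u \<in> U \<Longrightarrow> dst u = 0 \<Longrightarrow> u = v"
  using dst_path[of u] by simp

lemma dst_edge:
  assumes "u \<in> U" "{u, w} \<in> E"
  shows "w \<in> U" "dst w \<le> Suc (dst u)"
proof -
  have "(v, w) \<in> adjR ^^ Suc (dst u)"
    using dst_path[OF assms(1)] assms(2) by (auto simp: adjR_def)
  from dst_le[OF this] show "w \<in> U" "dst w \<le> Suc (dst u)" by simp_all
qed

lemma U_V: "U \<subseteq> V"
proof
  fix u assume u: "u \<in> U"
  show "u \<in> V"
  proof (cases "dst u")
    case 0
    then show ?thesis using dst_0[OF u] v by simp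
  next
    case (Suc n)
    then obtain w where "(w, u) \<in> adjR" using dst_path[OF u] by auto
    then show ?thesis using edgeD(2) unfolding adjR_def by blast
  qed
qed

lemma finU: "finite U"
  using U_V finV finite_subset by blast

lemma N_dst: "w \<in> N \<longleftrightarrow> w \<in> U \<and> dst w = 1"
proof
  assume "w \<in> N"
  then have e: "{v, w} \<in> E" unfolding N_def by simp
  have "w \<in> U" "dst w \<le> 1" using dst_edge[OF v_U e] dst_v by simp_all
  moreover have "dst w \<noteq> 0" using dst_0 calculation(1) edgeD(3)[OF e] by blast
  ultimately show "w \<in> U \<and> dst w = 1" by simp
next
  assume "w \<in> U \<and> dst w = 1"
  then have "(v, w) \<in> adjR ^^ 1" using dst_path[of w] by metis
  then show "w \<in> N" unfolding N_def adjR_def by simp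
qed

lemma First_N: "First u \<subseteq> N"
  unfolding First_def N_def by blast

lemma First_neighbour: "w \<in> N \<Longrightarrow> First w = {w}"
  using N_dst[of w] unfolding First_def N_def by auto

lemma First_step:
  assumes u: "u \<in> U" "dst u = Suc (Suc m)"
  shows "f \<in> First u \<longleftrightarrow> (\<exists>u'. u' \<in> U \<and> {u', u} \<in> E \<and> dst u' = Suc m \<and> f \<in> First u')"
proof
  assume "f \<in> First u"
  then have f: "{v, f} \<in> E" "(f, u) \<in> adjR ^^ Suc m" unfolding First_def u(2) by simp_all
  then obtain u' where u': "(f, u') \<in> adjR ^^ m" "(u', u) \<in> adjR" by auto
  have "(v, u') \<in> adjR ^^ Suc m" using f(1) u'(1) relpow_Suc_I2[of v f adjR u' m] unfolding adjR_def by blast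
  from dst_le[OF this] have 1: "u' \<in> U" "dst u' \<le> Suc m" by simp_all
  have e: "{u', u} \<in> E" using u'(2) unfolding adjR_def by simp
  have "dst u' = Suc m" using dst_edge(2)[OF 1(1) e] 1(2) u(2) by simp
  then show "\<exists>u'. u' \<in> U \<and> {u', u} \<in> E \<and> dst u' = Suc m \<and> f \<in> First u'"
    using 1 e f(1) u'(1) unfolding First_def by (intro exI[of _ u']) simp
next
  assume "\<exists>u'. u' \<in> U \<and> {u', u} \<in> E \<and> dst u' = Suc m \<and> f \<in> First u'"
  then obtain u' where u': "{u', u} \<in> E" "dst u' = Suc m" "{v, f} \<in> E" "(f, u') \<in> adjR ^^ m"
    unfolding First_def by auto
  then have "(f, u) \<in> adjR ^^ Suc m" by (auto simp: adjR_def)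
  then show "f \<in> First u" unfolding First_def u(2) using u'(3) by simp
qed

lemma prev_exists:
  assumes "u \<in> U" "u \<noteq> v"
  obtains u' where "u' \<in> U" "{u', u} \<in> E" "dst u = Suc (dst u')"
proof -
  obtain n where n: "dst u = Suc n" using dst_0 assms by (cases "dst u") auto
  then have "(v, u) \<in> adjR ^^ Suc n" using dst_path[OF assms(1)] by simp
  then obtain u' where u': "(v, u') \<in> adjR ^^ n" "(u', u) \<in> adjR" by auto
  have e: "{u', u} \<in> E" using u'(2) unfolding adjR_def by simp
  from dst_le[OF u'(1)] have 1: "u' \<in> U" "dst u' \<le> n" by simp_all
  then have "dst u' = n" using dst_edge(2)[OF 1(1) e] n by simp
  then show thesis using that 1 e n by simp
qed

lemma First_nonempty:
  assumes "u \<in> U" "u \<noteq> v"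
  shows "First u \<noteq> {}"
  using assms
proof (induction "dst u" arbitrary: u rule: less_induct)
  case less
  obtain u' where u': "u' \<in> U" "{u', u} \<in> E" "dst u = Suc (dst u')" using prev_exists less.prems by blast
  show ?case
  proof (cases "dst u'")
    case 0
    then have "u \<in> N" using N_dst less.prems u'(3) by simp
    then show ?thesis using First_neighbour by blast
  next
    case (Suc m)
    then have "u' \<noteq> v" using dst_v by auto
    then have "First u' \<noteq> {}" using less.hyps[of u'] u' by simp
    then obtain f where "f \<in> First u'" by blast
    then have "f \<in> First u" using First_step[of u m f] less.prems u' Suc by auto
    then show ?thesis by blast
  qed
qed

lemma burning_U: "u \<in> burning V E S v t \<Longrightarrow> u \<in> U \<and> dst u \<le> t"
proof (induction t arbitrary: u)
  case 0
  then show ?case using v_U dst_v by simp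
next
  case (Suc t)
  then consider "u \<in> burning V E S v t" | u' where "u' \<in> burning V E S v t" "{u', u} \<in> E" by auto
  then show ?case
  proof cases
    case 1
    then show ?thesis using Suc.IH by fastforce
  next
    case 2
    then have "u' \<in> U" "dst u' \<le> t" using Suc.IH by blast+
    then show ?thesis using dst_edge[OF _ 2(2)] by fastforce
  qed
qed

text \<open>A vertex that burns as early as its distance permits was reached along a geodesic, and
  the second vertex of this geodesic burned in step 1.\<close>

lemma burning_first:
  assumes "u \<in> burning V E S v (dst u)" "dst u \<ge> 1"
  shows "\<exists>f\<in>First u. f \<in> burning V E S v 1"
  using assms
proof (induction "dst u" arbitrary: u)
  case 0
  then show ?case by linarith
next
  case (Suc t)
  have uU: "u \<in> U" using burning_U Suc.prems(1) by blast
  have "u \<in> burning V E S v (Suc t)" using Suc.prems(1) Suc.hyps(2) by simp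
  moreover have "u \<notin> burning V E S v t" using burning_U[of u S t] Suc.hyps(2) by auto
  ultimately obtain u' where u': "u' \<in> burning V E S v t" "{u', u} \<in> E" by auto
  have 1: "u' \<in> U" "dst u' \<le> t" using burning_U[OF u'(1)] by simp_all
  have d: "dst u' = t" using dst_edge(2)[OF 1(1) u'(2)] 1(2) Suc.hyps(2) by simp
  show ?case
  proof (cases t)
    case 0
    then have "dst u = 1" using Suc.hyps(2) by simp
    then have "u \<in> N" using N_dst uU by simp
    then have "First u = {u}" by (rule First_neighbour)
    moreover have "u \<in> burning V E S v 1" using Suc.prems(1) \<open>dst u = 1\<close> by simp
    ultimately show ?thesis by simp
  next
    case t: (Suc m)
    have "\<exists>f\<in>First u'. f \<in> burning V E S v 1"
      by (rule Suc.hyps(1)) (use d u'(1) t in simp_all)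
    then obtain f where f: "f \<in> First u'" "f \<in> burning V E S v 1" by blast
    have "f \<in> First u" using First_step[OF uU, of m f] Suc.hyps(2) t 1 u' d f(1) by auto
    then show ?thesis using f(2) by blast
  qed
qed

text \<open>\<open>\<tau>\<close> assigns to each vertex of \<open>P\<close> the step at which it is protected. The second alternative
  in the timing condition allows a delay of one step for vertices all of whose geodesics
  from \<open>v\<close> are cut at the first step.\<close>

lemma timed_protection:
  assumes P: "P \<subseteq> M" and M: "M \<subseteq> V" "v \<notin> M"
    and lev: "\<And>t. card {p\<in>P. \<tau> p = t} \<le> k" and pos: "\<And>p. p \<in> P \<Longrightarrow> \<tau> p \<ge> (1::nat)"
    and bdry: "\<And>u w. u \<in> V - M \<Longrightarrow> w \<in> M \<Longrightarrow> {u, w} \<in> E \<Longrightarrow> w \<in> P"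
    and time: "\<And>p. p \<in> P \<Longrightarrow> \<tau> p \<le> dst p \<or> (\<tau> p = Suc (dst p) \<and> dst p \<ge> 1 \<and> (\<forall>f\<in>First p. f \<in> P \<and> \<tau> f = 1))"
  shows "card M \<le> sn k V E v"
proof -
  define S where "S t = {p\<in>P. \<tau> p = t}" for t
  have finP: "finite P" by (rule finite_subset[OF subset_trans[OF P M(1)] finV])
  have burnV: "burning V E S v t \<subseteq> V" for t
  proof
    fix u assume "u \<in> burning V E S v t"
    from burning_U[OF this] show "u \<in> V" using U_V by blast
  qed
  have inv: "burning V E S v t \<inter> M = {}" for t
  proof (induction t)
    case 0
    then show ?case using M(2) by simp
  next
    case (Suc t)
    show ?case
    proof (rule ccontr)
      assume "burning V E S v (Suc t) \<inter> M \<noteq> {}"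
      then obtain w where w: "w \<in> burning V E S v (Suc t)" "w \<in> M" by blast
      then have "w \<notin> burning V E S v t" using Suc.IH by blast
      then obtain u where u: "u \<in> burning V E S v t" "{u, w} \<in> E" and np: "w \<notin> (\<Union>i\<in>{1..Suc t}. S i)"
        using w(1) by auto
      have "u \<in> V - M" using u(1) Suc.IH burnV by blast
      then have wP: "w \<in> P" using bdry w(2) u(2) by blast
      have "\<not> \<tau> w \<le> Suc t"
      proof
        assume "\<tau> w \<le> Suc t"
        then have "\<tau> w \<in> {1..Suc t}" using pos[OF wP] by simp
        moreover have "w \<in> S (\<tau> w)" using wP unfolding S_def by simp
        ultimately show False using np by blast
      qed
      moreover have "dst w \<le> Suc t" using burning_U[OF w(1)] by simp
      ultimately have h: "\<tau> w = Suc (dst w)" "dst w = Suc t" "\<forall>f\<in>First w. f \<in> P \<and> \<tau> f = 1"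
        using time[OF wP] by auto
      \<comment> \<open>The late case: if \<open>w\<close> burned at time \<open>dst w\<close>, some
        vertex of \<open>First w\<close> would burn in step 1, when all of these are
        protected.\<close>
      obtain f where f: "f \<in> First w" "f \<in> burning V E S v 1" using burning_first[of w S] w(1) h(2) by auto
      have "f \<in> P" "\<tau> f = 1" using h(3) f(1) by blast+
      then have "f \<in> S 1" "f \<noteq> v" using P M(2) unfolding S_def by blast+
      then show False using f(2) by auto
    qed
  qed
  have "valid_strategy k V E v S"
    unfolding valid_strategy_def
  proof (intro allI conjI)
    fix t
    have "S (Suc t) \<subseteq> P" unfolding S_def by blast
    then show "S (Suc t) \<subseteq> V - burning V E S v t" using inv[of t] P M(1) by blast
    show "finite (S (Suc t))" unfolding S_def using finP by simp
    show "card (S (Suc t)) \<le> k" unfolding S_def by (rule lev)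
  qed
  from sn_ge[OF finV this] have "card (saved V E S v) \<le> sn k V E v" .
  moreover have "M \<subseteq> saved V E S v" unfolding saved_def using inv M(1) by blast
  then have "card M \<le> card (saved V E S v)"
    by (rule card_mono[rotated]) (use finV in \<open>simp add: saved_def\<close>)
  ultimately show ?thesis by simp
qed

end

lemma anc_trans: "a \<in> anc par r b \<Longrightarrow> b \<in> anc par r x \<Longrightarrow> a \<in> anc par r x"
  unfolding anc_def by (auto intro: rtrancl_trans)

lemma sep_swap:
  assumes "sep V E r par Z L R x y"
  shows "sep V E r par Z R L x y" "sep V E r par Z L R y x"
proof -
  have "\<forall>u\<in>R. \<forall>w\<in>L. {u, w} \<notin> E" using assms unfolding sep_def by (metis insert_commute)
  then show "sep V E r par Z R L x y" using assms unfolding sep_def by auto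
  show "sep V E r par Z L R y x" using assms unfolding sep_def by (simp add: Un_commute)
qed

section \<open>Breadth-first trees with priorities\<close>

context fire
begin

definition EU :: "'a set set" where
  "EU = {e\<in>E. e \<subseteq> U}"

text \<open>Ties in the breadth-first tree are broken in favour of neighbours of \<open>v\<close> of high priority \<open>pr\<close>, so the
  geodesics to a vertex in the branch of \<open>w\<close> start with neighbours of priority at most \<open>pr w\<close>.\<close>

definition toprank :: "('a \<Rightarrow> nat) \<Rightarrow> 'a \<Rightarrow> nat" where
  "toprank pr u = Max (pr ` First u)"

definition bpar :: "('a \<Rightarrow> nat) \<Rightarrow> 'a \<Rightarrow> 'a" where
  "bpar pr u = (if dst u = 1 then v else
     (SOME u'. u' \<in> U \<and> {u', u} \<in> E \<and> Suc (dst u') = dst u \<and> toprank pr u' = toprank pr u))"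

lemma finN: "finite N"
proof -
  have "N \<subseteq> V" using N_dst U_V by blast
  then show ?thesis using finV finite_subset by blast
qed

lemma finFirst: "finite (First u)"
  by (rule finite_subset[OF First_N finN])

text \<open>A geodesic starting with a neighbour of top priority passes through some predecessor of
  \<open>u\<close>, and no predecessor has first vertices that \<open>u\<close> lacks. So some
  predecessor has the same \<open>toprank\<close>.\<close>

lemma bpar:
  assumes u: "u \<in> U" "u \<noteq> v"
  shows "bpar pr u \<in> U" "{u, bpar pr u} \<in> E" "Suc (dst (bpar pr u)) = dst u"
    "bpar pr u \<noteq> v \<Longrightarrow> toprank pr (bpar pr u) = toprank pr u"
proof -
  have "bpar pr u \<in> U \<and> {u, bpar pr u} \<in> E \<and> Suc (dst (bpar pr u)) = dst u \<and>
    (bpar pr u \<noteq> v \<longrightarrow> toprank pr (bpar pr u) = toprank pr u)"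
  proof (cases "dst u = 1")
    case True
    then have "u \<in> N" using N_dst u(1) by blast
    then have "{u, v} \<in> E" unfolding N_def using edge_sym by blast
    moreover have "bpar pr u = v" using True unfolding bpar_def by simp
    ultimately show ?thesis using v_U dst_v True by simp
  next
    case False
    have "dst u \<noteq> 0" using dst_0 u by blast
    then obtain m where m: "dst u = Suc (Suc m)" using False by (metis One_nat_def not0_implies_Suc)
    have "Max (pr ` First u) \<in> pr ` First u"
      by (rule Max_in) (use finFirst First_nonempty[OF u] in simp_all)
    then obtain f where f: "f \<in> First u" "pr f = toprank pr u" unfolding toprank_def by force
    obtain u' where u': "u' \<in> U" "{u', u} \<in> E" "dst u' = Suc m" "f \<in> First u'"
      using First_step[OF u(1) m] f(1) by blast
    have sub: "First u' \<subseteq> First u" using First_step[OF u(1) m] u'(1-3) by blast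
    have "toprank pr u' = toprank pr u"
    proof (rule antisym)
      show "toprank pr u' \<le> toprank pr u" unfolding toprank_def
        by (rule Max_mono) (use sub u'(4) finFirst in auto)
      have "pr f \<le> toprank pr u'" unfolding toprank_def by (rule Max_ge) (use finFirst u'(4) in auto)
      then show "toprank pr u \<le> toprank pr u'" using f(2) by simp
    qed
    then have "\<exists>u'. u' \<in> U \<and> {u', u} \<in> E \<and> Suc (dst u') = dst u \<and> toprank pr u' = toprank pr u"
      using u'(1-3) m by (intro exI[of _ u']) simp
    from someI_ex[OF this] show ?thesis unfolding bpar_def using False edge_sym by simp
  qed
  then show "bpar pr u \<in> U" "{u, bpar pr u} \<in> E" "Suc (dst (bpar pr u)) = dst u"
    "bpar pr u \<noteq> v \<Longrightarrow> toprank pr (bpar pr u) = toprank pr u" by simp_all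
qed

lemma bfs_tree: "span_tree U EU v (bpar pr) dst"
  unfolding span_tree_def
proof (intro conjI ballI impI)
  fix w assume w: "w \<in> U" "w \<noteq> v"
  note b = bpar[OF w, of pr]
  show "bpar pr w \<in> U" by (rule b(1))
  show "{w, bpar pr w} \<in> EU" unfolding EU_def using b(1,2) w(1) by simp
  show "dst (bpar pr w) < dst w" using b(3) by linarith
qed (rule v_U)

lemma bpar_N: "w \<in> N \<Longrightarrow> bpar pr w = v"
  unfolding bpar_def using N_dst by simp

lemma anc_props:
  assumes "x \<in> U" "z \<in> anc (bpar pr) v x"
  shows "z \<in> U \<and> dst z \<le> dst x \<and> (z \<noteq> v \<longrightarrow> toprank pr z = toprank pr x) \<and> (dst z = dst x \<longrightarrow> z = x)"
  using assms
proof (induction "dst x" arbitrary: x rule: less_induct)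
  case less
  show ?case
  proof (cases "x = v")
    case True
    then have "z = v" using less.prems(2) by simp
    then show ?thesis using True v_U by simp
  next
    case False
    note b = bpar[OF less.prems(1) False, of pr]
    have "z = x \<or> z \<in> anc (bpar pr) v (bpar pr x)" using less.prems(2) anc_step[OF False, of "bpar pr"] by blast
    then show ?thesis
    proof
      assume z: "z \<in> anc (bpar pr) v (bpar pr x)"
      have "dst (bpar pr x) < dst x" using b(3) by linarith
      from less.hyps[OF this b(1) z] have h: "z \<in> U" "dst z \<le> dst (bpar pr x)" "z \<noteq> v \<longrightarrow> toprank pr z = toprank pr (bpar pr x)"
        by blast+
      have "toprank pr z = toprank pr x" if zv: "z \<noteq> v"
      proof -
        have "bpar pr x \<noteq> v"
        proof
          assume "bpar pr x = v"
          then show False using z zv by simp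
        qed
        then show ?thesis using b(4) h(3) zv by simp
      qed
      moreover have "dst z < dst x" using h(2) b(3) by linarith
      ultimately show ?thesis using h(1) by simp
    qed (use less.prems in simp)
  qed
qed

lemma anc_level:
  assumes x: "x \<in> U" and z: "z \<in> anc (bpar pr) v x" "z' \<in> anc (bpar pr) v x" "dst z = dst z'"
  shows "z = z'"
proof -
  have "z \<in> U" "z' \<in> U" using anc_props[OF x] z by blast+
  then show ?thesis using anc_linear[OF z(1,2)] anc_props z(3) by metis
qed

lemma anc_level_card:
  assumes x: "x \<in> U"
  shows "finite {z\<in>anc (bpar pr) v x. dst z = t}" "card {z\<in>anc (bpar pr) v x. dst z = t} \<le> 1"
proof -
  have "\<exists>p. {z\<in>anc (bpar pr) v x. dst z = t} \<subseteq> {p}" using anc_level[OF x] by blast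
  then obtain p where p: "{z\<in>anc (bpar pr) v x. dst z = t} \<subseteq> {p}" by blast
  show "finite {z\<in>anc (bpar pr) v x. dst z = t}" by (rule finite_subset[OF p]) simp
  have "card {z\<in>anc (bpar pr) v x. dst z = t} \<le> card {p}" by (rule card_mono[OF _ p]) simp
  then show "card {z\<in>anc (bpar pr) v x. dst z = t} \<le> 1" by simp
qed

text \<open>The levels \<open>s\<close> and \<open>t\<close> may differ, since one of the paths may
  be protected a step later than the other.\<close>

lemma anc_two:
  assumes "x \<in> U" "y \<in> U" "Q \<subseteq> {z\<in>anc (bpar pr) v x. dst z = s} \<union> {z\<in>anc (bpar pr) v y. dst z = t}"
  shows "card Q \<le> 2"
proof -
  let ?A = "{z\<in>anc (bpar pr) v x. dst z = s}" and ?B = "{z\<in>anc (bpar pr) v y. dst z = t}"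
  have "card Q \<le> card (?A \<union> ?B)"
    by (rule card_mono[OF _ assms(3)]) (use anc_level_card assms in blast)
  also have "\<dots> \<le> card ?A + card ?B" by (rule card_Un_le)
  also have "\<dots> \<le> 1 + 1" by (intro add_mono anc_level_card assms(1,2))
  finally show ?thesis by simp
qed

text \<open>\<open>toprank\<close> is constant along a tree path apart from \<open>v\<close>, and at
  the neighbour \<open>w\<close> it is \<open>pr w\<close>.\<close>

lemma branch_first:
  assumes x: "x \<in> U" and z: "z \<in> anc (bpar pr) v x" "z \<noteq> v" and w: "w \<in> anc (bpar pr) v x" "w \<in> N"
    and f: "f \<in> First z"
  shows "pr f \<le> pr w"
proof -
  have "w \<noteq> v" using w(2) N_dst dst_v by auto
  then have "toprank pr z = toprank pr w" using anc_props[OF x z(1)] anc_props[OF x w(1)] z(2) by simp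
  moreover have "toprank pr w = pr w" unfolding toprank_def First_neighbour[OF w(2)] by simp
  moreover have "pr f \<le> toprank pr z" unfolding toprank_def by (rule Max_ge) (use finFirst f in auto)
  ultimately show ?thesis by simp
qed

lemma anc_child:
  assumes x: "x \<in> U" and q: "q \<in> anc (bpar pr) v x" "dst q = 2" and w: "w \<in> anc (bpar pr) v x" "w \<in> N"
  shows "{w, q} \<in> E"
proof -
  have qU: "q \<in> U" using anc_props[OF x q(1)] by blast
  have qv: "q \<noteq> v" using q(2) dst_v by auto
  note b = bpar[OF qU qv, of pr]
  have "bpar pr q \<in> anc (bpar pr) v q" using anc_step[OF qv, of "bpar pr"] by simp
  then have "bpar pr q \<in> anc (bpar pr) v x" using anc_trans q(1) by metis
  moreover have "dst (bpar pr q) = dst w" using b(3) q(2) w(2) N_dst by simp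
  ultimately have "bpar pr q = w" using anc_level[OF x] w(1) by blast
  then show ?thesis using b(2) edge_sym by simp
qed

text \<open>The constant 12 is the slack 4 of \<open>sep\<close> plus 4 for each of the at most two
  vertices given up. Vertices that the fire cannot reach are saved anyway.\<close>

lemma count_saved:
  assumes s: "card U \<le> 4 * card AZ + 4" and AZ: "AZ \<subseteq> U" and X: "card X \<le> 2" "finite X"
  shows "card V \<le> 4 * card (AZ - X \<union> (V - U)) + 12"
proof -
  have fin: "finite AZ" using AZ finU finite_subset by blast
  have "card (AZ - X \<union> (V - U)) = card (AZ - X) + card (V - U)"
    by (rule card_Un_disjoint) (use fin finV AZ in auto)
  moreover have "card AZ - card X \<le> card (AZ - X)" by (rule diff_card_le_card_Diff[OF X(2)])
  moreover have "card (V - U) = card V - card U" by (rule card_Diff_subset[OF finU U_V])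
  moreover have "card U \<le> card V" by (rule card_mono[OF finV U_V])
  ultimately show ?thesis using s X(1) by linarith
qed

section \<open>Strategies obtained from separators\<close>

lemma sepD:
  assumes "sep U EU v (bpar pr) Z A C x y"
  shows "Z \<union> A \<union> C = U" "Z \<inter> A = {}" "\<And>u w. u \<in> C \<Longrightarrow> w \<in> A \<Longrightarrow> {u, w} \<notin> E" "x \<in> U" "y \<in> U"
    "Z \<subseteq> anc (bpar pr) v x \<union> anc (bpar pr) v y" "card U \<le> 4 * card (A \<union> Z) + 4"
proof -
  have p: "Z \<union> A \<union> C = U" "\<forall>u\<in>A. \<forall>w\<in>C. {u, w} \<notin> EU" using assms unfolding sep_def by simp_all
  show "{u, w} \<notin> E" if "u \<in> C" "w \<in> A" for u w
  proof
    assume "{u, w} \<in> E"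
    then have "{w, u} \<in> E" using edge_sym by blast
    then have "{w, u} \<in> EU" unfolding EU_def using that p(1) by blast
    then show False using p(2) that by blast
  qed
qed (use assms in \<open>simp_all add: sep_def\<close>)

text \<open>Each path asks for at most one vertex per step if vertices are protected at the time
  given by their distance. As \<open>C\<close> has no edges to \<open>A\<close>, the fire could
  otherwise enter \<open>A\<close> only from \<open>v\<close>, so the neighbours of \<open>v\<close>
  in \<open>A\<close> are added in step 1.\<close>

lemma simple_strategy:
  assumes s: "sep U EU v (bpar pr) Z A C x y" and few: "card (N \<inter> Z) + card (N \<inter> A) \<le> 2"
  shows "card V \<le> 4 * sn 2 V E v + 12"
proof -
  note d = sepD[OF s]
  define P where "P = (Z - {v}) \<union> (N \<inter> A)"
  define M where "M = (A \<union> Z) - {v} \<union> (V - U)"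
  have vN: "v \<notin> N" using N_dst dst_v by auto
  have "card M \<le> sn 2 V E v"
  proof (rule timed_protection[of P _ dst])
    show "P \<subseteq> M" unfolding P_def M_def using vN by blast
    show "M \<subseteq> V" unfolding M_def using d(1) U_V by blast
    show "v \<notin> M" unfolding M_def using v_U by blast
  next
    fix t
    show "card {p\<in>P. dst p = t} \<le> 2"
    proof (cases "t = 1")
      case True
      have "{p\<in>P. dst p = t} \<subseteq> (N \<inter> Z) \<union> (N \<inter> A)" unfolding P_def True using N_dst d(1) by blast
      then have "card {p\<in>P. dst p = t} \<le> card ((N \<inter> Z) \<union> (N \<inter> A))" by (rule card_mono[rotated]) (use finN in simp)
      also have "\<dots> \<le> card (N \<inter> Z) + card (N \<inter> A)" by (rule card_Un_le)
      finally show ?thesis using few by simp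
    next
      case False
      have "{p\<in>P. dst p = t} \<subseteq> {z\<in>anc (bpar pr) v x. dst z = t} \<union> {z\<in>anc (bpar pr) v y. dst z = t}"
        unfolding P_def using False N_dst d(6) by blast
      then show ?thesis by (rule anc_two[OF d(4,5)])
    qed
  next
    fix p assume p: "p \<in> P"
    then have "p \<noteq> v" "p \<in> U" unfolding P_def using vN d(1) by blast+
    then show "dst p \<ge> 1" using dst_0[of p] by (cases "dst p") auto
  next
    fix u w assume u: "u \<in> V - M" and w: "w \<in> M" and e: "{u, w} \<in> E"
    have uU: "u \<in> U" using u unfolding M_def by blast
    then have "w \<in> U" using dst_edge(1) e by blast
    then have w': "w \<in> A \<union> Z" "w \<noteq> v" using w unfolding M_def by blast+
    show "w \<in> P"
    proof (cases "w \<in> Z")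
      case True
      then show ?thesis unfolding P_def using w'(2) by blast
    next
      case False
      then have wA: "w \<in> A" using w' by blast
      then have "u \<notin> C" using d(3) e by blast
      then have "u = v" using u uU d(1) unfolding M_def by blast
      then have "w \<in> N" using e unfolding N_def by simp
      then show ?thesis unfolding P_def using wA by blast
    qed
  qed simp
  moreover have "card V \<le> 4 * card M + 12" unfolding M_def
    by (rule count_saved[OF d(7)]) (use d(1) in auto)
  ultimately show ?thesis by linarith
qed

text \<open>Step 1 can serve only two of \<open>wi\<close>, \<open>wj\<close>, \<open>wk\<close>, so
  \<open>wj\<close> burns and its neighbours in \<open>A\<close> need protection. Either that adds
  nothing to \<open>wk\<close>, or the path to \<open>x\<close> beyond \<open>wi\<close> is
  protected one step late; then step 2 is free for the vertex of the other path at distance 2 and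
  the neighbours of \<open>wj\<close> in \<open>A\<close>.\<close>

lemma split_strategy:
  assumes s: "sep U EU v (bpar pr) Z A C x y"
    and NZ: "N \<inter> Z = {wi, wj}" "wi \<noteq> wj" and NA: "N \<inter> A = {wk}"
    and wi: "wi \<in> anc (bpar pr) v x" and wj: "wj \<in> anc (bpar pr) v y"
    and del: "{u. {wj, u} \<in> E} \<inter> A \<subseteq> {wk} \<or>
      ((\<forall>z\<in>anc (bpar pr) v x. z \<noteq> v \<longrightarrow> First z \<subseteq> {wi, wk}) \<and>
       card {q\<in>Z \<inter> anc (bpar pr) v y. dst q = 2} + card ({u. {wj, u} \<in> E} \<inter> A) \<le> 2)"
  shows "card V \<le> 4 * sn 2 V E v + 12"
proof -
  note d = sepD[OF s]
  let ?D = "{u. {wj, u} \<in> E}"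
  define P where "P = (Z - {v, wj}) \<union> ({wk} \<union> (?D \<inter> A - {v}))"
  define M where "M = (A \<union> Z) - {v, wj} \<union> (V - U)"
  have vN: "v \<notin> N" using N_dst dst_v by auto
  have wN: "wi \<in> N" "wj \<in> N" "wk \<in> N" "wi \<in> Z" "wj \<in> Z" "wk \<in> A" using NZ NA by blast+
  have d1: "dst wi = 1" "dst wj = 1" "dst wk = 1" "wj \<in> U" using wN N_dst by blast+
  have wjA: "wj \<notin> A" using wN(5) d(2) by blast
  have PU: "P \<subseteq> U" unfolding P_def using d(1) wN(6) by blast
  have PM: "P \<subseteq> M" unfolding P_def M_def using wN(3,6) wjA vN by blast
  have MV: "M \<subseteq> V" unfolding M_def using d(1) U_V by blast
  have vM: "v \<notin> M" unfolding M_def using v_U by blast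
  have bdry: "w \<in> P" if u: "u \<in> V - M" and w: "w \<in> M" and e: "{u, w} \<in> E" for u w
  proof -
    have uU: "u \<in> U" using u unfolding M_def by blast
    then have "w \<in> U" using dst_edge(1) e by blast
    then have w': "w \<in> A \<union> Z" "w \<noteq> v" "w \<noteq> wj" using w unfolding M_def by blast+
    show "w \<in> P"
    proof (cases "w \<in> Z")
      case True
      then show ?thesis unfolding P_def using w'(2,3) by blast
    next
      case False
      then have wA: "w \<in> A" using w' by blast
      then have "u \<notin> C" using d(3) e by blast
      then have "u = v \<or> u = wj" using u uU d(1) unfolding M_def by blast
      then show ?thesis
      proof
        assume "u = v"
        then have "w \<in> N" using e unfolding N_def by simp
        then show ?thesis unfolding P_def using wA NA by blast
      next
        assume "u = wj"
        then show ?thesis unfolding P_def using wA e w'(2) by blast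
      qed
    qed
  qed
  have P1: "dst p \<ge> 1" if "p \<in> P" for p
  proof -
    have "p \<noteq> v" "p \<in> U" using that vM PM PU by blast+
    then show ?thesis using dst_0[of p] by (cases "dst p") auto
  qed
  have lev1: "p \<in> {wi, wk}" if "p \<in> P" "dst p = 1" for p
  proof -
    have "p \<in> N" using that PU N_dst by blast
    then have "p \<in> N \<inter> Z - {wj} \<or> p \<in> N \<inter> A" using that(1) wN(3,6) unfolding P_def by blast
    then show ?thesis using NZ(1) NA by blast
  qed
  have "card M \<le> sn 2 V E v"
  proof (cases "?D \<inter> A \<subseteq> {wk}")
    case True
    show ?thesis
    proof (rule timed_protection[OF PM MV vM _ P1 bdry])
      fix t
      show "card {p\<in>P. dst p = t} \<le> 2"
      proof (cases "t = 1")
        case t: True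
        have "{p\<in>P. dst p = t} \<subseteq> {wi, wk}" using lev1 t by blast
        then have "card {p\<in>P. dst p = t} \<le> card {wi, wk}" by (rule card_mono[rotated]) simp
        then show ?thesis using card_insert_le_m1[of 2 "{wk}" wi] by simp
      next
        case False
        have "{p\<in>P. dst p = t} \<subseteq> {z\<in>anc (bpar pr) v x. dst z = t} \<union> {z\<in>anc (bpar pr) v y. dst z = t}"
        proof
          fix p assume p: "p \<in> {p\<in>P. dst p = t}"
          then have "p \<noteq> wk" using d1(3) False by blast
          then have "p \<in> Z" using p True unfolding P_def by blast
          then show "p \<in> {z\<in>anc (bpar pr) v x. dst z = t} \<union> {z\<in>anc (bpar pr) v y. dst z = t}" using d(6) p by blast
        qed
        then show ?thesis by (rule anc_two[OF d(4,5)])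
      qed
    qed simp_all
  next
    case False
    then have fi: "\<And>z. z \<in> anc (bpar pr) v x \<Longrightarrow> z \<noteq> v \<Longrightarrow> First z \<subseteq> {wi, wk}"
      and q2: "card {q\<in>Z \<inter> anc (bpar pr) v y. dst q = 2} + card (?D \<inter> A) \<le> 2" using del by blast+
    define late where "late = {p\<in>Z \<inter> anc (bpar pr) v x. p \<noteq> wi}"
    define \<tau> where "\<tau> p = (if p \<in> late then Suc (dst p) else dst p)" for p
    have late2: "dst p \<noteq> 1" if "p \<in> late" for p
    proof
      assume dp: "dst p = 1"
      have pa: "p \<in> anc (bpar pr) v x" "p \<noteq> wi" using that unfolding late_def by blast+
      have "p = wi" by (rule anc_level[OF d(4) pa(1) wi]) (use dp d1(1) in simp)
      then show False using pa(2) by blast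
    qed
    have DA2: "dst p \<le> 2" if "p \<in> ?D" for p using dst_edge(2)[OF d1(4)] that d1(2) by force
    have kinds: "p = wk \<or> (p \<in> ?D \<inter> A \<and> p \<notin> late) \<or> p \<in> late \<or> p = wi \<or> (p \<in> Z \<inter> anc (bpar pr) v y \<and> p \<notin> late)"
      if "p \<in> P" for p
      using that d(2,6) unfolding P_def late_def by blast
    show ?thesis
    proof (rule timed_protection[OF PM MV vM _ _ bdry])
      fix t
      show "card {p\<in>P. \<tau> p = t} \<le> 2"
      proof -
        consider "t = 0" | "t = 1" | "t = 2" | "t \<ge> 3" by linarith
        then show ?thesis
        proof cases
          case 1
          have "\<tau> p \<noteq> t" if "p \<in> P" for p using P1[OF that] 1 unfolding \<tau>_def by simp
          then have "{p\<in>P. \<tau> p = t} = {}" by blast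
          then show ?thesis by (simp only: card.empty)
        next
          case 2
          have "{p\<in>P. \<tau> p = t} \<subseteq> {wi, wk}"
          proof
            fix p assume p: "p \<in> {p\<in>P. \<tau> p = t}"
            then have "dst p = 1" using P1[of p] 2 unfolding \<tau>_def by (auto split: if_splits)
            then show "p \<in> {wi, wk}" using lev1 p by blast
          qed
          then have "card {p\<in>P. \<tau> p = t} \<le> card {wi, wk}" by (rule card_mono[rotated]) simp
          then show ?thesis using card_insert_le_m1[of 2 "{wk}" wi] by simp
        next
          case 3
          let ?Q = "{q\<in>Z \<inter> anc (bpar pr) v y. dst q = 2}"
          have "{p\<in>P. \<tau> p = t} \<subseteq> ?Q \<union> (?D \<inter> A)"
          proof
            fix p assume p: "p \<in> {p\<in>P. \<tau> p = t}"
            have nl: "p \<notin> late"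
            proof
              assume l: "p \<in> late"
              then have "dst p = 1" using p 3 unfolding \<tau>_def by simp
              then show False using late2[OF l] by simp
            qed
            then have d2: "dst p = 2" using p 3 unfolding \<tau>_def by simp
            then have "p \<noteq> wk" "p \<noteq> wi" using d1 by auto
            then show "p \<in> ?Q \<union> (?D \<inter> A)" using kinds[of p] p nl d2 by blast
          qed
          moreover have "finite ?Q" by (rule finite_subset[OF _ anc_level_card(1)[OF d(5), of pr 2]]) blast
          moreover have "finite (?D \<inter> A)" by (rule finite_subset[OF _ finU]) (use d(1) in blast)
          ultimately have "card {p\<in>P. \<tau> p = t} \<le> card (?Q \<union> (?D \<inter> A))" by (intro card_mono) simp_all
          also have "\<dots> \<le> card ?Q + card (?D \<inter> A)" by (rule card_Un_le)
          finally show ?thesis using q2 by linarith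
        next
          case 4
          \<comment> \<open>From step 3 on, each step serves one vertex of the late path at distance
            \<open>t - 1\<close> and one of the punctual path at distance \<open>t\<close>.\<close>
          have "{p\<in>P. \<tau> p = t} \<subseteq> {z\<in>anc (bpar pr) v x. dst z = t - 1} \<union> {z\<in>anc (bpar pr) v y. dst z = t}"
          proof
            fix p assume p: "p \<in> {p\<in>P. \<tau> p = t}"
            show "p \<in> {z\<in>anc (bpar pr) v x. dst z = t - 1} \<union> {z\<in>anc (bpar pr) v y. dst z = t}"
            proof (cases "p \<in> late")
              case True
              then have "dst p = t - 1" using p unfolding \<tau>_def by auto
              then show ?thesis using True unfolding late_def by blast
            next
              case nl: False
              then have dt: "dst p = t" using p unfolding \<tau>_def by simp
              then have "p \<noteq> wk" "p \<noteq> wi" using d1 4 by auto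
              moreover have "p \<notin> ?D" using DA2[of p] dt 4 by linarith
              ultimately show ?thesis using kinds[of p] p nl dt by blast
            qed
          qed
          then show ?thesis by (rule anc_two[OF d(4,5)])
        qed
      qed
    next
      fix p assume p: "p \<in> P"
      then show "1 \<le> \<tau> p" using P1[OF p] unfolding \<tau>_def by simp
      show "\<tau> p \<le> dst p \<or> (\<tau> p = Suc (dst p) \<and> dst p \<ge> 1 \<and> (\<forall>f\<in>First p. f \<in> P \<and> \<tau> f = 1))"
      proof (cases "p \<in> late")
        case True
        have "p \<noteq> v" using p PM vM by blast
        then have "First p \<subseteq> {wi, wk}" using fi True unfolding late_def by blast
        moreover have "wi \<in> P" "wk \<in> P" unfolding P_def using wN(1,4) NZ(2) vN by blast+
        moreover have "wi \<notin> late" "wk \<notin> late" unfolding late_def using wN(6) d(2) by blast+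
        then have "\<tau> wi = 1" "\<tau> wk = 1" unfolding \<tau>_def using d1 by simp_all
        ultimately have "\<forall>f\<in>First p. f \<in> P \<and> \<tau> f = 1" by blast
        then show ?thesis using True P1[OF p] unfolding \<tau>_def by simp
      next
        case False
        then show ?thesis unfolding \<tau>_def by simp
      qed
    qed simp_all
  qed
  moreover have "card V \<le> 4 * card M + 12" unfolding M_def
    by (rule count_saved[OF d(7)]) (use d(1) NZ in \<open>auto simp: card_insert_if\<close>)
  ultimately show ?thesis by linarith
qed


text \<open>The at most four neighbours of \<open>wj\<close> include \<open>v\<close> and, in
  disjoint sets, \<open>Q\<close> and those in \<open>L\<close> and in \<open>R\<close>. Geodesics
  to the path of \<open>wi\<close> start at \<open>wi\<close> or at a neighbour of lower priority.
  If there is no such neighbour, one of the sides leaves enough room for the delay. If there is one,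
  the delay is safe on its side; should this side be too crowded, \<open>wj\<close> has no
  neighbours on the other one, which then needs no delay.\<close>

lemma split_separator_saves_many:
  assumes s: "sep U EU v (bpar pr) Z L R x y" and vZ: "v \<in> Z"
    and NZ: "N \<inter> Z = {wi, wj}" "wi \<noteq> wj"
    and wi: "wi \<in> anc (bpar pr) v x" and wj: "wj \<in> anc (bpar pr) v y"
    and pr: "pr wi < pr wj" "inj_on pr N" and L: "N \<inter> L = {l}" and R: "N \<inter> R = {r}"
    and deg: "card {u. {wj, u} \<in> E} \<le> 4" and low: "card {f\<in>N. pr f < pr wi} \<le> 1"
  shows "card V \<le> 4 * sn 2 V E v + 12"
proof -
  let ?D = "{u. {wj, u} \<in> E}"
  define Q where "Q = {q\<in>Z \<inter> anc (bpar pr) v y. dst q = 2}"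
  note d = sepD[OF s]
  have LR: "Z \<inter> L = {}" "Z \<inter> R = {}" "L \<inter> R = {}" "Z \<union> L \<union> R = U" using s unfolding sep_def by blast+
  have wN: "wi \<in> N" "wj \<in> N" using NZ by blast+
  have finD: "finite ?D" by (rule finite_subset[OF _ finV]) (use edgeD in blast)
  have QD: "Q \<subseteq> ?D" unfolding Q_def using anc_child[OF d(5) _ _ wj wN(2)] by blast
  have finQ: "finite Q" using QD finD finite_subset by blast
  have vD: "v \<in> ?D" using wN(2) edge_sym unfolding N_def by blast
  have vQ: "v \<notin> Q" unfolding Q_def using dst_v by simp
  have QZ: "Q \<subseteq> Z" unfolding Q_def by blast
  have Q1: "card Q \<le> 1"
  proof -
    have "card Q \<le> card {z\<in>anc (bpar pr) v y. dst z = 2}"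
      by (rule card_mono[OF anc_level_card(1)[OF d(5)]]) (auto simp: Q_def)
    then show ?thesis using anc_level_card(2)[OF d(5), of pr 2] by simp
  qed
  have count: "1 + card Q + card (?D \<inter> L) + card (?D \<inter> R) \<le> 4"
  proof -
    have "insert v Q \<union> (?D \<inter> L) \<union> (?D \<inter> R) \<subseteq> ?D" using QD vD by blast
    then have "card (insert v Q \<union> (?D \<inter> L) \<union> (?D \<inter> R)) \<le> card ?D" by (rule card_mono[OF finD])
    moreover have "card (insert v Q \<union> (?D \<inter> L) \<union> (?D \<inter> R)) = card (insert v Q \<union> (?D \<inter> L)) + card (?D \<inter> R)"
      by (rule card_Un_disjoint) (use finQ finD QZ vZ LR in auto)
    moreover have "card (insert v Q \<union> (?D \<inter> L)) = card (insert v Q) + card (?D \<inter> L)"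
      by (rule card_Un_disjoint) (use finQ finD QZ vZ LR in auto)
    moreover have "card (insert v Q) = 1 + card Q" using finQ vQ by simp
    ultimately show ?thesis using deg by linarith
  qed
  have firsts: "First z \<subseteq> insert wi {f\<in>N. pr f < pr wi}" if "z \<in> anc (bpar pr) v x" "z \<noteq> v" for z
  proof
    fix f assume f: "f \<in> First z"
    have "pr f \<le> pr wi" by (rule branch_first[OF d(4) that wi wN(1) f])
    moreover have fN: "f \<in> N" using f First_N by blast
    moreover have "f = wi" if "pr f = pr wi" using pr(2) fN wN(1) that unfolding inj_on_def by blast
    ultimately show "f \<in> insert wi {f\<in>N. pr f < pr wi}" by (cases "pr f = pr wi") auto
  qed
  have delayed: "card V \<le> 4 * sn 2 V E v + 12"
    if s': "sep U EU v (bpar pr) Z A C x y" and A: "N \<inter> A = {a}"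
      and F: "{f\<in>N. pr f < pr wi} \<subseteq> {a}" and c: "card Q + card (?D \<inter> A) \<le> 2" for A C a
  proof (rule split_strategy[OF s' NZ A wi wj], rule disjI2, intro conjI ballI impI)
    fix z assume "z \<in> anc (bpar pr) v x" "z \<noteq> v"
    from firsts[OF this] show "First z \<subseteq> {wi, a}" using F by blast
  qed (use c in \<open>simp add: Q_def\<close>)
  have direct: "card V \<le> 4 * sn 2 V E v + 12"
    if s': "sep U EU v (bpar pr) Z A C x y" and A: "N \<inter> A = {a}" and c: "card (?D \<inter> A) = 0" for A C a
  proof (rule split_strategy[OF s' NZ A wi wj], rule disjI1)
    have "?D \<inter> A = {}" using c finD by simp
    then show "?D \<inter> A \<subseteq> {a}" by blast
  qed
  note s2 = sep_swap(1)[OF s]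
  show ?thesis
  proof (cases "{f\<in>N. pr f < pr wi} = {}")
    case True
    have "card Q + card (?D \<inter> L) \<le> 2 \<or> card Q + card (?D \<inter> R) \<le> 2" using count Q1 by linarith
    then show ?thesis
    proof
      assume "card Q + card (?D \<inter> L) \<le> 2"
      then show ?thesis using delayed[OF s L] True by simp
    next
      assume "card Q + card (?D \<inter> R) \<le> 2"
      then show ?thesis using delayed[OF s2 R] True by simp
    qed
  next
    case False
    then obtain f where f: "f \<in> N" "pr f < pr wi" by blast
    have F: "{f\<in>N. pr f < pr wi} \<subseteq> {f}"
    proof
      fix g assume g: "g \<in> {f\<in>N. pr f < pr wi}"
      show "g \<in> {f}"
      proof (rule ccontr)
        assume "g \<notin> {f}"
        then have "card {f, g} = 2" by auto
        moreover have "card {f, g} \<le> card {f\<in>N. pr f < pr wi}" by (rule card_mono) (use f g finN in auto)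
        ultimately show False using low by simp
      qed
    qed
    have "f \<notin> Z"
    proof
      assume "f \<in> Z"
      then have "f = wi \<or> f = wj" using NZ(1) f(1) by blast
      then show False using f(2) pr(1) by auto
    qed
    moreover have "f \<in> U" using f(1) N_dst by blast
    ultimately have "f = l \<or> f = r" using LR(4) L R f(1) by blast
    then show ?thesis
    proof
      assume "f = l"
      then show ?thesis
        using delayed[OF s L] direct[OF s2 R] F count by (cases "card Q + card (?D \<inter> L) \<le> 2") auto
    next
      assume "f = r"
      then show ?thesis
        using delayed[OF s2 R] direct[OF s L] F count by (cases "card Q + card (?D \<inter> R) \<le> 2") auto
    qed
  qed
qed

lemma separator_saves_many:
  assumes s: "sep U EU v (bpar pr) Z L R x y"
    and cN: "card N \<le> 3 \<or> (card N = 4 \<and> inj_on pr N \<and> (\<forall>w\<in>N. card {u. {w, u} \<in> E} \<le> 4) \<and>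
      (\<forall>wi wj. N \<inter> Z = {wi, wj} \<longrightarrow> wi \<noteq> wj \<longrightarrow> pr wi < pr wj \<longrightarrow> N \<inter> L \<noteq> {} \<longrightarrow> N \<inter> R \<noteq> {} \<longrightarrow>
        card {f\<in>N. pr f < pr wi} \<le> 1))"
  shows "card V \<le> 4 * sn 2 V E v + 12"
proof -
  note d = sepD[OF s]
  note s2 = sep_swap(1)[OF s]
  note d2 = sepD[OF s2]
  have LR: "Z \<inter> L = {}" "Z \<inter> R = {}" "L \<inter> R = {}" using s unfolding sep_def by blast+
  have NU: "N \<subseteq> U" using N_dst by blast
  have onex: "w = w'" if "w \<in> N" "w' \<in> N" "w \<in> anc (bpar pr) v x" "w' \<in> anc (bpar pr) v x" for w w'
    using anc_level[OF d(4) that(3,4)] that(1,2) N_dst by simp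
  have oney: "w = w'" if "w \<in> N" "w' \<in> N" "w \<in> anc (bpar pr) v y" "w' \<in> anc (bpar pr) v y" for w w'
    using anc_level[OF d(5) that(3,4)] that(1,2) N_dst by simp
  have NZ2: "card (N \<inter> Z) \<le> 2"
    by (rule anc_two[OF d(4,5), of _ pr 1 1]) (use d(6) N_dst in blast)
  have "v \<in> U" by (rule v_U)
  then consider "v \<in> L" | "v \<in> R" | "v \<in> Z" using d(1) by blast
  then show ?thesis
  proof cases
    case 1
    have "N \<inter> R = {}" using d2(3)[OF 1] unfolding N_def by blast
    then show ?thesis using simple_strategy[OF s2] NZ2 by simp
  next
    case 2
    have "N \<inter> L = {}" using d(3)[OF 2] unfolding N_def by blast
    then show ?thesis using simple_strategy[OF s] NZ2 by simp
  next
    case 3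
    show ?thesis
    proof (cases "card (N \<inter> Z) + card (N \<inter> L) \<le> 2 \<or> card (N \<inter> Z) + card (N \<inter> R) \<le> 2")
      case True
      then show ?thesis using simple_strategy[OF s] simple_strategy[OF s2] by blast
    next
      case False
      have "N = N \<inter> Z \<union> N \<inter> L \<union> N \<inter> R" using NU d(1) by blast
      then have "card N = card (N \<inter> Z \<union> N \<inter> L \<union> N \<inter> R)" by simp
      also have "\<dots> = card (N \<inter> Z \<union> N \<inter> L) + card (N \<inter> R)"
        by (rule card_Un_disjoint) (use finN LR in auto)
      also have "card (N \<inter> Z \<union> N \<inter> L) = card (N \<inter> Z) + card (N \<inter> L)"
        by (rule card_Un_disjoint) (use finN LR in auto)
      finally have sum: "card N = card (N \<inter> Z) + card (N \<inter> L) + card (N \<inter> R)" .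
      \<comment> \<open>\<open>Z\<close> contains at most two neighbours of \<open>v\<close>. If
        \<open>simple_strategy\<close> fails for both sides, the four neighbours are distributed as
        2, 1, 1.\<close>
      have c: "card (N \<inter> Z) = 2" "card (N \<inter> L) = 1" "card (N \<inter> R) = 1" "card N = 4"
        using sum False NZ2 cN by linarith+
      have h: "inj_on pr N" "\<And>w. w \<in> N \<Longrightarrow> card {u. {w, u} \<in> E} \<le> 4"
        and low: "\<And>wi wj. N \<inter> Z = {wi, wj} \<Longrightarrow> wi \<noteq> wj \<Longrightarrow> pr wi < pr wj \<Longrightarrow> N \<inter> L \<noteq> {} \<Longrightarrow> N \<inter> R \<noteq> {} \<Longrightarrow>
          card {f\<in>N. pr f < pr wi} \<le> 1"
        using cN c(4) by auto
      obtain l where l: "N \<inter> L = {l}" using c(2) card_1_singletonE by blast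
      obtain r where r: "N \<inter> R = {r}" using c(3) card_1_singletonE by blast
      obtain a b where ab: "N \<inter> Z = {a, b}" "a \<noteq> b" using c(1) by (meson card_2_iff)
      have fin: "card V \<le> 4 * sn 2 V E v + 12" if p: "N \<inter> Z = {wi, wj}" "wi \<noteq> wj" "pr wi < pr wj" for wi wj
      proof -
        have w: "wi \<in> N" "wj \<in> N" "wi \<in> Z" "wj \<in> Z" using p(1) by blast+
        have lo: "card {f\<in>N. pr f < pr wi} \<le> 1" by (rule low[OF p]) (use l r in simp_all)
        have "wi \<in> anc (bpar pr) v x \<or> wi \<in> anc (bpar pr) v y" "wj \<in> anc (bpar pr) v x \<or> wj \<in> anc (bpar pr) v y"
          using d(6) w(3,4) by blast+
        then consider "wi \<in> anc (bpar pr) v x" "wj \<in> anc (bpar pr) v y"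
          | "wi \<in> anc (bpar pr) v y" "wj \<in> anc (bpar pr) v x"
          using onex[OF w(1,2)] oney[OF w(1,2)] p(2) by blast
        then show ?thesis
        proof cases
          case 1
          show ?thesis by (rule split_separator_saves_many[OF s 3 p(1,2) 1 p(3) h(1) l r h(2)[OF w(2)] lo])
        next
          case 2
          show ?thesis by (rule split_separator_saves_many[OF sep_swap(2)[OF s] 3 p(1,2) 2 p(3) h(1) l r h(2)[OF w(2)] lo])
        qed
      qed
      have "pr a \<noteq> pr b" using h(1) ab unfolding inj_on_def by blast
      then consider "pr a < pr b" | "pr b < pr a" by linarith
      then show ?thesis
      proof cases
        case 1
        then show ?thesis using fin[OF ab] by blast
      next
        case 2
        have "N \<inter> Z = {b, a}" using ab(1) by (simp add: insert_commute)
        then show ?thesis using fin[of b a] ab(2) 2 by simp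
      qed
    qed
  qed
qed

theorem good_vertex:
  assumes model: "minor_model badj V E B"
    and deg: "card N \<le> 3 \<or> (card N = 4 \<and> (\<forall>w\<in>N. card {u. {w, u} \<in> E} \<le> 4))"
  shows "card V \<le> 4 * sn 2 V E v + 12"
proof -
  have modelU: "minor_model badj U EU B"
    by (rule minor_model_subset[OF model U_V]) (auto simp: EU_def)
  show ?thesis
  proof (cases "card N \<le> 3")
    case True
    obtain Z L R x y where "sep U EU v (bpar (\<lambda>_. 0)) Z L R x y"
      using brick_separator[OF finU modelU bfs_tree] by blast
    from separator_saves_many[OF this] show ?thesis using True by blast
  next
    case False
    then have d4: "card N = 4" "\<And>w. w \<in> N \<Longrightarrow> card {u. {w, u} \<in> E} \<le> 4" using deg by auto
    have NE: "N = {w. {v, w} \<in> EU}" unfolding EU_def using v_U N_dst unfolding N_def by blast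
    have NU: "N \<subseteq> U - {v}" using N_dst dst_v by auto
    obtain N2 where N2: "N2 \<subseteq> N" "card N2 = 2"
      and sp: "\<And>par lev. span_tree U EU v par lev \<Longrightarrow> \<forall>w\<in>N. par w = v \<Longrightarrow>
        \<exists>Z L R x y. sep U EU v par Z L R x y \<and> (N2 \<subseteq> Z \<longrightarrow> N \<inter> L = {} \<or> N \<inter> R = {})"
      using split_separator[OF finU modelU v_U NE NU d4(1)] by blast
    have "card (N - N2) = 2" using d4(1) N2 finN by (simp add: card_Diff_subset finite_subset)
    then obtain c1 c2 where c12: "N - N2 = {c1, c2}" "c1 \<noteq> c2" by (meson card_2_iff)
    obtain c3 c4 where c34: "N2 = {c3, c4}" "c3 \<noteq> c4" using N2(2) by (meson card_2_iff)
    have N4: "N = {c1, c2, c3, c4}" using c12(1) c34(1) N2(1) by blast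
    have ne: "c1 \<noteq> c3" "c1 \<noteq> c4" "c2 \<noteq> c3" "c2 \<noteq> c4" using c12(1) c34(1) by blast+
    \<comment> \<open>The pair \<open>N2\<close> gets the two highest priorities. If both of its
      vertices were on the separator, some side would have no neighbour of \<open>v\<close>.
      Otherwise the lower separator neighbour is \<open>c1\<close> or \<open>c2\<close>, with at
      most one neighbour below it.\<close>
    define pr :: "'a \<Rightarrow> nat" where "pr w = (if w = c1 then 1 else if w = c2 then 2 else if w = c3 then 3 else 4)" for w
    have prv: "pr c1 = 1" "pr c2 = 2" "pr c3 = 3" "pr c4 = 4" unfolding pr_def using c12(2) c34(2) ne by simp_all
    have inj: "inj_on pr N" unfolding N4 using prv by (simp add: inj_on_def)
    have "\<forall>w\<in>N. bpar pr w = v" using bpar_N by blast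
    from sp[OF bfs_tree this] obtain Z L R x y where
      s: "sep U EU v (bpar pr) Z L R x y" and split: "N2 \<subseteq> Z \<longrightarrow> N \<inter> L = {} \<or> N \<inter> R = {}" by blast
    have low: "card {f\<in>N. pr f < pr wi} \<le> 1"
      if w: "N \<inter> Z = {wi, wj}" "wi \<noteq> wj" "pr wi < pr wj" "N \<inter> L \<noteq> {}" "N \<inter> R \<noteq> {}" for wi wj
    proof -
      have nsub: "\<not> {c3, c4} \<subseteq> Z" using split w(4,5) c34(1) by blast
      have wN: "wi \<in> {c1, c2, c3, c4}" "wj \<in> {c1, c2, c3, c4}" using w(1) N4 by blast+
      have "wi = c1 \<or> wi = c2"
      proof (rule ccontr)
        assume "\<not> ?thesis"
        then have "wi = c3 \<or> wi = c4" using wN(1) by blast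
        then have "wi = c3 \<and> wj = c4" using wN(2) w(3) prv by auto
        then show False using nsub w(1) by blast
      qed
      then have "{f\<in>N. pr f < pr wi} \<subseteq> {c1}" unfolding N4 using prv by auto
      then have "card {f\<in>N. pr f < pr wi} \<le> card {c1}" by (rule card_mono[rotated]) simp
      then show ?thesis by simp
    qed
    show ?thesis by (rule separator_saves_many[OF s]) (use d4 inj low in blast)
  qed
qed

text \<open>Makes up for the additive 12 in \<open>good_vertex\<close>, which leaves that bound
  empty when \<open>card V\<close> is at most 12.\<close>

lemma sn_positive:
  assumes "card V \<ge> 2"
  shows "1 \<le> sn 2 V E v"
proof (cases "N = {}")
  case True
  have "card (V - {v}) \<le> sn 2 V E v"
    by (rule timed_protection[of "{}" _ "\<lambda>_. 1"]) (use True in \<open>auto simp: N_def\<close>)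
  moreover have "card (V - {v}) = card V - 1" using v finV by simp
  ultimately show ?thesis using assms by linarith
next
  case False
  then obtain w where w: "w \<in> N" by blast
  then have "w \<in> U" "dst w = 1" using N_dst by blast+
  have "card {w} \<le> sn 2 V E v"
  proof (rule timed_protection[of "{w}" _ dst])
    show "{w} \<subseteq> V" using \<open>w \<in> U\<close> U_V by blast
    show "v \<notin> {w}" using \<open>dst w = 1\<close> dst_v by auto
    show "card {p \<in> {w}. dst p = t} \<le> 2" for t
      by (rule order_trans[OF card_mono[of "{w}"]]) auto
  qed (use \<open>dst w = 1\<close> in simp_all)
  then show ?thesis by simp
qed

end

section \<open>Counting\<close>

lemma degree_sum:
  assumes "simple_graph V E"
  shows "(\<Sum>v\<in>V. card {w. {v, w} \<in> E}) = 2 * card E"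
proof -
  note finE = finite_edges[OF assms]
  have finV: "finite V" using assms unfolding simple_graph_def by blast
  have "card {w. {v, w} \<in> E} = card {e\<in>E. v \<in> e}" for v
  proof -
    have ne: "v \<noteq> w" if "{v, w} \<in> E" for w
    proof
      assume "v = w"
      then have "{v} \<in> E" using that by simp
      then obtain a b where "a \<noteq> b" "{v} = {a, b}" using assms unfolding simple_graph_def by metis
      then show False by (metis doubleton_eq_iff insert_absorb2)
    qed
    have "{e\<in>E. v \<in> e} = (\<lambda>w. {v, w}) ` {w. {v, w} \<in> E}"
    proof
      show "{e\<in>E. v \<in> e} \<subseteq> (\<lambda>w. {v, w}) ` {w. {v, w} \<in> E}"
      proof
        fix e assume e: "e \<in> {e\<in>E. v \<in> e}"
        then obtain a b where ab: "e = {a, b}" using assms unfolding simple_graph_def by blast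
        then have "e = {v, a} \<or> e = {v, b}" using e by auto
        then show "e \<in> (\<lambda>w. {v, w}) ` {w. {v, w} \<in> E}" using e by blast
      qed
    qed blast
    moreover have "inj_on (\<lambda>w. {v, w}) {w. {v, w} \<in> E}"
      by (rule inj_onI) (metis doubleton_eq_iff)
    ultimately show ?thesis by (simp add: card_image)
  qed
  then have "(\<Sum>v\<in>V. card {w. {v, w} \<in> E}) = (\<Sum>v\<in>V. \<Sum>e\<in>E. if v \<in> e then 1 else 0)"
    using finE by (simp add: sum.If_cases Int_def)
  also have "\<dots> = (\<Sum>e\<in>E. \<Sum>v\<in>V. if v \<in> e then 1 else 0)" by (rule sum.swap)
  also have "\<dots> = (\<Sum>e\<in>E. 2)"
  proof (rule sum.cong[OF refl])
    fix e assume e: "e \<in> E"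
    then obtain a b where ab: "a \<in> V" "b \<in> V" "a \<noteq> b" "e = {a, b}" using assms unfolding simple_graph_def by metis
    have "(\<Sum>v\<in>V. if v \<in> e then 1 else 0) = card (V \<inter> e)" using finV by (simp add: sum.If_cases Int_def)
    also have "V \<inter> e = {a, b}" using ab by blast
    finally show "(\<Sum>v\<in>V. if v \<in> e then 1 else 0) = (2::nat)" using ab(3) by simp
  qed
  finally show ?thesis by simp
qed

text \<open>Since the average degree is at most 4, the excess over 4 of the large degrees, and hence
  the number of neighbours of vertices of degree at least 5, is linear in the number of vertices
  of degree at most 3.\<close>

lemma many_good_vertices:
  fixes V :: "'a set" and E :: "'a set set"
  defines "deg \<equiv> \<lambda>v. card {w. {v, w} \<in> E}"
  assumes gr: "simple_graph V E" and e: "card E \<le> 2 * card V"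
  shows "card V \<le> 25 * card {v\<in>V. deg v \<le> 3 \<or> (deg v = 4 \<and> (\<forall>w\<in>{w. {v, w} \<in> E}. deg w \<le> 4))}"
proof -
  let ?G = "{v\<in>V. deg v \<le> 3 \<or> (deg v = 4 \<and> (\<forall>w\<in>{w. {v, w} \<in> E}. deg w \<le> 4))}"
  define Big where "Big = {v\<in>V. deg v \<ge> 5}"
  define Small where "Small = {v\<in>V. deg v \<le> 3}"
  have finV: "finite V" using gr unfolding simple_graph_def by blast
  have fin: "finite Big" "finite Small" "finite ?G" unfolding Big_def Small_def using finV by simp_all
  have ends: "w \<in> V" if "{v, w} \<in> E" for v w using edge_subset[OF gr that] by blast
  have fin_nb: "finite {w. {v, w} \<in> E}" for v by (rule finite_subset[OF _ finV]) (use ends in blast)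
  have "(\<Sum>v\<in>V. int (deg v) - 4) \<le> 0"
  proof -
    have "(\<Sum>v\<in>V. int (deg v)) = int (\<Sum>v\<in>V. deg v)" by simp
    also have "\<dots> = 2 * int (card E)" unfolding deg_def degree_sum[OF gr] by simp
    finally have "(\<Sum>v\<in>V. int (deg v)) = 2 * int (card E)" .
    then show ?thesis using e by (simp add: sum_subtractf)
  qed
  \<comment> \<open>Degree 4 contributes 0, and a vertex of \<open>Small\<close> contributes at
    least -4.\<close>
  moreover have "(\<Sum>v\<in>Big. int (deg v) - 4) - 4 * int (card Small) \<le> (\<Sum>v\<in>V. int (deg v) - 4)"
  proof -
    have "(\<Sum>v\<in>Big. int (deg v) - 4) - 4 * int (card Small) =
      (\<Sum>v\<in>V. if v \<in> Big then int (deg v) - 4 else 0) + (\<Sum>v\<in>V. if v \<in> Small then -4 else 0)"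
    proof -
      have "V \<inter> Big = Big" "V \<inter> Small = Small" unfolding Big_def Small_def by blast+
      then have "(\<Sum>v\<in>V. if v \<in> Big then int (deg v) - 4 else 0) = (\<Sum>v\<in>Big. int (deg v) - 4)"
        "(\<Sum>v\<in>V. if v \<in> Small then -4 else 0 :: int) = (\<Sum>v\<in>Small. -4)"
        using finV by (simp_all only: sum.inter_restrict[symmetric])
      then show ?thesis by simp
    qed
    also have "\<dots> = (\<Sum>v\<in>V. (if v \<in> Big then int (deg v) - 4 else 0) + (if v \<in> Small then -4 else 0))"
      by (simp only: sum.distrib)
    also have "\<dots> \<le> (\<Sum>v\<in>V. int (deg v) - 4)"
      by (rule sum_mono) (auto simp: Big_def Small_def)
    finally show ?thesis .
  qed
  ultimately have excess: "(\<Sum>v\<in>Big. int (deg v) - 4) \<le> 4 * int (card Small)" by linarith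
  have "V - ?G \<subseteq> (\<Union>b\<in>Big. insert b {w. {b, w} \<in> E})"
  proof
    fix v assume v: "v \<in> V - ?G"
    show "v \<in> (\<Union>b\<in>Big. insert b {w. {b, w} \<in> E})"
    proof (cases "deg v \<ge> 5")
      case True
      then show ?thesis using v unfolding Big_def by blast
    next
      case False
      then obtain w where w: "{v, w} \<in> E" "\<not> deg w \<le> 4" using v by fastforce
      then have "w \<in> Big" unfolding Big_def using ends by simp
      moreover have "{w, v} \<in> E" using w(1) by (simp add: insert_commute)
      ultimately show ?thesis by blast
    qed
  qed
  then have "card (V - ?G) \<le> card (\<Union>b\<in>Big. insert b {w. {b, w} \<in> E})"
    by (rule card_mono[rotated]) (use fin(1) fin_nb in blast)
  also have "\<dots> \<le> (\<Sum>b\<in>Big. card (insert b {w. {b, w} \<in> E}))" by (rule card_UN_le[OF fin(1)])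
  also have "\<dots> \<le> (\<Sum>b\<in>Big. Suc (deg b))"
    by (rule sum_mono) (use fin_nb in \<open>simp add: card_insert_if deg_def\<close>)
  finally have "int (card (V - ?G)) \<le> int (\<Sum>b\<in>Big. Suc (deg b))" by (simp only: of_nat_le_iff)
  also have "\<dots> = (\<Sum>b\<in>Big. int (Suc (deg b)))" by (rule of_nat_sum)
  \<comment> \<open>For \<open>d\<close> at least 5, \<open>d + 1\<close> is at most
    \<open>6 * (d - 4)\<close>, with equality at 5. With the excess bound this makes 24 vertices per
    small vertex, and the good vertices themselves raise it to 25.\<close>
  also have "\<dots> \<le> (\<Sum>b\<in>Big. 6 * (int (deg b) - 4))"
    by (rule sum_mono) (simp add: Big_def)
  also have "\<dots> = 6 * (\<Sum>b\<in>Big. int (deg b) - 4)" by (simp only: sum_distrib_left)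
  also have "\<dots> \<le> 24 * int (card Small)" using excess by simp
  finally have "card (V - ?G) \<le> 24 * card Small" by simp
  moreover have "card Small \<le> card ?G" by (rule card_mono[OF fin(3)]) (auto simp: Small_def)
  moreover have sub: "?G \<subseteq> V" by (rule Collect_subset)
  have "card (V - ?G) = card V - card ?G" by (rule card_Diff_subset[OF fin(3) sub])
  moreover have "card ?G \<le> card V" by (rule card_mono[OF finV sub])
  ultimately show ?thesis by linarith
qed

theorem theorem4:
  fixes V :: "'a set" and E :: "'a set set"
  assumes "simple_graph V E"
    and "triangle_free V E"
    and "planar V E"
    and "card V \<ge> 2"
  shows "surviving_rate 2 V E \<ge> 1 / 723636"
proof -
  obtain B where B: "minor_model gadj V E B" using planar_minor_model[OF assms(1,3)] by blast
  have brick: "minor_model badj V E (\<lambda>v. halve -` B v)" by (rule brick_model[OF B])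
  have eb: "card E \<le> 2 * card V" by (rule edge_bound[OF assms(1,2) B])
  let ?deg = "\<lambda>v. card {w. {v, w} \<in> E}"
  define G where "G = {v\<in>V. ?deg v \<le> 3 \<or> (?deg v = 4 \<and> (\<forall>w\<in>{w. {v, w} \<in> E}. ?deg w \<le> 4))}"
  have cG: "card V \<le> 25 * card G" unfolding G_def by (rule many_good_vertices[OF assms(1) eb])
  have finV: "finite V" using assms(1) unfolding simple_graph_def by blast
  have G: "card V \<le> 16 * sn 2 V E v" if vG: "v \<in> G" for v
  proof -
    interpret fire V E v by unfold_locales (use assms(1) vG in \<open>simp_all add: G_def\<close>)
    have "card V \<le> 4 * sn 2 V E v + 12"
      by (rule good_vertex[OF brick]) (use vG in \<open>simp add: G_def N_def\<close>)
    moreover have "1 \<le> sn 2 V E v" by (rule sn_positive[OF assms(4)])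
    ultimately show ?thesis by linarith
  qed
  have "real (card V) * real (card V) \<le> 25 * real (card G) * real (card V)"
    using cG by (intro mult_right_mono) simp_all
  also have "\<dots> = 25 * (\<Sum>v\<in>G. real (card V))" by simp
  also have "(\<Sum>v\<in>G. real (card V)) \<le> (\<Sum>v\<in>G. 16 * real (sn 2 V E v))"
  proof (rule sum_mono)
    fix v assume "v \<in> G"
    from G[OF this] show "real (card V) \<le> 16 * real (sn 2 V E v)" by linarith
  qed
  also have "\<dots> \<le> (\<Sum>v\<in>V. 16 * real (sn 2 V E v))"
    by (rule sum_mono2[OF finV]) (auto simp: G_def)
  also have "\<dots> = 16 * (\<Sum>v\<in>V. real (sn 2 V E v))" by (simp add: sum_distrib_left)
  \<comment> \<open>The factor 400 is 25 from the share of good vertices times 16, where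
    \<open>4 * sn + 12\<close> is at most \<open>16 * sn\<close> because \<open>sn\<close> is
    positive.\<close>
  finally have "(real (card V))\<^sup>2 \<le> 400 * (\<Sum>v\<in>V. real (sn 2 V E v))" by (simp add: power2_eq_square)
  moreover have "(real (card V))\<^sup>2 > 0" using assms(4) by simp
  ultimately have "1 / 400 \<le> surviving_rate 2 V E"
    unfolding surviving_rate_def by (simp add: field_simps)
  then show ?thesis by simp
qed

end
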